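(* Let $G=(V,E)$ be a simple undirected connected graph with $n$ vertices and $m$ edges, given by adjacency lists, and let $k$ be an integer with $2\le k\le n$. Let $\mathcal{S}_k(G)=\{G[V'] : V'\subseteq V,\ |V'|=k,\ G[V'] \text{ is connected}\}$. There is an algorithm that lists every $G[V']\in\mathcal{S}_k(G)$ exactly once (outputting its edge set $E[V']$) in $O\big(\sum_{G[V']\in\mathcal{S}_k(G)}|E[V']|\big)$ time.
   Context: For $V'\subseteq V$, $E[V']=\{(u,v)\in E: u,v\in V'\}$ and $G[V']=(V',E[V'])$ is the subgraph induced by $V'$. The elements of $\mathcal{S}_k(G)$ are called $k$-subgraphs. Running times are in the standard RAM model. *)

theory Defs
  imports Main
begin

section \<open>Simple undirected graphs\<close>

text \<open>A graph is a pair of a vertex set and an edge set; an undirected edge joining u and v is the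
  two-element set {u, v}, so the cardinality of an edge set counts every edge once.\<close>

type_synonym 'a ugraph = "'a set \<times> 'a set set"

definition simple_graph :: "'a ugraph \<Rightarrow> bool" where
  "simple_graph G \<longleftrightarrow> finite (fst G) \<and>
     (\<forall>e \<in> snd G. \<exists>u \<in> fst G. \<exists>v \<in> fst G. u \<noteq> v \<and> e = {u, v})"

definition connected_graph :: "'a ugraph \<Rightarrow> bool" where
  "connected_graph G \<longleftrightarrow> fst G \<noteq> {} \<and>
     (\<forall>u \<in> fst G. \<forall>v \<in> fst G. (u, v) \<in> {(x, y). {x, y} \<in> snd G}\<^sup>*)"

definition induced_edges :: "'a ugraph \<Rightarrow> 'a set \<Rightarrow> 'a set set" where
  "induced_edges G V' = {{u, v} | u v. {u, v} \<in> snd G \<and> u \<in> V' \<and> v \<in> V'}"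

definition induced_subgraph :: "'a ugraph \<Rightarrow> 'a set \<Rightarrow> 'a ugraph" where
  "induced_subgraph G V' = (V', induced_edges G V')"

definition k_subgraphs :: "nat \<Rightarrow> 'a ugraph \<Rightarrow> 'a ugraph set" where
  "k_subgraphs k G =
     {induced_subgraph G V' | V'. V' \<subseteq> fst G \<and> card V' = k \<and> connected_graph (induced_subgraph G V')}"

section \<open>Random access machines\<close>

text \<open>A machine has registers, which instructions name directly, and a random access memory, which
  is addressed through registers. Its program is a fixed finite list of instructions, and every
  instruction takes one unit of time.

  Words are the natural numbers below a capacity W. An instruction whose result does not fit into
  a word has no successor configuration, so a run that reaches Halt has never overflowed and does
  not depend on any overflow convention. Subtraction is truncated at 0; division rounds down and yields 0 if the divisor is 0.\<close>

type_synonym reg = nat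

datatype instr =
    LoadConst reg nat
  | Move reg reg
  | Add reg reg reg
  | Sub reg reg reg
  | Mul reg reg reg
  | Div reg reg reg
  | Load reg reg
  | Store reg reg
  | Jump nat
  | JumpZero reg nat
  | Output reg
  | Halt

record config =
  pc :: nat
  regs :: "reg \<Rightarrow> nat"
  mem :: "nat \<Rightarrow> nat"
  outp :: "nat list"

definition set_reg :: "nat \<Rightarrow> reg \<Rightarrow> nat \<Rightarrow> config \<Rightarrow> config option" where
  "set_reg W r x s =
     (if x < W then Some (s\<lparr>pc := pc s + 1, regs := (regs s)(r := x)\<rparr>) else None)"

fun exec_instr :: "nat \<Rightarrow> instr \<Rightarrow> config \<Rightarrow> config option" where
  "exec_instr W (LoadConst r x) s = set_reg W r x s"
| "exec_instr W (Move r a) s = set_reg W r (regs s a) s"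
| "exec_instr W (Add r a b) s = set_reg W r (regs s a + regs s b) s"
| "exec_instr W (Sub r a b) s = set_reg W r (regs s a - regs s b) s"
| "exec_instr W (Mul r a b) s = set_reg W r (regs s a * regs s b) s"
| "exec_instr W (Div r a b) s = set_reg W r (regs s a div regs s b) s"
| "exec_instr W (Load r a) s = set_reg W r (mem s (regs s a)) s"
| "exec_instr W (Store a b) s =
     Some (s\<lparr>pc := pc s + 1, mem := (mem s)(regs s a := regs s b)\<rparr>)"
| "exec_instr W (Jump l) s = Some (s\<lparr>pc := l\<rparr>)"
| "exec_instr W (JumpZero a l) s = Some (s\<lparr>pc := (if regs s a = 0 then l else pc s + 1)\<rparr>)"
| "exec_instr W (Output a) s = Some (s\<lparr>pc := pc s + 1, outp := outp s @ [regs s a]\<rparr>)"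
| "exec_instr W Halt s = None"

definition ram_step :: "nat \<Rightarrow> instr list \<Rightarrow> (config \<times> config) set" where
  "ram_step W P = {(s, s'). pc s < length P \<and> exec_instr W (P ! pc s) s = Some s'}"

definition halted :: "instr list \<Rightarrow> config \<Rightarrow> bool" where
  "halted P s \<longleftrightarrow> pc s < length P \<and> P ! pc s = Halt"

definition init_config :: "nat list \<Rightarrow> config" where
  "init_config xs =
     \<lparr>pc = 0, regs = (\<lambda>_. 0), mem = (\<lambda>a. if a < length xs then xs ! a else 0), outp = []\<rparr>"

text \<open>With word capacity W and input xs, the program P halts after exactly t steps, having written
  the words ys.\<close>

definition ram_run :: "nat \<Rightarrow> instr list \<Rightarrow> nat list \<Rightarrow> nat \<Rightarrow> nat list \<Rightarrow> bool" where
  "ram_run W P xs t ys \<longleftrightarrow>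
     (\<exists>s. (init_config xs, s) \<in> ram_step W P ^^ t \<and> halted P s \<and> outp s = ys)"

section \<open>Input and output conventions\<close>

text \<open>The order of the neighbours in an adjacency list is arbitrary.\<close>

definition adjacency_lists :: "nat ugraph \<Rightarrow> nat list list \<Rightarrow> bool" where
  "adjacency_lists G adj \<longleftrightarrow> fst G = {0..<length adj} \<and>
     (\<forall>v < length adj. distinct (adj ! v) \<and> set (adj ! v) = {u. {u, v} \<in> snd G})"

text \<open>Memory layout of the input for n vertices: n in cell 0, k in cell 1, and from cell n + 3 on the
  adjacency lists one after the other. For v < n, cell v + 2 holds the address at which the
  list of v starts; cell n + 2 holds the first address after the last list.\<close>

definition encode_input :: "nat \<Rightarrow> nat list list \<Rightarrow> nat list" where
  "encode_input k adj =
     [length adj, k] @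
     map (\<lambda>v. length adj + 3 + length (concat (take v adj))) [0..<length adj + 1] @
     concat adj"

definition lists_edges :: "(nat \<times> nat) list \<Rightarrow> nat set set \<Rightarrow> bool" where
  "lists_edges es F \<longleftrightarrow>
     distinct (map (\<lambda>(u, v). {u, v}) es) \<and> set (map (\<lambda>(u, v). {u, v}) es) = F"

text \<open>The length prefix makes the output format uniquely decodable.\<close>

definition encode_edges :: "(nat \<times> nat) list \<Rightarrow> nat list" where
  "encode_edges es = length es # concat (map (\<lambda>(u, v). [u, v]) es)"

definition lists_exactly_once :: "nat list \<Rightarrow> nat ugraph set \<Rightarrow> bool" where
  "lists_exactly_once ys S \<longleftrightarrow>
     (\<exists>Hs ess. distinct Hs \<and> set Hs = S \<and>
        list_all2 (\<lambda>H es. lists_edges es (snd H)) Hs ess \<and>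
        ys = concat (map encode_edges ess))"

end

theory Submission
  imports Defs
begin

text \<open>A search node is a connected set S of included vertices and a set X of excluded vertices such that
  S extends to a solution, that is, to a connected k-set that avoids X; such a solution T, the witness,
  comes with the node. As long as S has fewer than k - 1 vertices, a vertex v of T that is adjacent to S
  is chosen and the node splits into excluding v and including v. Including v keeps the witness.
  Excluding v is possible iff a search from S in the graph without X and v finds k vertices. If it does,
  these are the witness of the new node. If it does not, the explored set A is kept, v is added to it,
  and the next v is taken from T outside A, where the search goes on, so a run of failures costs no more
  than one search. If T is contained in A, the run is stuck and A is reset to S. Unless T is a whole
  component (and then the only solution), the vertex added last has a neighbour outside T; it is in S
  from then on, so this neighbour is explored in all later runs and keeps them from being stuck. At
  |S| = k - 1 the solutions are S + w for the neighbours w of S.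

  A search sees only edges inside the k-set that it finds, and this set is the witness of exactly one
  chain of inclusions; the chain ends in a base case that lists it, so each solution pays for a bounded
  number of searches. Deleting v from the adjacency lists costs its degree outside X. Every neighbour
  of v outside X lies in some solution below the including child, and a solution includes each of its
  vertices only once, so deletions cost at most the sum of its degrees per solution.\<close>

section \<open>A structured language over the random access machine\<close>

text \<open>One search per node would be too much: a chain of inclusions may lead to a single
  solution, whose edges pay only for a bounded number of searches. Stuck runs are affordable because
  such a run has explored exactly the witness, and because at most two of them occur for one
  witness. The accounting is amortised: a node finishes within its \<open>potential\<close> and
  leaves its \<open>credit\<close> unspent. The coefficients are found backwards: 50 exceeds the
  price of a unit of search, 300 covers a stuck run, 400 a successful search with the run before it,
  1500 all of these and the output of a base case, and 16 the unlinking and relinking of a list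
  entry. S must be nonempty, so the vertices serve as roots one after the other and are then
  deleted. This may disconnect the graph; vertices in components with fewer than \<open>k\<close>
  vertices are marked once and skipped. Memory is zero at the start, so the adjacency matrix costs
  one store per list entry. The machine has no procedure calls: the recursion is a loop over single
  node steps with a stack.\<close>

datatype atom =
    AConst nat nat
  | AMove nat nat
  | AAdd nat nat nat
  | ASub nat nat nat
  | AIn nat nat
  | AGet nat nat nat nat
  | APut nat nat nat nat
  | AOut nat

datatype com =
    Skip
  | Atom atom
  | Seq com com  (infixr ";;" 60)
  | IfNZ nat com com
  | WhileNZ nat com

text \<open>Time is a ghost counter, bounded from below by an eighth of the machine steps.\<close>

record hstate =
  rg :: "nat \<Rightarrow> nat"
  ar :: "nat \<Rightarrow> nat \<Rightarrow> nat \<Rightarrow> nat"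
  ou :: "nat list"
  tm :: nat

definition tick :: "hstate \<Rightarrow> hstate" where
  "tick \<sigma> = \<sigma>\<lparr>tm := Suc (tm \<sigma>)\<rparr>"

definition setr :: "nat \<Rightarrow> nat \<Rightarrow> hstate \<Rightarrow> hstate" where
  "setr r x \<sigma> = \<sigma>\<lparr>rg := (rg \<sigma>)(r := x), tm := Suc (tm \<sigma>)\<rparr>"

definition update2 :: "(nat \<Rightarrow> nat \<Rightarrow> nat) \<Rightarrow> nat \<Rightarrow> nat \<Rightarrow> nat \<Rightarrow> nat \<Rightarrow> nat \<Rightarrow> nat" where
  "update2 g i j x = (\<lambda>i' j'. if i' = i \<and> j' = j then x else g i' j')"

definition setm :: "nat \<Rightarrow> nat \<Rightarrow> nat \<Rightarrow> nat \<Rightarrow> hstate \<Rightarrow> hstate" where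
  "setm a i j x \<sigma> = \<sigma>\<lparr>ar := (ar \<sigma>)(a := update2 (ar \<sigma> a) i j x), tm := Suc (tm \<sigma>)\<rparr>"

definition putout :: "nat \<Rightarrow> hstate \<Rightarrow> hstate" where
  "putout x \<sigma> = \<sigma>\<lparr>ou := ou \<sigma> @ [x], tm := Suc (tm \<sigma>)\<rparr>"

lemma state_simps [simp]:
  "rg (tick \<sigma>) = rg \<sigma>" "ar (tick \<sigma>) = ar \<sigma>" "ou (tick \<sigma>) = ou \<sigma>" "tm (tick \<sigma>) = Suc (tm \<sigma>)"
  "rg (setr r x \<sigma>) = (rg \<sigma>)(r := x)" "ar (setr r x \<sigma>) = ar \<sigma>" "ou (setr r x \<sigma>) = ou \<sigma>"
  "tm (setr r x \<sigma>) = Suc (tm \<sigma>)"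
  "rg (setm a i j x \<sigma>) = rg \<sigma>" "ar (setm a i j x \<sigma>) = (ar \<sigma>)(a := update2 (ar \<sigma> a) i j x)"
  "ou (setm a i j x \<sigma>) = ou \<sigma>" "tm (setm a i j x \<sigma>) = Suc (tm \<sigma>)"
  "rg (putout x \<sigma>) = rg \<sigma>" "ar (putout x \<sigma>) = ar \<sigma>" "ou (putout x \<sigma>) = ou \<sigma> @ [x]"
  "tm (putout x \<sigma>) = Suc (tm \<sigma>)"
  by (simp_all add: tick_def setr_def setm_def putout_def)

fun atom_effect :: "nat list \<Rightarrow> atom \<Rightarrow> hstate \<Rightarrow> hstate" where
  "atom_effect inp (AConst r x) \<sigma> = setr r x \<sigma>"
| "atom_effect inp (AMove r a) \<sigma> = setr r (rg \<sigma> a) \<sigma>"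
| "atom_effect inp (AAdd r a b) \<sigma> = setr r (rg \<sigma> a + rg \<sigma> b) \<sigma>"
| "atom_effect inp (ASub r a b) \<sigma> = setr r (rg \<sigma> a - rg \<sigma> b) \<sigma>"
| "atom_effect inp (AIn r a) \<sigma> = setr r (inp ! rg \<sigma> a) \<sigma>"
| "atom_effect inp (AGet r a i j) \<sigma> = setr r (ar \<sigma> a (rg \<sigma> i) (rg \<sigma> j)) \<sigma>"
| "atom_effect inp (APut a i j r) \<sigma> = setm a (rg \<sigma> i) (rg \<sigma> j) (rg \<sigma> r) \<sigma>"
| "atom_effect inp (AOut a) \<sigma> = putout (rg \<sigma> a) \<sigma>"

text \<open>Only constants and sums can create a value of \<open>B\<close> or more, so only they
  carry a bound; the other atoms copy or decrease values that are below \<open>B\<close> already.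
  The second array index is limited because of the stride in the address; the first one is an
  arbitrary value below \<open>B\<close>.\<close>

fun atom_safe :: "nat \<Rightarrow> nat \<Rightarrow> nat list \<Rightarrow> atom \<Rightarrow> hstate \<Rightarrow> bool" where
  "atom_safe N B inp (AConst r x) \<sigma> \<longleftrightarrow> x < B"
| "atom_safe N B inp (AMove r a) \<sigma> \<longleftrightarrow> True"
| "atom_safe N B inp (AAdd r a b) \<sigma> \<longleftrightarrow> rg \<sigma> a + rg \<sigma> b < B"
| "atom_safe N B inp (ASub r a b) \<sigma> \<longleftrightarrow> True"
| "atom_safe N B inp (AIn r a) \<sigma> \<longleftrightarrow> rg \<sigma> a < length inp"
| "atom_safe N B inp (AGet r a i j) \<sigma> \<longleftrightarrow> a < 16 \<and> rg \<sigma> j \<le> N"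
| "atom_safe N B inp (APut a i j r) \<sigma> \<longleftrightarrow> a < 16 \<and> rg \<sigma> j \<le> N"
| "atom_safe N B inp (AOut a) \<sigma> \<longleftrightarrow> True"

inductive big_step :: "nat \<Rightarrow> nat \<Rightarrow> nat list \<Rightarrow> com \<Rightarrow> hstate \<Rightarrow> hstate \<Rightarrow> bool" for N B inp where
  skip: "big_step N B inp Skip \<sigma> \<sigma>"
| ex_atom: "atom_safe N B inp a \<sigma> \<Longrightarrow> big_step N B inp (Atom a) \<sigma> (atom_effect inp a \<sigma>)"
| ex_seq: "big_step N B inp c \<sigma> \<sigma>1 \<Longrightarrow> big_step N B inp c' \<sigma>1 \<sigma>2 \<Longrightarrow> big_step N B inp (c ;; c') \<sigma> \<sigma>2"
| ex_if1: "rg \<sigma> r \<noteq> 0 \<Longrightarrow> big_step N B inp c (tick \<sigma>) \<sigma>1 \<Longrightarrow> big_step N B inp (IfNZ r c c') \<sigma> \<sigma>1"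
| ex_if2: "rg \<sigma> r = 0 \<Longrightarrow> big_step N B inp c' (tick \<sigma>) \<sigma>1 \<Longrightarrow> big_step N B inp (IfNZ r c c') \<sigma> \<sigma>1"
| ex_wh1: "rg \<sigma> r \<noteq> 0 \<Longrightarrow> big_step N B inp c (tick \<sigma>) \<sigma>1 \<Longrightarrow> big_step N B inp (WhileNZ r c) \<sigma>1 \<sigma>2
     \<Longrightarrow> big_step N B inp (WhileNZ r c) \<sigma> \<sigma>2"
| ex_wh2: "rg \<sigma> r = 0 \<Longrightarrow> big_step N B inp (WhileNZ r c) \<sigma> (tick \<sigma>)"

inductive_cases ex_skipE: "big_step N B inp Skip \<sigma> \<sigma>'"
inductive_cases ex_atomE: "big_step N B inp (Atom a) \<sigma> \<sigma>'"
inductive_cases ex_seqE: "big_step N B inp (c ;; c') \<sigma> \<sigma>'"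
inductive_cases ex_ifE: "big_step N B inp (IfNZ r c c') \<sigma> \<sigma>'"

subsection \<open>Compilation\<close>

text \<open>Machine registers 0 to 7 are scratch registers and constants for address arithmetic. Array a
  occupies the cells that are congruent to a modulo 16, above the input; the stride N + 1 makes the
  address injective for second indices up to N.\<close>

definition target_reg :: "nat \<Rightarrow> nat" where "target_reg r = r + 8"

definition address_code :: "nat \<Rightarrow> nat \<Rightarrow> nat \<Rightarrow> instr list" where
  "address_code a i j = [Mul 0 (target_reg i) 1, Add 0 0 (target_reg j), Add 0 0 2, Mul 0 0 3, LoadConst 4 a, Add 0 0 4]"

fun compile_atom :: "atom \<Rightarrow> instr list" where
  "compile_atom (AConst r x) = [LoadConst (target_reg r) x]"
| "compile_atom (AMove r a) = [Move (target_reg r) (target_reg a)]"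
| "compile_atom (AAdd r a b) = [Add (target_reg r) (target_reg a) (target_reg b)]"
| "compile_atom (ASub r a b) = [Sub (target_reg r) (target_reg a) (target_reg b)]"
| "compile_atom (AIn r a) = [Load (target_reg r) (target_reg a)]"
| "compile_atom (AGet r a i j) = address_code a i j @ [Load (target_reg r) 0]"
| "compile_atom (APut a i j r) = address_code a i j @ [Store 0 (target_reg r)]"
| "compile_atom (AOut a) = [Output (target_reg a)]"

text \<open>Forward jumps need the length of code that is not yet generated. It does not depend on
  the load address, so it can be computed before \<open>compile\<close>.\<close>

fun code_length :: "com \<Rightarrow> nat" where
  "code_length Skip = 0"
| "code_length (Atom a) = length (compile_atom a)"
| "code_length (c ;; c') = code_length c + code_length c'"
| "code_length (IfNZ r c c') = code_length c + code_length c' + 2"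
| "code_length (WhileNZ r c) = code_length c + 2"

fun compile :: "nat \<Rightarrow> com \<Rightarrow> instr list" where
  "compile l Skip = []"
| "compile l (Atom a) = compile_atom a"
| "compile l (c ;; c') = compile l c @ compile (l + code_length c) c'"
| "compile l (IfNZ r c c') = JumpZero (target_reg r) (l + code_length c + 2) # compile (l + 1) c
     @ Jump (l + code_length c + code_length c' + 2) # compile (l + code_length c + 2) c'"
| "compile l (WhileNZ r c) = JumpZero (target_reg r) (l + code_length c + 2) # compile (l + 1) c @ [Jump l]"

lemma length_comp [simp]: "length (compile l c) = code_length c"
  by (induction c arbitrary: l) auto

section \<open>Simulation of the structured language by the machine\<close>

definition code_at :: "instr list \<Rightarrow> nat \<Rightarrow> instr list \<Rightarrow> bool" where
  "code_at P l cs \<longleftrightarrow> (\<exists>as bs. P = as @ cs @ bs \<and> length as = l)"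

lemma code_at_Nil [simp]: "code_at P l [] \<longleftrightarrow> l \<le> length P"
proof
  assume "l \<le> length P"
  then have "P = take l P @ [] @ drop l P \<and> length (take l P) = l" by simp
  then show "code_at P l []" unfolding code_at_def by blast
qed (auto simp: code_at_def)

lemma code_at_Cons: "code_at P l (c # cs) \<Longrightarrow> l < length P \<and> P ! l = c \<and> code_at P (l + 1) cs"
proof -
  assume "code_at P l (c # cs)"
  then obtain as bs where "P = as @ (c # cs) @ bs" "length as = l" unfolding code_at_def by blast
  moreover from this have "P = (as @ [c]) @ cs @ bs \<and> length (as @ [c]) = l + 1" by simp
  ultimately show ?thesis unfolding code_at_def by (metis append_Cons length_append
    less_add_same_cancel1 list.size(4) nth_append_length zero_less_Suc add_Suc_right)
qed

lemma code_at_append: "code_at P l (cs @ ds) \<Longrightarrow> code_at P l cs \<and> code_at P (l + length cs) ds"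
proof -
  assume "code_at P l (cs @ ds)"
  then obtain as bs where "P = as @ (cs @ ds) @ bs" "length as = l" unfolding code_at_def by blast
  then have "P = as @ cs @ (ds @ bs) \<and> length as = l"
     "P = (as @ cs) @ ds @ bs \<and> length (as @ cs) = l + length cs" by simp_all
  then show ?thesis unfolding code_at_def by blast
qed

text \<open>Every instruction has to advance \<open>pc\<close> by one: this is execution of
  straight-line code, for which the number of steps is the length of the list.\<close>

fun exec_list :: "nat \<Rightarrow> instr list \<Rightarrow> config \<Rightarrow> config option" where
  "exec_list W [] s = Some s"
| "exec_list W (i # is) s = (case exec_instr W i s of None \<Rightarrow> None
     | Some s1 \<Rightarrow> if pc s1 = pc s + 1 then exec_list W is s1 else None)"

lemma exec_list_steps:
  "code_at P (pc s) is \<Longrightarrow> exec_list W is s = Some s' \<Longrightarrow>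
   (s, s') \<in> ram_step W P ^^ length is \<and> pc s' = pc s + length is"
proof (induction "is" arbitrary: s)
  case Nil
  then show ?case by simp
next
  case (Cons i "is")
  then obtain s1 where s1: "exec_instr W i s = Some s1" "pc s1 = pc s + 1" "exec_list W is s1 = Some s'"
    by (auto split: option.splits if_splits)
  have c: "pc s < length P" "P ! pc s = i" "code_at P (pc s1) is"
    using code_at_Cons[OF Cons.prems(1)] s1(2) by auto
  have "(s, s1) \<in> ram_step W P"
    using c s1 by (auto simp: ram_step_def)
  moreover have "(s1, s') \<in> ram_step W P ^^ length is \<and> pc s' = pc s1 + length is"
    using Cons.IH[OF c(3) s1(3)] .
  ultimately show ?case
    using s1(2) relpow_Suc_I2[of s s1 "ram_step W P" s' "length is"] by (simp del: relpow.simps)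
qed

text \<open>\<open>W_large\<close> makes the last cell of the last array addressable for row indices
  below \<open>B\<close>. The bound \<open>N * N + 3\<close> is the length of an input with
  \<open>N + 3\<close> header cells and at most \<open>N - 1\<close> entries in each of
  \<open>N\<close> lists.\<close>

locale layout =
  fixes W N B :: nat and inp :: "nat list"
  assumes W_large: "16 * (B * (N + 1) + N + N * N + 4) \<le> W"
    and inp_len: "length inp \<le> N * N + 3"
    and inp_bd: "\<forall>x \<in> set inp. x < B"
begin

definition address :: "nat \<Rightarrow> nat \<Rightarrow> nat \<Rightarrow> nat" where
  "address a i j = (i * (N + 1) + j + (N * N + 3)) * 16 + a"

lemma address_inj:
  assumes "address a i j = address a' i' j'" "a < 16" "a' < 16" "j \<le> N" "j' \<le> N"
  shows "a = a' \<and> i = i' \<and> j = j'"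
proof -
  have a: "address a i j mod 16 = a" "address a' i' j' mod 16 = a'"
    using assms(2,3) unfolding address_def by (simp_all only: mod_mult_self3 mod_less)
  then have "a = a'" using assms(1) by simp
  then have e: "i * (N + 1) + j = i' * (N + 1) + j'"
    using assms(1) by (simp add: address_def)
  have "(i * (N + 1) + j) mod (N + 1) = j" "(i' * (N + 1) + j') mod (N + 1) = j'"
    using assms(4,5) by (metis add.commute le_imp_less_Suc mod_less mod_mult_self3 mult.commute Suc_eq_plus1)+
  then have "j = j'" using e by simp
  moreover from this have "i * (N + 1) = i' * (N + 1)" using e by linarith
  then have "i = i'" by (metis mult_cancel2 Suc_eq_plus1 nat.distinct(1))
  ultimately show ?thesis using \<open>a = a'\<close> by simp
qed

lemma address_ge_input: "length inp \<le> address a i j"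
proof -
  have "N * N + 3 \<le> address a i j" unfolding address_def by simp
  then show ?thesis using inp_len by linarith
qed

lemma address_less:
  assumes "i < B" "j \<le> N" "a < 16"
  shows "address a i j < W"
proof -
  have "i * (N + 1) \<le> B * (N + 1)" using assms(1) by (intro mult_le_mono1) simp
  then have "i * (N + 1) + j + (N * N + 3) + 1 \<le> B * (N + 1) + N + N * N + 4"
    using assms(2) by simp
  moreover have "x * 16 + 16 \<le> W" if "x + 1 \<le> y" "16 * y \<le> W" for x y :: nat
    using that by linarith
  ultimately have "(i * (N + 1) + j + (N * N + 3)) * 16 + 16 \<le> W" using W_large by blast
  then show ?thesis using assms(3) unfolding address_def by linarith
qed

lemma W_ge: "16 * B + 16 * N + 16 * (N * N) + 64 \<le> W"
proof -
  have "16 * B + 16 * N + 16 * (N * N) + 64 \<le> 16 * (B * (N + 1) + N + N * N + 4)" by simp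
  then show ?thesis using W_large by (rule le_trans)
qed

lemma B_le_W: "B + 20 \<le> W"
  using W_ge by linarith

definition bdd :: "hstate \<Rightarrow> bool" where
  "bdd \<sigma> \<longleftrightarrow> (\<forall>r. rg \<sigma> r < B) \<and> (\<forall>a i j. ar \<sigma> a i j < B)"

definition rel :: "hstate \<Rightarrow> config \<Rightarrow> bool" where
  "rel \<sigma> s \<longleftrightarrow> bdd \<sigma> \<and> (\<forall>r. regs s (target_reg r) = rg \<sigma> r) \<and> outp s = ou \<sigma>
     \<and> (\<forall>a < length inp. mem s a = inp ! a)
     \<and> (\<forall>a i j. a < 16 \<longrightarrow> j \<le> N \<longrightarrow> mem s (address a i j) = ar \<sigma> a i j)
     \<and> regs s 1 = N + 1 \<and> regs s 2 = N * N + 3 \<and> regs s 3 = 16"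

lemma target_reg_simps [simp]: "target_reg r = target_reg r' \<longleftrightarrow> r = r'" "target_reg r \<noteq> 0" "target_reg r \<noteq> Suc 0" "target_reg r \<noteq> 2"
   "target_reg r \<noteq> 3" "target_reg r \<noteq> 4" "0 \<noteq> target_reg r" "Suc 0 \<noteq> target_reg r" "2 \<noteq> target_reg r" "3 \<noteq> target_reg r" "4 \<noteq> target_reg r"
  by (auto simp: target_reg_def)

lemma rel_tick: "rel \<sigma> s \<Longrightarrow> rel (tick \<sigma>) (s\<lparr>pc := l\<rparr>)"
  unfolding rel_def tick_def bdd_def by auto

lemma rel_rg: "rel \<sigma> s \<Longrightarrow> regs s (target_reg r) = rg \<sigma> r"
  unfolding rel_def by auto

lemma exec_adr:
  assumes "rel \<sigma> s" "a < 16" "rg \<sigma> j \<le> N"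
  shows "\<exists>s'. exec_list W (address_code a i j) s = Some s' \<and> regs s' 0 = address a (rg \<sigma> i) (rg \<sigma> j)
     \<and> rel \<sigma> s' \<and> pc s' = pc s + 6"
proof -
  have "rg \<sigma> i < B" using assms(1) by (auto simp: rel_def bdd_def)
  then have b: "address a (rg \<sigma> i) (rg \<sigma> j) < W" using assms address_less by simp
  have r: "regs s (target_reg i) = rg \<sigma> i" "regs s (target_reg j) = rg \<sigma> j" "regs s (Suc 0) = N + 1"
    "regs s 2 = N * N + 3" "regs s 3 = 16"
    using assms(1) by (auto simp: rel_def)
  let ?x1 = "rg \<sigma> i * (N + 1)"
  \<comment> \<open>Every intermediate value is at most the final address, so the single bound
    \<open>b\<close> excludes all overflows of the address computation.\<close>
  have b1: "?x1 < W" "?x1 + rg \<sigma> j < W" "?x1 + rg \<sigma> j + (N * N + 3) < W"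
     "(?x1 + rg \<sigma> j + (N * N + 3)) * 16 < W"
    using b by (auto simp: address_def)
  have a: "a < W" using b by (auto simp: address_def)
  show ?thesis
    using assms(1) b b1 a
    by (auto simp: address_code_def set_reg_def r address_def rel_def)
qed

lemma exec_atom:
  assumes "rel \<sigma> s" "atom_safe N B inp a \<sigma>"
  shows "\<exists>s'. exec_list W (compile_atom a) s = Some s' \<and> rel (atom_effect inp a \<sigma>) s' \<and> pc s' = pc s + length (compile_atom a)"
proof -
  have len: "length (address_code a i j) = 6" for a i j by (simp add: address_code_def)
  have rb: "\<And>r. rg \<sigma> r < B" "\<And>a i j. ar \<sigma> a i j < B" using assms(1) by (auto simp: rel_def bdd_def)
  have rW: "\<And>x. x < B \<Longrightarrow> x < W" using B_le_W by linarith
  have rgW: "\<And>r. rg \<sigma> r < W" "\<And>a i j. ar \<sigma> a i j < W" by (rule rW, rule rb)+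
  have rs: "\<And>x r. x < B \<Longrightarrow> rel (setr r x \<sigma>) (s\<lparr>pc := l, regs := (regs s)(target_reg r := x)\<rparr>)" for l
    using assms(1) by (auto simp: rel_def setr_def bdd_def)
  have app: "exec_list W (xs @ ys) s = (case exec_list W xs s of None \<Rightarrow> None | Some s1 \<Rightarrow> exec_list W ys s1)"
    for xs ys s
    by (induction xs arbitrary: s) (auto split: option.splits)
  show ?thesis
  proof (cases a)
    case (AConst r x)
    then show ?thesis using assms rs rW by (simp add: set_reg_def)
  next
    case (AMove r x)
    then show ?thesis using assms rs rW rb rgW by (simp add: set_reg_def rel_rg)
  next
    case (AAdd r x y)
    then show ?thesis using assms rs rW rb rgW by (simp add: set_reg_def rel_rg)
  next
    case (ASub r x y)
    moreover have "rg \<sigma> x - rg \<sigma> y < B" using rb(1)[of x] by linarith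
    ultimately show ?thesis using assms rs rW rb rgW by (simp add: set_reg_def rel_rg)
  next
    case (AIn r x)
    moreover have "inp ! rg \<sigma> x < B" using assms AIn inp_bd by simp
    moreover have "mem s (rg \<sigma> x) = inp ! rg \<sigma> x" using assms AIn by (simp add: rel_def)
    ultimately show ?thesis using assms rs rW rb rgW by (simp add: set_reg_def rel_rg)
  next
    case (AOut r)
    then show ?thesis using assms by (auto simp: rel_def bdd_def)
  next
    case (AGet r nm i j)
    then obtain s' where s': "exec_list W (address_code nm i j) s = Some s'" "regs s' 0 = address nm (rg \<sigma> i) (rg \<sigma> j)"
      "rel \<sigma> s'" "pc s' = pc s + 6"
      using exec_adr[OF assms(1), of nm j i] assms(2) by auto
    have m: "mem s' (address nm (rg \<sigma> i) (rg \<sigma> j)) = ar \<sigma> nm (rg \<sigma> i) (rg \<sigma> j)"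
      using s'(3) AGet assms(2) by (auto simp: rel_def)
    have "rel (setr r x \<sigma>) (s'\<lparr>pc := l, regs := (regs s')(target_reg r := x)\<rparr>)" if "x < B" for x l
      using that s'(3) by (auto simp: rel_def setr_def bdd_def)
    then show ?thesis using AGet s' m rb rW rgW by (simp add: app set_reg_def len)
  next
    case (APut nm i j r)
    then obtain s' where s': "exec_list W (address_code nm i j) s = Some s'" "regs s' 0 = address nm (rg \<sigma> i) (rg \<sigma> j)"
      "rel \<sigma> s'" "pc s' = pc s + 6"
      using exec_adr[OF assms(1), of nm j i] assms(2) by auto
    have A: "nm < 16" "rg \<sigma> j \<le> N" using APut assms(2) by auto
    have "rel (atom_effect inp a \<sigma>) (s'\<lparr>pc := l, mem := (mem s')(address nm (rg \<sigma> i) (rg \<sigma> j) := rg \<sigma> r)\<rparr>)" for l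
    proof -
      have 1: "\<not> address nm (rg \<sigma> i) (rg \<sigma> j) < length inp"
        using address_ge_input[of nm "rg \<sigma> i" "rg \<sigma> j"] by linarith
      have 2: "(address a' i' j' = address nm (rg \<sigma> i) (rg \<sigma> j)) = (a' = nm \<and> i' = rg \<sigma> i \<and> j' = rg \<sigma> j)" 
        if "a' < 16" "j' \<le> N" for a' i' j'
        using address_inj[of a' i' j' nm] that A by auto
      show ?thesis using s'(3) APut rb 1 2
        by (auto simp: rel_def bdd_def update2_def)
    qed
    then show ?thesis using APut s' rel_rg[OF s'(3)] by (simp add: app len)
  qed
qed

text \<open>Each unit of ghost time pays for at most 8 machine steps: an array access takes six
  instructions for the address and one for the access, a test together with the jump that ends its
  branch or loop body takes two.\<close>

lemma comp_correct:
  "big_step N B inp c \<sigma> \<sigma>' \<Longrightarrow> rel \<sigma> s \<Longrightarrow> code_at P (pc s) (compile (pc s) c) \<Longrightarrow>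
   \<exists>t s'. (s, s') \<in> ram_step W P ^^ t \<and> rel \<sigma>' s' \<and> pc s' = pc s + code_length c \<and> t + 8 * tm \<sigma> \<le> 8 * tm \<sigma>'"
proof (induction arbitrary: s rule: big_step.induct)
  case (skip \<sigma>)
  then show ?case by (auto intro: exI[of _ 0])
next
  case (ex_atom a \<sigma>)
  obtain s' where s': "exec_list W (compile_atom a) s = Some s'" "rel (atom_effect inp a \<sigma>) s'" "pc s' = pc s + length (compile_atom a)"
    using exec_atom[OF ex_atom(2,1)] by auto
  have "tm (atom_effect inp a \<sigma>) = Suc (tm \<sigma>)" by (cases a) auto
  moreover have "length (compile_atom a) \<le> 8" by (cases a) (auto simp: address_code_def)
  ultimately show ?case using exec_list_steps[OF _ s'(1)] s' ex_atom(3) by fastforce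
next
  case (ex_seq c \<sigma> \<sigma>1 c' \<sigma>2)
  have c: "code_at P (pc s) (compile (pc s) c)" "code_at P (pc s + code_length c) (compile (pc s + code_length c) c')"
    using code_at_append[OF ex_seq.prems(2)[simplified]] by auto
  obtain t s1 where 1: "(s, s1) \<in> ram_step W P ^^ t" "rel \<sigma>1 s1" "pc s1 = pc s + code_length c" "t + 8 * tm \<sigma> \<le> 8 * tm \<sigma>1"
    using ex_seq.IH(1)[OF ex_seq.prems(1) c(1)] by auto
  obtain t' s2 where 2: "(s1, s2) \<in> ram_step W P ^^ t'" "rel \<sigma>2 s2" "pc s2 = pc s1 + code_length c'" "t' + 8 * tm \<sigma>1 \<le> 8 * tm \<sigma>2"
    using ex_seq.IH(2)[OF 1(2)] 1(3) c(2) by auto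
  have "(s, s2) \<in> ram_step W P ^^ (t + t')" using 1(1) 2(1) by (auto simp: relpow_add)
  then show ?case using 1 2 by (intro exI[of _ "t + t'"] exI[of _ s2]) auto
next
  case (ex_if1 \<sigma> r c \<sigma>1 c')
  have c1: "pc s < length P" "P ! pc s = JumpZero (target_reg r) (pc s + code_length c + 2)"
     "code_at P (pc s + 1) (compile (pc s + 1) c @ Jump (pc s + code_length c + code_length c' + 2) # compile (pc s + code_length c + 2) c')"
    using code_at_Cons[OF ex_if1.prems(2)[simplified]] by auto
  have c2: "code_at P (pc s + 1) (compile (pc s + 1) c)"
     "code_at P (pc s + 1 + code_length c) (Jump (pc s + code_length c + code_length c' + 2) # compile (pc s + code_length c + 2) c')"
    using code_at_append[OF c1(3)] by auto
  let ?s = "s\<lparr>pc := pc s + 1\<rparr>"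
  have const_regs: "(s, ?s) \<in> ram_step W P"
    using c1 ex_if1.hyps(1) rel_rg[OF ex_if1.prems(1), of r] by (auto simp: ram_step_def)
  obtain t s1 where 1: "(?s, s1) \<in> ram_step W P ^^ t" "rel \<sigma>1 s1" "pc s1 = pc s + 1 + code_length c" "t + 8 * tm (tick \<sigma>) \<le> 8 * tm \<sigma>1"
    using ex_if1.IH[OF rel_tick[OF ex_if1.prems(1)], of "pc s + 1"] c2(1) by auto
  let ?s2 = "s1\<lparr>pc := pc s + code_length c + code_length c' + 2\<rparr>"
  have st2: "(s1, ?s2) \<in> ram_step W P"
    using code_at_Cons[OF c2(2)] 1(3) by (auto simp: ram_step_def)
  have r2: "rel \<sigma>1 ?s2" using 1(2) by (auto simp: rel_def)
  have "(s, s1) \<in> ram_step W P ^^ Suc t" using const_regs 1(1) by (rule relpow_Suc_I2)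
  then have "(s, ?s2) \<in> ram_step W P ^^ Suc (Suc t)" using st2 by (rule relpow_Suc_I)
  then show ?case using r2 1(4) 
    by (intro exI[of _ "Suc (Suc t)"] exI[of _ ?s2]) (auto simp: tick_def)
next
  case (ex_if2 \<sigma> r c' \<sigma>1 c)
  have c1: "pc s < length P" "P ! pc s = JumpZero (target_reg r) (pc s + code_length c + 2)"
     "code_at P (pc s + 1) (compile (pc s + 1) c @ Jump (pc s + code_length c + code_length c' + 2) # compile (pc s + code_length c + 2) c')"
    using code_at_Cons[OF ex_if2.prems(2)[simplified]] by auto
  have "code_at P (pc s + 1 + code_length c) (Jump (pc s + code_length c + code_length c' + 2) # compile (pc s + code_length c + 2) c')"
    using code_at_append[OF c1(3)] by auto
  then have c2: "code_at P (pc s + code_length c + 2) (compile (pc s + code_length c + 2) c')"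
    using code_at_Cons by fastforce
  let ?s = "s\<lparr>pc := pc s + code_length c + 2\<rparr>"
  have const_regs: "(s, ?s) \<in> ram_step W P"
    using c1 ex_if2.hyps(1) rel_rg[OF ex_if2.prems(1), of r] by (auto simp: ram_step_def)
  obtain t s1 where 1: "(?s, s1) \<in> ram_step W P ^^ t" "rel \<sigma>1 s1" "pc s1 = pc s + code_length c + 2 + code_length c'" "t + 8 * tm (tick \<sigma>) \<le> 8 * tm \<sigma>1"
    using ex_if2.IH[OF rel_tick[OF ex_if2.prems(1)], of "pc s + code_length c + 2"] c2(1) by auto
  have "(s, s1) \<in> ram_step W P ^^ Suc t" using const_regs 1(1) by (rule relpow_Suc_I2)
  then show ?case using 1
    by (intro exI[of _ "Suc t"] exI[of _ s1]) (auto simp: tick_def)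
next
  case (ex_wh1 \<sigma> r c \<sigma>1 \<sigma>2)
  have c1: "pc s < length P" "P ! pc s = JumpZero (target_reg r) (pc s + code_length c + 2)"
     "code_at P (pc s + 1) (compile (pc s + 1) c @ [Jump (pc s)])"
    using code_at_Cons[OF ex_wh1.prems(2)[simplified]] by auto
  have c2: "code_at P (pc s + 1) (compile (pc s + 1) c)"
     "code_at P (pc s + 1 + code_length c) [Jump (pc s)]"
    using code_at_append[OF c1(3)] by auto
  let ?s = "s\<lparr>pc := pc s + 1\<rparr>"
  have const_regs: "(s, ?s) \<in> ram_step W P"
    using c1 ex_wh1.hyps(1) rel_rg[OF ex_wh1.prems(1), of r] by (auto simp: ram_step_def)
  obtain t s1 where 1: "(?s, s1) \<in> ram_step W P ^^ t" "rel \<sigma>1 s1" "pc s1 = pc s + 1 + code_length c" "t + 8 * tm (tick \<sigma>) \<le> 8 * tm \<sigma>1"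
    using ex_wh1.IH(1)[OF rel_tick[OF ex_wh1.prems(1)], of "pc s + 1"] c2(1) by auto
  let ?s2 = "s1\<lparr>pc := pc s\<rparr>"
  have st2: "(s1, ?s2) \<in> ram_step W P"
    using code_at_Cons[OF c2(2)] 1(3) by (auto simp: ram_step_def)
  have r2: "rel \<sigma>1 ?s2" using 1(2) by (auto simp: rel_def)
  obtain t' s3 where 3: "(?s2, s3) \<in> ram_step W P ^^ t'" "rel \<sigma>2 s3" "pc s3 = pc s + code_length (WhileNZ r c)" "t' + 8 * tm \<sigma>1 \<le> 8 * tm \<sigma>2"
    using ex_wh1.IH(2)[OF r2] ex_wh1.prems(2) by auto
  have "(s, s1) \<in> ram_step W P ^^ Suc t" using const_regs 1(1) by (rule relpow_Suc_I2)
  then have "(s, ?s2) \<in> ram_step W P ^^ Suc (Suc t)" using st2 by (rule relpow_Suc_I)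
  then have "(s, s3) \<in> ram_step W P ^^ (Suc (Suc t) + t')" using 3(1) relpow_add by blast
  then show ?case using 3 1(4) 
    by (intro exI[of _ "Suc (Suc t) + t'"] exI[of _ s3]) (auto simp: tick_def)
next
  case (ex_wh2 \<sigma> r c)
  have c1: "pc s < length P" "P ! pc s = JumpZero (target_reg r) (pc s + code_length c + 2)"
    using code_at_Cons[OF ex_wh2.prems(2)[simplified]] by auto
  let ?s = "s\<lparr>pc := pc s + code_length c + 2\<rparr>"
  have const_regs: "(s, ?s) \<in> ram_step W P"
    using c1 ex_wh2.hyps(1) rel_rg[OF ex_wh2.prems(1), of r] by (auto simp: ram_step_def)
  then show ?case using rel_tick[OF ex_wh2.prems(1)]
    by (intro exI[of _ "Suc 0"] exI[of _ ?s]) (auto simp: tick_def)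
qed

end

text \<open>Computes the constants \<open>N + 1\<close>, \<open>N * N + 3\<close> and 16 of
  \<open>rel\<close> from the number of vertices in cell 0. This is what lets one fixed program
  serve all graphs.\<close>

definition prologue :: "instr list" where
  "prologue = [LoadConst 0 0, Load 5 0, Mul 2 5 5, LoadConst 4 3, Add 2 2 4, LoadConst 4 1, Add 1 5 4,
     LoadConst 3 16]"

definition program :: "com \<Rightarrow> instr list" where
  "program c = prologue @ compile 8 c @ [Halt]"

definition initial_hstate :: hstate where
  "initial_hstate = \<lparr>rg = (\<lambda>_. 0), ar = (\<lambda>_ _ _. 0), ou = [], tm = 0\<rparr>"

lemma program_correct:
  assumes "layout W N B inp" "0 < B" "0 < length inp" "inp ! 0 = N" "big_step N B inp c initial_hstate \<sigma>"
  shows "\<exists>t. ram_run W (program c) inp t (ou \<sigma>) \<and> t \<le> 8 * tm \<sigma> + 8"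
proof -
  interpret layout W N B inp by fact
  have w: "N < W" "N * N < W" "N * N + 3 < W" "16 < W" "N + 1 < W"
    using W_ge by auto
  let ?s = "init_config inp"
  let ?P = "program c"
  have c: "code_at ?P 0 prologue" "code_at ?P 8 (compile 8 c)" "8 + code_length c < length ?P" "?P ! (8 + code_length c) = Halt"
  proof -
    have "program c = [] @ prologue @ (compile 8 c @ [Halt])" "program c = prologue @ compile 8 c @ [Halt]"
       "length prologue = 8"
      by (simp_all add: program_def prologue_def)
    then show "code_at ?P 0 prologue" "code_at ?P 8 (compile 8 c)" unfolding code_at_def
      by (metis list.size(3), metis)
  qed (simp_all add: program_def prologue_def nth_append)
  obtain s1 where s1: "exec_list W prologue ?s = Some s1" "rel initial_hstate s1"
  proof -
    have m: "mem ?s 0 = N" using assms by (simp add: init_config_def)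
    show ?thesis 
    proof (rule that)
      show "exec_list W prologue ?s = Some (?s\<lparr>pc := 8, regs := (\<lambda>_. 0)(0 := 0, 5 := N, 2 := N * N + 3,
          4 := 1, 1 := N + 1, 3 := 16)\<rparr>)"
        using m w by (auto simp: prologue_def set_reg_def init_config_def fun_eq_iff)
      have "\<not> address a i j < length inp" for a i j using address_ge_input[of a i j] by linarith
      then show "rel initial_hstate (?s\<lparr>pc := 8, regs := (\<lambda>_. 0)(0 := 0, 5 := N, 2 := N * N + 3,
          4 := 1, 1 := N + 1, 3 := 16)\<rparr>)"
        using assms(2) by (auto simp: rel_def bdd_def initial_hstate_def init_config_def target_reg_def)
    qed
  qed
  have st1: "(?s, s1) \<in> ram_step W ?P ^^ 8" "pc s1 = 8"
  proof -
    have "pc ?s = 0" "length prologue = 8" by (simp_all add: init_config_def prologue_def)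
    then show "(?s, s1) \<in> ram_step W ?P ^^ 8" "pc s1 = 8"
      using exec_list_steps[of ?P ?s prologue W s1] c(1) s1(1) by (metis, metis add_0)
  qed
  obtain t s2 where t: "(s1, s2) \<in> ram_step W ?P ^^ t" "rel \<sigma> s2" "pc s2 = 8 + code_length c" "t + 8 * tm initial_hstate \<le> 8 * tm \<sigma>"
    using comp_correct[OF assms(5) s1(2), of ?P] c(2) st1(2) by auto
  have "(?s, s2) \<in> ram_step W ?P ^^ (8 + t)" using st1(1) t(1) relpow_add by blast
  then have "ram_run W ?P inp (8 + t) (ou \<sigma>)"
    unfolding ram_run_def halted_def using t c by (auto simp: rel_def)
  then show ?thesis using t(4) by (intro exI[of _ "8 + t"]) auto
qed


subsection \<open>Weakest preconditions\<close>

text \<open>Being existential over finite runs, it states termination, safety of all atoms and the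
  postcondition at once.\<close>

definition wp :: "nat \<Rightarrow> nat \<Rightarrow> nat list \<Rightarrow> com \<Rightarrow> (hstate \<Rightarrow> bool) \<Rightarrow> hstate \<Rightarrow> bool" where
  "wp N B inp c Q \<sigma> \<longleftrightarrow> (\<exists>\<sigma>'. big_step N B inp c \<sigma> \<sigma>' \<and> Q \<sigma>')"

lemma wp_skip [simp]: "wp N B inp Skip Q \<sigma> = Q \<sigma>"
  unfolding wp_def by (auto elim: ex_skipE intro: big_step.intros)

lemma wp_atom [simp]: "wp N B inp (Atom a) Q \<sigma> \<longleftrightarrow> atom_safe N B inp a \<sigma> \<and> Q (atom_effect inp a \<sigma>)"
  unfolding wp_def by (auto elim: ex_atomE intro: big_step.intros)

lemma wp_seq [simp]: "wp N B inp (c ;; c') Q = wp N B inp c (wp N B inp c' Q)"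
  unfolding wp_def fun_eq_iff by (blast elim: ex_seqE intro: ex_seq)

lemma wp_if [simp]: "wp N B inp (IfNZ r c c') Q \<sigma> =
    (if rg \<sigma> r \<noteq> 0 then wp N B inp c Q (tick \<sigma>) else wp N B inp c' Q (tick \<sigma>))"
  unfolding wp_def by (auto elim!: ex_ifE intro: big_step.intros)

lemma wp_mono: "wp N B inp c Q \<sigma> \<Longrightarrow> (\<And>\<sigma>'. Q \<sigma>' \<Longrightarrow> Q' \<sigma>') \<Longrightarrow> wp N B inp c Q' \<sigma>"
  unfolding wp_def by auto

text \<open>The main loop simulates a recursion, and a nested call is a chain of its iterations.
  Such chains are composed by transitivity; the loop has no invariant in the usual sense.\<close>

definition loop_iteration :: "nat \<Rightarrow> nat \<Rightarrow> nat list \<Rightarrow> nat \<Rightarrow> com \<Rightarrow> (hstate \<times> hstate) set" where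
  "loop_iteration N B inp r c = {(\<sigma>, \<sigma>'). rg \<sigma> r \<noteq> 0 \<and> big_step N B inp c (tick \<sigma>) \<sigma>'}"

lemma while_of_iterations: "(\<sigma>, \<sigma>') \<in> (loop_iteration N B inp r c)\<^sup>* \<Longrightarrow> rg \<sigma>' r = 0 \<Longrightarrow> big_step N B inp (WhileNZ r c) \<sigma> (tick \<sigma>')"
  by (induction rule: converse_rtrancl_induct) (auto simp: loop_iteration_def intro: big_step.intros)

lemma wp_while:
  assumes "I (i0::nat) \<sigma>"
    and "\<And>i \<sigma>. I i \<sigma> \<Longrightarrow> rg \<sigma> r \<noteq> 0 \<Longrightarrow> wp N B inp c (\<lambda>\<sigma>'. \<exists>i'<i. I i' \<sigma>') (tick \<sigma>)"
    and "\<And>i \<sigma>. I i \<sigma> \<Longrightarrow> rg \<sigma> r = 0 \<Longrightarrow> Q (tick \<sigma>)"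
  shows "wp N B inp (WhileNZ r c) Q \<sigma>"
  using assms(1)
proof (induction i0 arbitrary: \<sigma> rule: less_induct)
  case (less i)
  show ?case
  proof (cases "rg \<sigma> r = 0")
    case True
    then show ?thesis using assms(3)[OF less.prems] by (auto simp: wp_def intro: big_step.intros)
  next
    case False
    then obtain \<sigma>' i' where "big_step N B inp c (tick \<sigma>) \<sigma>'" "I i' \<sigma>'" "i' < i"
      using assms(2)[OF less.prems] by (auto simp: wp_def)
    then show ?thesis using less.IH[of i' \<sigma>'] False by (auto simp: wp_def intro: big_step.intros)
  qed
qed

definition For :: "nat \<Rightarrow> nat \<Rightarrow> nat \<Rightarrow> com \<Rightarrow> com" where
  "For t i l c = Atom (AConst i 0) ;; Atom (ASub t l i) ;;
     WhileNZ t (c ;; Atom (AAdd i i 1) ;; Atom (ASub t l i))"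

text \<open>The invariant refers to the loop head, where counter and test register are already
  updated; this is the reason for the two \<open>setr\<close> in the hypothesis on the body. They
  also make \<open>I\<close> speak about the time of the loop overhead.\<close>

lemma wp_For:
  assumes l: "rg \<sigma> l = m" "rg \<sigma> 1 = 1" "m < B" "i \<noteq> l" "t \<noteq> l" "t \<noteq> i" "i \<noteq> 1" "t \<noteq> 1"
    and I0: "I 0 (setr t m (setr i 0 \<sigma>))"
    and step: "\<And>j \<sigma>. I j \<sigma> \<Longrightarrow> j < m \<Longrightarrow> rg \<sigma> i = j \<Longrightarrow> rg \<sigma> l = m \<Longrightarrow> rg \<sigma> 1 = 1 \<Longrightarrow>
      wp N B inp c (\<lambda>\<sigma>'. rg \<sigma>' i = j \<and> rg \<sigma>' l = m \<and> rg \<sigma>' 1 = 1 \<and>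
        I (Suc j) (setr t (m - Suc j) (setr i (Suc j) \<sigma>'))) (tick \<sigma>)"
    and final: "\<And>\<sigma>. I m \<sigma> \<Longrightarrow> rg \<sigma> i = m \<Longrightarrow> Q (tick \<sigma>)"
  shows "wp N B inp (For t i l c) Q \<sigma>"
proof -
  let ?J = "\<lambda>\<sigma>. \<exists>j \<le> m. I j \<sigma> \<and> rg \<sigma> i = j \<and> rg \<sigma> t = m - j \<and> rg \<sigma> l = m \<and> rg \<sigma> 1 = 1"
  have "wp N B inp (WhileNZ t (c ;; Atom (AAdd i i 1) ;; Atom (ASub t l i))) Q (setr t m (setr i 0 \<sigma>))"
  proof (rule wp_while[where I = "\<lambda>q \<sigma>. ?J \<sigma> \<and> q = rg \<sigma> t"])
    show "?J (setr t m (setr i 0 \<sigma>)) \<and> m = rg (setr t m (setr i 0 \<sigma>)) t" using assms by auto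
  next
    fix q \<sigma> assume "?J \<sigma> \<and> q = rg \<sigma> t" and nz: "rg \<sigma> t \<noteq> 0"
    then obtain j where j: "j < m" "I j \<sigma>" "rg \<sigma> i = j" "rg \<sigma> t = m - j" "rg \<sigma> l = m" "rg \<sigma> 1 = 1" "q = m - j"
      using le_neq_implies_less by fastforce
    from step[OF j(2,1,3,5,6)]
    show "wp N B inp (c ;; Atom (AAdd i i 1) ;; Atom (ASub t l i)) (\<lambda>\<sigma>'. \<exists>q'<q. ?J \<sigma>' \<and> q' = rg \<sigma>' t) (tick \<sigma>)"
      unfolding wp_seq
      by (rule wp_mono) (use j assms(3-8) in \<open>auto intro!: diff_less_mono2\<close>)
  next
    fix q \<sigma> assume "?J \<sigma> \<and> q = rg \<sigma> t" "rg \<sigma> t = 0"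
    then show "Q (tick \<sigma>)" using final by auto
  qed
  then show ?thesis using assms(1,3,4) unfolding For_def by simp
qed

section \<open>Connected vertex sets\<close>

locale kgraph =
  fixes n k :: nat and adj :: "nat \<Rightarrow> nat \<Rightarrow> bool"
  assumes adj_sym: "adj u v \<Longrightarrow> adj v u"
    and adj_irrefl: "\<not> adj u u"
    and adj_less: "adj u v \<Longrightarrow> u < n"
    and k_ge_2: "2 \<le> k"
    and k_le_n: "k \<le> n"
begin

lemma adj_less': "adj u v \<Longrightarrow> v < n"
  using adj_less adj_sym by blast

lemma finite_adj [simp]: "finite {w. adj v w \<and> P w}" "finite {w. adj v w}"
  by (rule finite_subset[of _ "{..<n}"], auto dest: adj_less')+

lemma finite_adj': "finite {w \<in> T. adj v w}"
  by (rule finite_subset[of _ "{..<n}"]) (auto dest: adj_less')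

text \<open>Connectedness by cuts, not by paths: all later arguments grow a set along an edge that
  leaves it, or show that a closed set contains a connected one that meets it.\<close>

definition conn :: "nat set \<Rightarrow> bool" where
  "conn T \<longleftrightarrow> T \<noteq> {} \<and> (\<forall>A. A \<subseteq> T \<longrightarrow> A \<noteq> {} \<longrightarrow> A \<noteq> T \<longrightarrow> (\<exists>x \<in> A. \<exists>y \<in> T - A. adj x y))"

definition deg_in :: "nat \<Rightarrow> nat set \<Rightarrow> nat" where
  "deg_in v T = card {w \<in> T. adj v w}"

text \<open>Twice the number of edges inside T.\<close>

definition degsum :: "nat set \<Rightarrow> nat" where
  "degsum T = (\<Sum>v \<in> T. deg_in v T)"

definition live_deg :: "nat set \<Rightarrow> nat \<Rightarrow> nat" where
  "live_deg X v = card {w. adj v w \<and> w \<notin> X}"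

definition completions :: "nat set \<Rightarrow> nat set \<Rightarrow> nat set set" where
  "completions S X = {T. T \<subseteq> {..<n} - X \<and> S \<subseteq> T \<and> card T = k \<and> conn T}"

lemma connD: "conn T \<Longrightarrow> A \<subseteq> T \<Longrightarrow> A \<noteq> {} \<Longrightarrow> A \<noteq> T \<Longrightarrow> \<exists>x \<in> A. \<exists>y \<in> T - A. adj x y"
  unfolding conn_def by blast

lemma conn_single: "conn {r}"
  unfolding conn_def by auto

lemma conn_insert:
  assumes "conn A" "x \<in> A" "adj x y"
  shows "conn (insert y A)"
  unfolding conn_def
proof (intro conjI allI impI)
  fix C assume C: "C \<subseteq> insert y A" "C \<noteq> {}" "C \<noteq> insert y A"
  consider "C \<inter> A = {}" | "A \<subseteq> C" | "C \<inter> A \<noteq> {}" "C \<inter> A \<noteq> A" by blast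
  then show "\<exists>x \<in> C. \<exists>y \<in> insert y A - C. adj x y"
  proof cases
    case 1
    then have "y \<in> C" "x \<notin> C" using C assms(2) by auto
    then show ?thesis using assms(2) adj_sym[OF assms(3)] by (intro bexI[of _ y] bexI[of _ x]) auto
  next
    case 2
    then have "y \<notin> C" "x \<in> C" using C assms(2) by auto
    then show ?thesis using assms(3) by (intro bexI[of _ x] bexI[of _ y]) auto
  next
    case 3
    then obtain a b where "a \<in> C \<inter> A" "b \<in> A - C \<inter> A" "adj a b"
      using connD[OF assms(1), of "C \<inter> A"] by blast
    then show ?thesis by (intro bexI[of _ a] bexI[of _ b]) auto
  qed
qed simp

text \<open>The order in which a search discovers vertices. It certifies connectedness, and it
  remains useful as an order: the first entry outside a set that contains the head is adjacent to
  that set.\<close>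

definition prefix_conn :: "nat list \<Rightarrow> bool" where
  "prefix_conn xs \<longleftrightarrow> (\<forall>i < length xs. 0 < i \<longrightarrow> (\<exists>j < i. adj (xs ! j) (xs ! i)))"

lemma prefix_conn_single [simp]: "prefix_conn [x]"
  unfolding prefix_conn_def by auto

lemma prefix_conn_snoc: "prefix_conn (xs @ [y]) \<longleftrightarrow> prefix_conn xs \<and> (xs = [] \<or> (\<exists>x \<in> set xs. adj x y))"
proof -
  define A where "A zs i = (\<exists>j < i. adj (zs ! j) (zs ! i))" for zs i
  have "(\<exists>x \<in> set xs. adj x y) \<longleftrightarrow> (\<exists>j < length xs. adj (xs ! j) y)"
    by (metis in_set_conv_nth)
  also have "\<dots> \<longleftrightarrow> A (xs @ [y]) (length xs)"
    unfolding A_def by (intro ex_cong1) (auto simp: nth_append)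
  finally have 1: "A (xs @ [y]) (length xs) \<longleftrightarrow> (\<exists>x \<in> set xs. adj x y)" by simp
  have 2: "A (xs @ [y]) i \<longleftrightarrow> A xs i" if "i < length xs" for i
    unfolding A_def using that by (intro ex_cong1) (auto simp: nth_append)
  have "prefix_conn (xs @ [y]) \<longleftrightarrow> (\<forall>i < Suc (length xs). 0 < i \<longrightarrow> A (xs @ [y]) i)"
    unfolding prefix_conn_def A_def by simp
  also have "\<dots> \<longleftrightarrow> (0 < length xs \<longrightarrow> A (xs @ [y]) (length xs)) \<and> (\<forall>i < length xs. 0 < i \<longrightarrow> A (xs @ [y]) i)"
    by (rule All_less_Suc)
  also have "(\<forall>i < length xs. 0 < i \<longrightarrow> A (xs @ [y]) i) \<longleftrightarrow> prefix_conn xs"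
    unfolding prefix_conn_def using 2 by (simp add: A_def)
  finally show ?thesis using 1 by auto
qed

lemma prefix_conn_conn: "prefix_conn xs \<Longrightarrow> xs \<noteq> [] \<Longrightarrow> conn (set xs)"
proof (induction xs rule: rev_induct)
  case (snoc y xs)
  then show ?case
  proof (cases "xs = []")
    case True
    then show ?thesis by (simp add: conn_single)
  next
    case False
    then obtain x where "x \<in> set xs" "adj x y" "conn (set xs)"
      using snoc by (auto simp: prefix_conn_snoc)
    then show ?thesis using conn_insert by simp
  qed
qed simp

text \<open>As long as the set is not all of \<open>U\<close>, some edge leads out of it inside
  \<open>U\<close>, and adding its endpoint raises the size by exactly one; so every size in between
  is met. This produces solutions through prescribed vertices.\<close>

lemma conn_grow:
  assumes "conn U" "finite U" "conn C" "C \<subseteq> U" "card C \<le> m" "m \<le> card U"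
  shows "\<exists>T. C \<subseteq> T \<and> T \<subseteq> U \<and> conn T \<and> card T = m"
  using assms(3-6)
proof (induction "m - card C" arbitrary: C)
  case 0
  then show ?case by (intro exI[of _ C]) auto
next
  case (Suc d)
  have "C \<noteq> {}" using Suc.prems(1) by (auto simp: conn_def)
  moreover have "C \<noteq> U" using Suc.hyps(2) Suc.prems(4) by auto
  ultimately obtain x y where xy: "x \<in> C" "y \<in> U - C" "adj x y"
    using connD[OF assms(1), of C] Suc.prems(2) by blast
  have fC: "finite C" using Suc.prems(2) assms(2) finite_subset by blast
  have c: "card (insert y C) = Suc (card C)" using xy fC by simp
  have "\<exists>T. insert y C \<subseteq> T \<and> T \<subseteq> U \<and> conn T \<and> card T = m"
  proof (rule Suc.hyps(1))
    show "d = m - card (insert y C)" "card (insert y C) \<le> m" using c Suc.hyps(2) by linarith+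
  qed (use conn_insert[OF Suc.prems(1) xy(1,3)] xy Suc.prems in auto)
  then show ?case by blast
qed

lemma completionsD: "T \<in> completions S X \<Longrightarrow> T \<subseteq> {..<n} \<and> T \<inter> X = {} \<and> S \<subseteq> T \<and> card T = k \<and> conn T \<and> finite T"
  unfolding completions_def using finite_subset by fastforce

lemma finite_completions [simp]: "finite (completions S X)"
  by (rule finite_subset[of _ "Pow {..<n}"]) (auto simp: completions_def)

lemma completions_split: "completions S X = completions (insert v S) X \<union> completions S (insert v X)"
  "completions (insert v S) X \<inter> completions S (insert v X) = {}"
  unfolding completions_def by auto

lemma completions_closed:
  assumes "T \<in> completions S X" "S \<noteq> {}" "S \<subseteq> A" "\<And>x y. x \<in> A \<Longrightarrow> adj x y \<Longrightarrow> y \<notin> X \<Longrightarrow> y \<in> A"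
  shows "T \<subseteq> A"
proof (rule ccontr)
  assume "\<not> T \<subseteq> A"
  moreover have "S \<subseteq> T" "conn T" "T \<inter> X = {}" using assms(1) completionsD by auto
  ultimately obtain x y where "x \<in> A \<inter> T" "y \<in> T - A \<inter> T" "adj x y"
    using connD[of T "A \<inter> T"] assms(2,3) by blast
  then show False using assms(4) \<open>T \<inter> X = {}\<close> by blast
qed

text \<open>The meaning of a failed search: the explored set is closed outside the forbidden
  vertices, so a connected set that contains S cannot leave it, and it is too small for
  \<open>k\<close> vertices.\<close>

lemma completions_empty:
  assumes "S \<noteq> {}" "S \<subseteq> A" "finite A" "card A < k" "\<And>x y. x \<in> A \<Longrightarrow> adj x y \<Longrightarrow> y \<notin> X \<Longrightarrow> y \<in> A"
  shows "completions S X = {}"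
proof -
  have False if "T \<in> completions S X" for T
    using completions_closed[OF that assms(1,2,5)] card_mono[OF assms(3), of T] completionsD[OF that] assms(4) by auto
  then show ?thesis by blast
qed

text \<open>The same conclusion without a search: if a closed set around S has exactly
  \<open>k\<close> vertices, it is the only candidate, and it contains \<open>v\<close>.\<close>

lemma completions_empty_avoiding:
  assumes "S \<noteq> {}" "S \<subseteq> A" "finite A" "card A = k" "v \<in> A"
    "\<And>x y. x \<in> A \<Longrightarrow> adj x y \<Longrightarrow> y \<notin> X \<Longrightarrow> y \<in> A"
  shows "completions S (insert v X) = {}"
proof -
  have False if T: "T \<in> completions S (insert v X)" for T
  proof -
    have "T \<subseteq> A" using completions_closed[OF T assms(1,2)] assms(6) by blast
    moreover have "card T = card A" using T assms(4) completionsD by auto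
    ultimately have "T = A" using assms(3) by (simp add: card_subset_eq)
    then show False using completionsD[OF T] assms(5) by blast
  qed
  then show ?thesis by blast
qed

section \<open>Degree sums and the potential\<close>

lemma deg_in_mono: "finite B \<Longrightarrow> A \<subseteq> B \<Longrightarrow> deg_in v A \<le> deg_in v B"
  unfolding deg_in_def by (intro card_mono) auto

lemma degsum_mono: "finite B \<Longrightarrow> A \<subseteq> B \<Longrightarrow> degsum A \<le> degsum B"
  unfolding degsum_def
  by (rule order_trans[OF sum_mono[of A _ "\<lambda>v. deg_in v B"] sum_mono2]) (auto intro: deg_in_mono)

text \<open>In a connected set with at least two vertices each vertex has a neighbour inside. This
  absorbs every cost of order \<open>k\<close> into the edges of a solution.\<close>

lemma degsum_ge_card:
  assumes "conn T" "finite T" "2 \<le> card T"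
  shows "card T \<le> degsum T"
proof -
  have "1 \<le> deg_in v T" if v: "v \<in> T" for v
  proof -
    have "T \<noteq> {v}" using assms(3) by auto
    then obtain y where "y \<in> T" "adj v y" using connD[OF assms(1), of "{v}"] v by blast
    then have "{w \<in> T. adj v w} \<noteq> {}" by auto
    moreover have "finite {w \<in> T. adj v w}" using assms(2) by simp
    ultimately show ?thesis unfolding deg_in_def by (metis Suc_leI card_gt_0_iff One_nat_def)
  qed
  then have "(\<Sum>v\<in>T. 1) \<le> degsum T" unfolding degsum_def by (intro sum_mono) auto
  then show ?thesis by simp
qed

lemma degsum_pairs: "finite T \<Longrightarrow> degsum T = card {(u, w). u \<in> T \<and> w \<in> T \<and> adj u w}"
proof -
  assume f: "finite T"
  have "{(u, w). u \<in> T \<and> w \<in> T \<and> adj u w} = (SIGMA u : T. {w \<in> T. adj u w})" by auto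
  then show ?thesis unfolding degsum_def deg_in_def using f by simp
qed

lemma degsum_completion: "T \<in> completions S X \<Longrightarrow> k \<le> degsum T"
  using completionsD[of T S X] degsum_ge_card[of T] k_ge_2 by auto

text \<open>For a neighbour \<open>w\<close> outside \<open>X\<close>, the set S with
  \<open>v\<close> and \<open>w\<close> has at most \<open>k\<close> vertices and the witness with
  \<open>w\<close> has at least \<open>k\<close>; a connected \<open>k\<close>-set between them is a
  solution that contains the edge from \<open>v\<close> to \<open>w\<close>. The room for
  \<open>w\<close> is the reason why branching stops at \<open>k - 1\<close> vertices in S.\<close>

lemma live_deg_le_completions:
  assumes "T0 \<in> completions (insert v S) X" "conn (insert v S)" "card (insert v S) < k"
  shows "live_deg X v \<le> (\<Sum>T \<in> completions (insert v S) X. deg_in v T)"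
proof -
  have T0: "T0 \<subseteq> {..<n}" "T0 \<inter> X = {}" "insert v S \<subseteq> T0" "card T0 = k" "conn T0" "finite T0"
    using completionsD[OF assms(1)] by blast+
  have fS: "finite (insert v S)" using T0(3,6) by (rule finite_subset)
  have "{w. adj v w \<and> w \<notin> X} \<subseteq> (\<Union>T \<in> completions (insert v S) X. {w \<in> T. adj v w})"
  proof
    fix w assume "w \<in> {w. adj v w \<and> w \<notin> X}"
    then have w: "adj v w" "w \<notin> X" by auto
    have vT: "v \<in> T0" using T0(3) by simp
    have c1: "conn (insert w T0)" by (rule conn_insert[OF T0(5) vT w(1)])
    have c2: "conn (insert w (insert v S))" by (rule conn_insert[OF assms(2) insertI1 w(1)])
    have c3: "card (insert w (insert v S)) \<le> k"
      using assms(3) fS by (cases "w \<in> insert v S") (simp_all add: insert_absorb)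
    have c4: "k \<le> card (insert w T0)" using T0(4,6) by (cases "w \<in> T0") (simp_all add: insert_absorb)
    have c5: "insert w (insert v S) \<subseteq> insert w T0" "finite (insert w T0)" using T0(3,6) by auto
    obtain T where T: "insert w (insert v S) \<subseteq> T" "T \<subseteq> insert w T0" "conn T" "card T = k"
      using conn_grow[OF c1 c5(2) c2 c5(1) c3 c4] by blast
    have "T \<in> completions (insert v S) X"
    proof -
      have "w < n" using w(1) by (rule adj_less')
      then have "T \<subseteq> {..<n} - X" using T(2) T0(1,2) w(2) by auto
      then show ?thesis using T by (simp add: completions_def)
    qed
    then show "w \<in> (\<Union>T \<in> completions (insert v S) X. {w \<in> T. adj v w})" using T(1) w(1) by (intro UN_I[of T]) auto
  qed
  then have "live_deg X v \<le> card (\<Union>T \<in> completions (insert v S) X. {w \<in> T. adj v w})"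
    unfolding live_deg_def by (rule card_mono[rotated]) (rule finite_UN_I[OF finite_completions], rule finite_adj')
  also have "\<dots> \<le> (\<Sum>T \<in> completions (insert v S) X. card {w \<in> T. adj v w})"
    by (intro card_UN_le) simp
  finally show ?thesis by (simp add: deg_in_def)
qed

text \<open>The first summand pays for searches and output, the second for the deletions of the vertices of
  T that are still to be included.\<close>

definition potential :: "nat \<Rightarrow> nat \<Rightarrow> nat set \<Rightarrow> nat set \<Rightarrow> nat" where
  "potential a b S X = (\<Sum>T \<in> completions S X. a * degsum T + b * (\<Sum>v \<in> T - S. deg_in v T))"

text \<open>Below the including child \<open>v\<close> is no longer among the vertices still to be
  included. This releases \<open>b\<close> times its degree in each of these solutions, which by
  \<open>live_deg_le_completions\<close> is enough to pay for its deletion.\<close>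

lemma potential_split:
  assumes "v \<notin> S"
  shows "potential a b S X = potential a b (insert v S) X + potential a b S (insert v X) + b * (\<Sum>T \<in> completions (insert v S) X. deg_in v T)"
proof -
  let ?f = "\<lambda>T. a * degsum T + b * (\<Sum>v \<in> T - S. deg_in v T)"
  have 1: "potential a b S X = sum ?f (completions (insert v S) X) + sum ?f (completions S (insert v X))"
    unfolding potential_def
    using sum.union_disjoint[OF finite_completions finite_completions completions_split(2)[of v S X], of ?f]
    by (simp only: completions_split(1)[of S X v, symmetric])
  have "?f T = (a * degsum T + b * (\<Sum>u \<in> T - insert v S. deg_in u T)) + b * deg_in v T" if T: "T \<in> completions (insert v S) X" for T
  proof -
    have e: "T - S = insert v (T - insert v S)" and f: "finite (T - insert v S)"
      using completionsD[OF T] assms by auto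
    have "(\<Sum>u \<in> T - S. deg_in u T) = deg_in v T + (\<Sum>u \<in> T - insert v S. deg_in u T)"
      unfolding e by (subst sum.insert[OF f]) simp_all
    then show ?thesis by (simp add: add_mult_distrib2)
  qed
  then have "sum ?f (completions (insert v S) X) = potential a b (insert v S) X + (\<Sum>T \<in> completions (insert v S) X. b * deg_in v T)"
    unfolding potential_def sum.distrib[symmetric] by (rule sum.cong[OF refl])
  then show ?thesis using 1 unfolding potential_def[of a b S "insert v X"] sum_distrib_left by linarith
qed

lemma potential_upper: "potential a b S X \<le> (a + b) * (\<Sum>T \<in> completions S X. degsum T)"
proof -
  have "(\<Sum>v \<in> T - S. deg_in v T) \<le> degsum T" if "T \<in> completions S X" for T
    unfolding degsum_def using completionsD[OF that] by (intro sum_mono2) auto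
  then have "potential a b S X \<le> (\<Sum>T \<in> completions S X. (a + b) * degsum T)"
    unfolding potential_def by (intro sum_mono) (simp add: add_mult_distrib)
  then show ?thesis by (simp add: sum_distrib_left)
qed

lemma potential_lower: "a * (\<Sum>T \<in> completions S X. degsum T) \<le> potential a b S X"
  unfolding potential_def sum_distrib_left by (intro sum_mono) simp

lemma degsum_le_sum_completions: "T \<in> completions S X \<Longrightarrow> degsum T \<le> (\<Sum>T \<in> completions S X. degsum T)"
  by (intro member_le_sum) auto

section \<open>Solutions when S has \<open>k - 1\<close> vertices\<close>

definition frontier :: "nat set \<Rightarrow> nat set \<Rightarrow> nat set" where
  "frontier S X = {w. w \<notin> X \<and> w \<notin> S \<and> (\<exists>u \<in> S. adj u w)}"

lemma finite_frontier [simp]: "finite (frontier S X)"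
  by (rule finite_subset[of _ "{..<n}"]) (auto simp: frontier_def dest: adj_less')

lemma completions_base:
  assumes "card S = k - 1" "conn S" "S \<subseteq> {..<n} - X"
  shows "completions S X = (\<lambda>w. insert w S) ` frontier S X"
proof -
  have fS: "finite S" using assms(3) finite_subset by blast
  show ?thesis
  proof (intro equalityI subsetI)
    fix T assume T: "T \<in> completions S X"
    note T' = completionsD[OF T]
    have "S \<noteq> T" using T' assms(1) k_ge_2 by auto
    moreover have "S \<noteq> {}" using assms(2) by (auto simp: conn_def)
    ultimately obtain u w where uw: "u \<in> S" "w \<in> T - S" "adj u w"
      using connD[of T S] T' by blast
    have "card (insert w S) = k" using uw fS assms(1) k_ge_2 by simp
    moreover have "insert w S \<subseteq> T" using uw T' by auto
    ultimately have "T = insert w S" using T' by (metis card_subset_eq)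
    moreover have "w \<in> frontier S X" using uw T' by (auto simp: frontier_def)
    ultimately show "T \<in> (\<lambda>w. insert w S) ` frontier S X" by blast
  next
    fix T assume "T \<in> (\<lambda>w. insert w S) ` frontier S X"
    then obtain w u where w: "T = insert w S" "w \<notin> X" "w \<notin> S" "u \<in> S" "adj u w" by (auto simp: frontier_def)
    have "conn T" using conn_insert[OF assms(2) w(4,5)] w(1) by simp
    moreover have "card T = k" using w fS assms(1) k_ge_2 by simp
    ultimately show "T \<in> completions S X" using w assms(3) adj_less' by (auto simp: completions_def)
  qed
qed

lemma inj_frontier: "inj_on (\<lambda>w. insert w S) (frontier S X)"
  by (auto simp: inj_on_def frontier_def)

text \<open>Double counting: list entries that stay inside S are paid by the edges of
  \<open>T0\<close>, and entries that lead to a vertex \<open>w\<close> of the frontier are edges of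
  the solution that adds \<open>w\<close>. Hence the factor 2.\<close>

lemma live_deg_base_sum:
  assumes "card S = k - 1" "conn S" "S \<subseteq> {..<n} - X" "T0 \<in> completions S X"
  shows "(\<Sum>u \<in> S. live_deg X u) \<le> 2 * (\<Sum>T \<in> completions S X. degsum T)"
proof -
  have fS: "finite S" using assms(3) finite_subset by blast
  have cs: "card {w \<in> A. P w} = (\<Sum>w \<in> A. if P w then 1 else 0)" if "finite A" for A :: "nat set" and P
    using sum.inter_filter[OF that, of "\<lambda>_. 1::nat" P] by simp
  have e: "(\<Sum>T \<in> completions S X. f T) = (\<Sum>w \<in> frontier S X. f (insert w S))" for f :: "nat set \<Rightarrow> nat"
    unfolding completions_base[OF assms(1-3)] by (simp add: sum.reindex[OF inj_frontier])
  have "live_deg X u = deg_in u S + card {w \<in> frontier S X. adj u w}" if "u \<in> S" for u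
  proof -
    have "{w. adj u w \<and> w \<notin> X} = {w \<in> S. adj u w} \<union> {w \<in> frontier S X. adj u w}"
      using that assms(3) by (auto simp: frontier_def)
    moreover have "{w \<in> S. adj u w} \<inter> {w \<in> frontier S X. adj u w} = {}" by (auto simp: frontier_def)
    ultimately show ?thesis unfolding live_deg_def deg_in_def using fS by (simp add: card_Un_disjoint)
  qed
  then have "(\<Sum>u \<in> S. live_deg X u) = degsum S + (\<Sum>u \<in> S. card {w \<in> frontier S X. adj u w})"
    by (simp add: degsum_def sum.distrib)
  also have "(\<Sum>u \<in> S. card {w \<in> frontier S X. adj u w}) = (\<Sum>u \<in> S. \<Sum>w \<in> frontier S X. if adj u w then 1 else 0)"
    by (intro sum.cong refl cs) simp
  also have "\<dots> = (\<Sum>w \<in> frontier S X. \<Sum>u \<in> S. if adj u w then 1 else 0)" by (rule sum.swap)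
  also have "\<dots> = (\<Sum>w \<in> frontier S X. card {u \<in> S. adj w u})"
    unfolding cs[OF fS] using adj_sym by (intro sum.cong refl) metis
  also have "\<dots> \<le> (\<Sum>w \<in> frontier S X. degsum (insert w S))"
  proof (rule sum_mono)
    fix w assume "w \<in> frontier S X"
    have "card {u \<in> S. adj w u} \<le> deg_in w (insert w S)" unfolding deg_in_def using fS by (intro card_mono) auto
    also have "\<dots> \<le> degsum (insert w S)" unfolding degsum_def using fS by (intro member_le_sum) auto
    finally show "card {u \<in> S. adj w u} \<le> degsum (insert w S)" .
  qed
  also have "\<dots> = (\<Sum>T \<in> completions S X. degsum T)" using e by simp
  finally have 1: "(\<Sum>u \<in> S. live_deg X u) \<le> degsum S + (\<Sum>T \<in> completions S X. degsum T)" by simp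
  have "degsum S \<le> degsum T0" using completionsD[OF assms(4)] by (intro degsum_mono) auto
  also have "\<dots> \<le> (\<Sum>T \<in> completions S X. degsum T)" using assms(4) by (rule degsum_le_sum_completions)
  finally show ?thesis using 1 by linarith
qed

lemma prefix_conn_adj:
  assumes "prefix_conn ts" "p < length ts" "\<forall>i < p. ts ! i \<in> A" "ts ! p \<notin> A" "ts ! 0 \<in> A"
  shows "\<exists>x \<in> A. adj x (ts ! p)"
proof -
  have "0 < p" using assms(4,5) by (cases p) auto
  then obtain j where "j < p" "adj (ts ! j) (ts ! p)" using assms(1,2) by (auto simp: prefix_conn_def)
  then show ?thesis using assms(3) by blast
qed

end

section \<open>Linked adjacency lists and search\<close>

text \<open>A doubly linked list ys between the sentinels a and b, with successors f and predecessors g.\<close>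

fun seg :: "(nat \<Rightarrow> nat) \<Rightarrow> (nat \<Rightarrow> nat) \<Rightarrow> nat \<Rightarrow> nat list \<Rightarrow> nat \<Rightarrow> bool" where
  "seg f g a [] b \<longleftrightarrow> f a = b \<and> g b = a"
| "seg f g a (y # ys) b \<longleftrightarrow> f a = y \<and> g y = a \<and> seg f g y ys b"

lemma seg_append: "seg f g a (xs @ v # ys) b \<longleftrightarrow> seg f g a xs v \<and> seg f g v ys b"
  by (induction xs arbitrary: a) auto

lemma seg_first: "seg f g a ys b \<Longrightarrow> f a = (ys @ [b]) ! 0"
  by (cases ys) auto

lemma seg_nth: "seg f g a ys b \<Longrightarrow> j < length ys \<Longrightarrow> f (ys ! j) = (ys @ [b]) ! Suc j"
proof (induction ys arbitrary: a j)
  case (Cons y ys)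
  then show ?case by (cases j) (auto dest: seg_first)
qed simp

lemma seg_pred: "seg f g a ys b \<Longrightarrow> g b \<in> insert a (set ys)"
  by (induction ys arbitrary: a) auto

lemma seg_succ: "seg f g a ys b \<Longrightarrow> f a \<in> insert b (set ys)"
  by (cases ys) auto

lemma seg_upd:
  "seg f g a ys b \<Longrightarrow> p \<notin> insert a (set ys) \<Longrightarrow> q \<notin> insert b (set ys) \<Longrightarrow>
   seg (f(p := x)) (g(q := y)) a ys b"
  by (induction ys arbitrary: a) auto

text \<open>The case \<open>a = b\<close> is included: all lists are circular with the one sentinel
  \<open>n\<close>. There is no clash at the sentinel, since its successor and its predecessor live
  in different arrays.\<close>

lemma seg_remove:
  "seg f g a (xs @ v # ys) b \<Longrightarrow> distinct (xs @ v # ys) \<Longrightarrow> a \<notin> set (xs @ v # ys) \<Longrightarrow> b \<notin> set (xs @ v # ys)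
   \<Longrightarrow> seg (f(g v := f v)) (g(f v := g v)) a (xs @ ys) b"
proof (induction xs arbitrary: a)
  case Nil
  then have s: "f a = v" "g v = a" "seg f g v ys b" by auto
  show ?case
  proof (cases ys)
    case Nil
    then show ?thesis using s by auto
  next
    case (Cons y ys')
    then have "seg f g y ys' b" "f v = y" "g y = v" using s by auto
    moreover have "a \<notin> insert y (set ys')" "y \<notin> insert b (set ys')" using Nil.prems Cons by auto
    ultimately have "seg (f(a := y)) (g(y := a)) y ys' b" using seg_upd by blast
    then have "seg (f(a := y)) (g(y := a)) a ys b" using Cons by simp
    then show ?thesis by (simp only: s(2) \<open>f v = y\<close> append_Nil)
  qed
next
  case (Cons x xs)
  then have s: "f a = x" "g x = a" "seg f g x (xs @ v # ys) b" by auto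
  then have "g v \<in> insert x (set xs)" "f v \<in> insert b (set ys)"
    unfolding seg_append using seg_pred seg_succ by blast+
  then have "g v \<noteq> a" "f v \<noteq> x" using Cons.prems by auto
  moreover have "seg (f(g v := f v)) (g(f v := g v)) x (xs @ ys) b"
    by (rule Cons.IH[OF s(3)]) (use Cons.prems in auto)
  moreover have "(f(g v := f v)) a = x" "(g(f v := g v)) x = a"
    using s \<open>g v \<noteq> a\<close> \<open>f v \<noteq> x\<close> by auto
  ultimately show ?case unfolding append_Cons seg.simps by blast
qed

text \<open>A set as the first column of a two-dimensional array. The empty set is the zero array,
  that is, memory as it is at the start.\<close>

definition marks :: "nat set \<Rightarrow> nat \<Rightarrow> nat \<Rightarrow> nat" where
  "marks A = (\<lambda>x j. if x \<in> A \<and> j = 0 then 1 else 0)"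

lemma update2_marks: "update2 (marks A) x 0 (Suc 0) = marks (insert x A)" "update2 (marks A) x 0 0 = marks (A - {x})"
  by (auto simp: update2_def marks_def fun_eq_iff)

definition ForList :: "nat \<Rightarrow> nat \<Rightarrow> nat \<Rightarrow> com \<Rightarrow> com" where
  "ForList x t u c = Atom (AGet x 0 u 3) ;; Atom (ASub t 3 x) ;;
     WhileNZ t (c ;; Atom (AGet x 0 u x) ;; Atom (ASub t 3 x))"

text \<open>The body may change other rows of array 0 but not the row that is traversed. Unlinking
  \<open>v\<close> meets this condition: it follows the row of \<open>v\<close> and edits only the
  rows of its neighbours, and no vertex is its own neighbour. The test register is the distance to
  the sentinel \<open>n\<close>, the largest index in use.\<close>

lemma wp_ForList:
  assumes r: "rg \<sigma> u = w" "rg \<sigma> 3 = N" "x \<noteq> t" "x \<noteq> u" "x \<noteq> 3" "t \<noteq> u" "t \<noteq> 3"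
    and s: "seg f g N ys N" "set ys \<subseteq> {..<N}" "ar \<sigma> 0 w = f"
    and I0: "I 0 (setr t (N - (ys @ [N]) ! 0) (setr x ((ys @ [N]) ! 0) \<sigma>))"
    and step: "\<And>j \<sigma>. I j \<sigma> \<Longrightarrow> j < length ys \<Longrightarrow> rg \<sigma> x = ys ! j \<Longrightarrow> rg \<sigma> u = w \<Longrightarrow> rg \<sigma> 3 = N \<Longrightarrow> ar \<sigma> 0 w = f \<Longrightarrow>
       wp N B inp c (\<lambda>\<sigma>'. rg \<sigma>' x = ys ! j \<and> rg \<sigma>' u = w \<and> rg \<sigma>' 3 = N \<and> ar \<sigma>' 0 w = f \<and>
         I (Suc j) (setr t (N - (ys @ [N]) ! Suc j) (setr x ((ys @ [N]) ! Suc j) \<sigma>'))) (tick \<sigma>)"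
    and final: "\<And>\<sigma>. I (length ys) \<sigma> \<Longrightarrow> Q (tick \<sigma>)"
  shows "wp N B inp (ForList x t u c) Q \<sigma>"
proof -
  let ?J = "\<lambda>i \<sigma>. \<exists>j \<le> length ys. i = length ys - j \<and> I j \<sigma> \<and> rg \<sigma> x = (ys @ [N]) ! j \<and>
     rg \<sigma> t = N - (ys @ [N]) ! j \<and> rg \<sigma> u = w \<and> rg \<sigma> 3 = N \<and> ar \<sigma> 0 w = f"
  have le: "(ys @ [N]) ! j \<le> N \<and> ((ys @ [N]) ! j < N \<longleftrightarrow> j < length ys)" if "j \<le> length ys" for j
  proof (cases "j < length ys")
    case True
    then have "ys ! j \<in> set ys" by simp
    then have "ys ! j < N" using s(2) by blast
    then show ?thesis using True by (simp add: nth_append)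
  qed (use that in auto)
  have "wp N B inp (WhileNZ t (c ;; Atom (AGet x 0 u x) ;; Atom (ASub t 3 x))) Q
     (setr t (N - (ys @ [N]) ! 0) (setr x ((ys @ [N]) ! 0) \<sigma>))"
  proof (rule wp_while[where I = ?J])
    show "?J (length ys) (setr t (N - (ys @ [N]) ! 0) (setr x ((ys @ [N]) ! 0) \<sigma>))"
      using r s I0 by (intro exI[of _ 0]) auto
  next
    fix i \<sigma> assume "?J i \<sigma>" and nz: "rg \<sigma> t \<noteq> 0"
    then obtain j where j: "j \<le> length ys" "i = length ys - j" "I j \<sigma>" "rg \<sigma> x = (ys @ [N]) ! j"
       "rg \<sigma> t = N - (ys @ [N]) ! j" "rg \<sigma> u = w" "rg \<sigma> 3 = N" "ar \<sigma> 0 w = f" by blast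
    have jl: "j < length ys" using le[OF j(1)] nz j(5) by linarith
    then have x: "rg \<sigma> x = ys ! j" using j(4) by (simp add: nth_append)
    have yN: "ys ! j < N" using le[OF j(1)] jl by (simp add: nth_append)
    show "wp N B inp (c ;; Atom (AGet x 0 u x) ;; Atom (ASub t 3 x)) (\<lambda>\<sigma>'. \<exists>i'<i. ?J i' \<sigma>') (tick \<sigma>)"
      unfolding wp_seq
    proof (rule wp_mono[OF step[OF j(3) jl x j(6,7,8)]])
      fix \<sigma>' assume A: "rg \<sigma>' x = ys ! j \<and> rg \<sigma>' u = w \<and> rg \<sigma>' 3 = N \<and> ar \<sigma>' 0 w = f \<and>
         I (Suc j) (setr t (N - (ys @ [N]) ! Suc j) (setr x ((ys @ [N]) ! Suc j) \<sigma>'))"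
      then have "f (ys ! j) = (ys @ [N]) ! Suc j" using seg_nth[OF s(1) jl] by simp
      then show "wp N B inp (Atom (AGet x 0 u x)) (wp N B inp (Atom (ASub t 3 x)) (\<lambda>\<sigma>'. \<exists>i'<i. ?J i' \<sigma>')) \<sigma>'"
        using A r yN j(2) jl
        by (simp del: One_nat_def) (intro exI[of _ "length ys - Suc j"] conjI exI[of _ "Suc j"]; simp)
    qed
  next
    fix i \<sigma> assume "?J i \<sigma>" and z: "rg \<sigma> t = 0"
    then obtain j where j: "j \<le> length ys" "I j \<sigma>" "rg \<sigma> t = N - (ys @ [N]) ! j" by blast
    have "j = length ys" using le[OF j(1)] z j(1,3) by linarith
    then show "Q (tick \<sigma>)" using final j(2) by simp
  qed
  then show ?thesis using r s seg_first[OF s(1)] unfolding ForList_def by simp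
qed

text \<open>Registers: 0, 1, 2 hold these constants, 3 to 5 hold n, k, k - 1; 6 the size of S, 7 the depth of
  the node, 8 the row of the queue A, 9 its length, 10 the number of scanned elements of A, 11 the
  position in the witness, 12 the number of stuck runs, 13 the vertex v, 14 whether the node is
  finished, 15 whether the recursion is running, 16 the root vertex; the others are temporary.

  Arrays: 0 and 1 hold successors and predecessors in the adjacency lists (row u, with sentinel n), 2 the
  adjacency matrix; row d of array 3 holds the witness at depth d, and row d + 1 the queue of this node,
  which becomes the witness of the child; 4 holds S, 5 the marks of A, 6 to 9 are used by the base case,
  10 to 12 are the stack of v, |S| and stuck runs, 13 the vertices in components that are too small.\<close>

definition clear :: com where
  "clear = For 18 19 9 (Atom (AGet 21 3 8 19) ;; Atom (APut 5 21 0 0))"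

definition reset :: com where
  "reset = For 18 19 6 (Atom (AGet 21 4 19 0) ;; Atom (APut 3 8 19 21) ;; Atom (APut 5 21 0 1)) ;;
     Atom (AMove 9 6) ;; Atom (AConst 10 0) ;; Atom (AConst 11 0)"

text \<open>The position in the witness never moves back during a run: the queue only grows, so
  vertices that were skipped stay in it. All picks of a run together cost no more than one pass over
  the witness.\<close>

definition pick :: com where
  "pick = Atom (ASub 18 4 11) ;; IfNZ 18 (Atom (AGet 21 3 7 11) ;; Atom (AGet 18 5 21 0)) Skip ;;
     WhileNZ 18 (Atom (AAdd 11 11 1) ;; Atom (ASub 18 4 11) ;;
       IfNZ 18 (Atom (AGet 21 3 7 11) ;; Atom (AGet 18 5 21 0)) Skip)"

definition remove :: com where
  "remove = ForList 21 18 13 (Atom (AGet 22 1 21 13) ;; Atom (AGet 23 0 21 13) ;;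
     Atom (APut 0 21 22 23) ;; Atom (APut 1 21 23 22))"

definition restore :: com where
  "restore = ForList 21 18 13 (Atom (AGet 22 1 21 13) ;; Atom (AGet 23 0 21 13) ;;
     Atom (APut 0 21 22 13) ;; Atom (APut 1 21 23 13))"

text \<open>The vertex in register 13 is skipped and not unlinked, so that only a successful search
  is followed by a deletion. Inequality is tested by adding both truncated differences.\<close>

definition scan :: com where
  "scan = Atom (AGet 21 0 20 3) ;; Atom (ASub 18 3 21) ;;
     WhileNZ 18 ((
       Atom (ASub 22 21 13) ;; Atom (ASub 23 13 21) ;; Atom (AAdd 22 22 23) ;;
       IfNZ 22 (Atom (AGet 22 5 21 0) ;;
         IfNZ 22 Skip (Atom (APut 3 8 9 21) ;; Atom (APut 5 21 0 1) ;; Atom (AAdd 9 9 1))) Skip) ;;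
       Atom (AGet 21 0 20 21) ;; Atom (ASub 18 3 21) ;; IfNZ 18 (Atom (ASub 18 4 9)) Skip)"

definition search :: com where
  "search = Atom (ASub 24 4 9) ;; IfNZ 24 (Atom (ASub 24 9 10)) Skip ;;
     WhileNZ 24 (Atom (AGet 20 3 8 10) ;; scan ;; Atom (AAdd 10 10 1) ;;
       Atom (ASub 24 4 9) ;; IfNZ 24 (Atom (ASub 24 9 10)) Skip)"

definition same_except :: "nat set \<Rightarrow> hstate \<Rightarrow> hstate \<Rightarrow> bool" where
  "same_except R \<sigma> \<sigma>' \<longleftrightarrow> (\<forall>r. r \<notin> R \<longrightarrow> rg \<sigma>' r = rg \<sigma> r)"

lemma same_exceptD: "same_except R \<sigma> \<sigma>' \<Longrightarrow> r \<notin> R \<Longrightarrow> rg \<sigma>' r = rg \<sigma> r"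
  unfolding same_except_def by auto

text \<open>\<open>B\<close> bounds all registers and cells. Among the largest values are input
  addresses, at most \<open>n * n + 3\<close>, and the length prefix of an output record, which is
  estimated by \<open>n * n + n\<close>.\<close>

locale alg = kgraph +
  fixes B :: nat and inp :: "nat list"
  assumes B_large: "n * n + 2 * n + 100 < B"
begin

abbreviation "WP \<equiv> wp n B inp"

lemma less_B: "x \<le> n \<Longrightarrow> x < B" "x \<le> n \<Longrightarrow> Suc x < B" "x \<le> n \<Longrightarrow> y \<le> n \<Longrightarrow> x + y < B"
  using B_large by auto

definition const_regs :: "hstate \<Rightarrow> bool" where
  "const_regs \<sigma> \<longleftrightarrow> rg \<sigma> 0 = 0 \<and> rg \<sigma> 1 = 1 \<and> rg \<sigma> 2 = 2 \<and> rg \<sigma> 3 = n \<and> rg \<sigma> 4 = k \<and> rg \<sigma> 5 = k - 1"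

lemma const_regsD: "const_regs \<sigma> \<Longrightarrow> rg \<sigma> 0 = 0" "const_regs \<sigma> \<Longrightarrow> rg \<sigma> (Suc 0) = 1" "const_regs \<sigma> \<Longrightarrow> rg \<sigma> 2 = 2" "const_regs \<sigma> \<Longrightarrow> rg \<sigma> 3 = n"
   "const_regs \<sigma> \<Longrightarrow> rg \<sigma> 4 = k" "const_regs \<sigma> \<Longrightarrow> rg \<sigma> 5 = k - 1"
  unfolding const_regs_def by auto

lemma const_regs_same_except: "const_regs \<sigma> \<Longrightarrow> same_except R \<sigma> \<sigma>' \<Longrightarrow> R \<inter> {..5} = {} \<Longrightarrow> const_regs \<sigma>'"
proof -
  assume "const_regs \<sigma>" and s: "same_except R \<sigma> \<sigma>'" and R: "R \<inter> {..5} = {}"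
  have "rg \<sigma>' r = rg \<sigma> r" if "r \<le> 5" for r
    using same_exceptD[OF s, of r] R that by blast
  then show ?thesis using \<open>const_regs \<sigma>\<close> unfolding const_regs_def by simp
qed

text \<open>Marks are erased along the queue, so the cost is the length of the queue and not
  \<open>n\<close>.\<close>

lemma wp_clear:
  assumes "const_regs \<sigma>" "rg \<sigma> 9 = length qs" "distinct qs" "length qs \<le> n"
    "\<And>i. i < length qs \<Longrightarrow> ar \<sigma> 3 (rg \<sigma> 8) i = qs ! i" "ar \<sigma> 5 = marks (set qs)"
    "\<And>\<sigma>'. same_except {18,19,21} \<sigma> \<sigma>' \<Longrightarrow> ar \<sigma>' = (ar \<sigma>)(5 := marks {}) \<Longrightarrow> ou \<sigma>' = ou \<sigma> \<Longrightarrow>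
       tm \<sigma>' \<le> tm \<sigma> + 6 * length qs + 5 \<Longrightarrow> Q \<sigma>'"
  shows "WP clear Q \<sigma>"
  unfolding clear_def
proof (rule wp_For[where m = "length qs" and I = "\<lambda>j \<sigma>'. same_except {18,19,21} \<sigma> \<sigma>' \<and>
      ar \<sigma>' = (ar \<sigma>)(5 := marks (set (drop j qs))) \<and> ou \<sigma>' = ou \<sigma> \<and> tm \<sigma>' \<le> tm \<sigma> + 6 * j + 2"])
  fix j \<sigma>'
  assume I: "same_except {18,19,21} \<sigma> \<sigma>' \<and> ar \<sigma>' = (ar \<sigma>)(5 := marks (set (drop j qs))) \<and> ou \<sigma>' = ou \<sigma> \<and> tm \<sigma>' \<le> tm \<sigma> + 6 * j + 2"
    and j: "j < length qs" "rg \<sigma>' 19 = j" "rg \<sigma>' 9 = length qs" "rg \<sigma>' 1 = 1"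
  have const_regs': "const_regs \<sigma>'" using const_regs_same_except[OF assms(1)] I by auto
  have "rg \<sigma>' 8 = rg \<sigma> 8" using I by (auto simp: same_except_def)
  then have q: "ar \<sigma>' 3 (rg \<sigma>' 8) j = qs ! j" using I assms(5)[OF j(1)] by simp
  have d: "set (drop j qs) - {qs ! j} = set (drop (Suc j) qs)"
    using assms(3) j(1) by (metis Cons_nth_drop_Suc Diff_insert_absorb distinct.simps(2) distinct_drop list.simps(15))
  show "WP (Atom (AGet 21 3 8 19) ;; Atom (APut 5 21 0 0)) (\<lambda>\<sigma>''. rg \<sigma>'' 19 = j \<and> rg \<sigma>'' 9 = length qs \<and>
      rg \<sigma>'' 1 = 1 \<and> same_except {18,19,21} \<sigma> (setr 18 (length qs - Suc j) (setr 19 (Suc j) \<sigma>'')) \<and>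
      ar (setr 18 (length qs - Suc j) (setr 19 (Suc j) \<sigma>'')) = (ar \<sigma>)(5 := marks (set (drop (Suc j) qs))) \<and>
      ou (setr 18 (length qs - Suc j) (setr 19 (Suc j) \<sigma>'')) = ou \<sigma> \<and>
      tm (setr 18 (length qs - Suc j) (setr 19 (Suc j) \<sigma>'')) \<le> tm \<sigma> + 6 * Suc j + 2) (tick \<sigma>')"
    using I j q d assms(4) const_regsD[OF const_regs'] by (simp add: update2_marks same_except_def)
qed (use assms const_regsD[OF assms(1)] less_B in \<open>auto simp: same_except_def\<close>)

lemma wp_reset:
  assumes "const_regs \<sigma>" "rg \<sigma> 6 = length ss" "length ss \<le> n"
    "\<And>i. i < length ss \<Longrightarrow> ar \<sigma> 4 i 0 = ss ! i" "ar \<sigma> 5 = marks {}"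
    "\<And>\<sigma>'. same_except {9,10,11,18,19,21} \<sigma> \<sigma>' \<Longrightarrow> rg \<sigma>' 9 = length ss \<Longrightarrow> rg \<sigma>' 10 = 0 \<Longrightarrow> rg \<sigma>' 11 = 0 \<Longrightarrow>
       ar \<sigma>' 5 = marks (set ss) \<Longrightarrow> (\<And>i. i < length ss \<Longrightarrow> ar \<sigma>' 3 (rg \<sigma> 8) i = ss ! i) \<Longrightarrow>
       (\<And>r. r \<noteq> rg \<sigma> 8 \<Longrightarrow> ar \<sigma>' 3 r = ar \<sigma> 3 r) \<Longrightarrow> (\<And>a. a \<noteq> 3 \<Longrightarrow> a \<noteq> 5 \<Longrightarrow> ar \<sigma>' a = ar \<sigma> a) \<Longrightarrow>
       ou \<sigma>' = ou \<sigma> \<Longrightarrow> tm \<sigma>' \<le> tm \<sigma> + 7 * length ss + 8 \<Longrightarrow> Q \<sigma>'"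
  shows "WP reset Q \<sigma>"
  unfolding reset_def wp_seq
proof (rule wp_For[where m = "length ss" and I = "\<lambda>j \<sigma>'. same_except {18,19,21} \<sigma> \<sigma>' \<and> ou \<sigma>' = ou \<sigma> \<and>
      ar \<sigma>' 5 = marks (set (take j ss)) \<and> (\<forall>i<j. ar \<sigma>' 3 (rg \<sigma> 8) i = ss ! i) \<and>
      (\<forall>r. r \<noteq> rg \<sigma> 8 \<longrightarrow> ar \<sigma>' 3 r = ar \<sigma> 3 r) \<and> (\<forall>a. a \<noteq> 3 \<longrightarrow> a \<noteq> 5 \<longrightarrow> ar \<sigma>' a = ar \<sigma> a) \<and>
      tm \<sigma>' \<le> tm \<sigma> + 7 * j + 2"], goal_cases)
  case (10 j \<sigma>')
  note I = 10(1) and j = 10(2-)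
  have const_regs': "const_regs \<sigma>'" using const_regs_same_except[OF assms(1)] I by auto
  have r: "rg \<sigma>' 8 = rg \<sigma> 8" using I by (auto simp: same_except_def)
  have q: "ar \<sigma>' 4 j 0 = ss ! j" using I assms(4)[OF j(1)] by simp
  have d: "insert (ss ! j) (set (take j ss)) = set (take (Suc j) ss)"
    using j(1) by (simp add: take_Suc_conv_app_nth)
  have u: "update2 g a b c r = g r" if "r \<noteq> a" for g a b c r using that by (auto simp: update2_def)
  show ?case
    using I j q d r assms(3) const_regsD[OF const_regs'] by (simp add: update2_marks same_except_def u) (simp add: update2_def less_Suc_eq)
next
  case (11 \<sigma>')
  have const_regs': "const_regs \<sigma>'" using const_regs_same_except[OF assms(1)] 11 by auto
  show ?case unfolding wp_atom
    by (intro conjI; (rule assms(6))?) (use 11 assms(2,3) less_B const_regsD[OF const_regs'] in \<open>simp_all add: same_except_def\<close>)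
qed (use assms const_regsD[OF assms(1)] less_B in \<open>simp_all add: same_except_def\<close>)

lemma wp_pick:
  assumes "const_regs \<sigma>" "rg \<sigma> 11 = p" "p \<le> k" "length ts = k" "\<And>i. i < k \<Longrightarrow> ar \<sigma> 3 (rg \<sigma> 7) i = ts ! i"
    "ar \<sigma> 5 = marks A"
    "\<And>\<sigma>' p'. same_except {11,18,21} \<sigma> \<sigma>' \<Longrightarrow> rg \<sigma>' 11 = p' \<Longrightarrow> p \<le> p' \<Longrightarrow> p' \<le> k \<Longrightarrow>
       (\<And>i. p \<le> i \<Longrightarrow> i < p' \<Longrightarrow> ts ! i \<in> A) \<Longrightarrow> (p' < k \<Longrightarrow> ts ! p' \<notin> A) \<Longrightarrow>
       ar \<sigma>' = ar \<sigma> \<Longrightarrow> ou \<sigma>' = ou \<sigma> \<Longrightarrow> tm \<sigma>' \<le> tm \<sigma> + 8 * (p' - p) + 8 \<Longrightarrow> Q \<sigma>'"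
  shows "WP pick Q \<sigma>"
proof -
  let ?I = "\<lambda>i \<sigma>'. \<exists>p'. p \<le> p' \<and> p' \<le> k \<and> i = k - p' \<and> rg \<sigma>' 11 = p' \<and> same_except {11,18,21} \<sigma> \<sigma>' \<and>
     (\<forall>i. p \<le> i \<and> i < p' \<longrightarrow> ts ! i \<in> A) \<and> (rg \<sigma>' 18 \<noteq> 0 \<longleftrightarrow> p' < k \<and> ts ! p' \<in> A) \<and>
     ar \<sigma>' = ar \<sigma> \<and> ou \<sigma>' = ou \<sigma> \<and> tm \<sigma>' + 2 \<le> tm \<sigma> + 8 * (p' - p) + 8"
  have "WP (WhileNZ 18 (Atom (AAdd 11 11 1) ;; Atom (ASub 18 4 11) ;;
       IfNZ 18 (Atom (AGet 21 3 7 11) ;; Atom (AGet 18 5 21 0)) Skip)) Q \<sigma>'" if "?I i \<sigma>'" for i \<sigma>'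
  proof (rule wp_while[where I = ?I, OF that], goal_cases)
    case (1 i \<sigma>')
    then obtain p' where p': "p \<le> p'" "p' < k" "i = k - p'" "rg \<sigma>' 11 = p'" "same_except {11,18,21} \<sigma> \<sigma>'"
     "\<forall>i. p \<le> i \<and> i < p' \<longrightarrow> ts ! i \<in> A" "ts ! p' \<in> A" "ar \<sigma>' = ar \<sigma>" "ou \<sigma>' = ou \<sigma>"
     "tm \<sigma>' + 2 \<le> tm \<sigma> + 8 * (p' - p) + 8" by blast
    have const_regs': "const_regs \<sigma>'" using const_regs_same_except[OF assms(1) p'(5)] by auto
    have r7: "rg \<sigma>' 7 = rg \<sigma> 7" using p'(5) by (simp add: same_except_def)
    have a: "\<forall>i. p \<le> i \<and> i < Suc p' \<longrightarrow> ts ! i \<in> A" using p'(6,7) by (auto simp: less_Suc_eq)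
    have t: "tm \<sigma>' + 10 \<le> tm \<sigma> + 8 * (Suc p' - p) + 8" using p'(10,1) by (simp add: Suc_diff_le)
    show ?case
    proof (cases "Suc p' < k")
      case True
      have q: "ar \<sigma> 3 (rg \<sigma>' 7) (Suc p') = ts ! Suc p'" using assms(5)[OF True] r7 by simp
      show ?thesis using True p' a t q r7 assms(6) const_regsD[OF const_regs'] k_le_n less_B
        by (simp del: One_nat_def, intro exI[of _ "k - Suc p'"] conjI exI[of _ "Suc p'"])
           (simp_all add: same_except_def marks_def)
    next
      case False
      then show ?thesis using p' a t r7 assms(6) const_regsD[OF const_regs'] k_le_n less_B
        by (simp del: One_nat_def, intro exI[of _ "k - Suc p'"] conjI exI[of _ "Suc p'"])
           (simp_all add: same_except_def marks_def)
    qed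
  next
    case (2 i \<sigma>')
    then obtain p' where p': "p \<le> p'" "p' \<le> k" "rg \<sigma>' 11 = p'" "same_except {11,18,21} \<sigma> \<sigma>'"
     "\<forall>i. p \<le> i \<and> i < p' \<longrightarrow> ts ! i \<in> A" "p' < k \<longrightarrow> ts ! p' \<notin> A" "ar \<sigma>' = ar \<sigma>" "ou \<sigma>' = ou \<sigma>"
     "tm \<sigma>' + 2 \<le> tm \<sigma> + 8 * (p' - p) + 8" by blast
    show ?case by (rule assms(7)[of _ p']) (use p' in \<open>simp_all add: same_except_def\<close>)
  qed
  note W = this
  show ?thesis
  proof (cases "p < k")
    case True
    have q: "ar \<sigma> 3 (rg \<sigma> 7) p = ts ! p" using assms(5)[OF True] .
    show ?thesis unfolding pick_def
      using True q assms(2,6) const_regsD[OF assms(1)] k_le_n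
      by simp (rule W[unfolded One_nat_def, of "k - p"], rule exI[of _ p], auto simp: same_except_def marks_def)
  next
    case False
    then show ?thesis unfolding pick_def
      using assms(2,3) const_regsD[OF assms(1)]
      by simp (rule W[unfolded One_nat_def, of 0], rule exI[of _ p], auto simp: same_except_def)
  qed
qed

section \<open>Unlinking and relinking a vertex\<close>

definition adjacency_rep :: "nat set \<Rightarrow> (nat \<Rightarrow> nat \<Rightarrow> nat) \<Rightarrow> (nat \<Rightarrow> nat \<Rightarrow> nat) \<Rightarrow> bool" where
  "adjacency_rep X f g \<longleftrightarrow> (\<forall>u<n. u \<notin> X \<longrightarrow>
     (\<exists>ys. distinct ys \<and> set ys = {w. adj u w \<and> w \<notin> X} \<and> seg (f u) (g u) n ys n))"

text \<open>The successors (and, with f and g exchanged, the predecessors) after v has been unlinked from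
  the lists of the vertices in D. The links of v itself stay, so unlinking can be undone.\<close>

definition unlink :: "nat set \<Rightarrow> (nat \<Rightarrow> nat \<Rightarrow> nat) \<Rightarrow> (nat \<Rightarrow> nat \<Rightarrow> nat) \<Rightarrow> nat \<Rightarrow> nat \<Rightarrow> nat \<Rightarrow> nat" where
  "unlink D f g v = (\<lambda>u x. if u \<in> D \<and> x = g u v then f u v else f u x)"

lemma adjacency_repE:
  assumes "adjacency_rep X f g" "u < n" "u \<notin> X"
  obtains ys where "distinct ys" "set ys = {w. adj u w \<and> w \<notin> X}" "seg (f u) (g u) n ys n"
    "set ys \<subseteq> {..<n}" "length ys = live_deg X u"
proof -
  obtain ys where ys: "distinct ys" "set ys = {w. adj u w \<and> w \<notin> X}" "seg (f u) (g u) n ys n"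
    using assms by (auto simp: adjacency_rep_def)
  have "length ys = live_deg X u" unfolding live_deg_def ys(2)[symmetric] using ys(1) distinct_card by metis
  moreover have "set ys \<subseteq> {..<n}" using ys(2) adj_less' by auto
  ultimately show thesis using that ys by blast
qed

lemma adjacency_rep_entry:
  assumes "adjacency_rep X f g" "adj w v" "w \<notin> X" "v \<notin> X"
  shows "f w (g w v) = v" "g w (f w v) = v" "f w v \<noteq> v" "g w v \<noteq> v" "f w v \<le> n" "g w v \<le> n"
proof -
  obtain ys where ys: "distinct ys" "set ys = {x. adj w x \<and> x \<notin> X}" "seg (f w) (g w) n ys n" "set ys \<subseteq> {..<n}"
    using adjacency_repE[OF assms(1) adj_less[OF assms(2)] assms(3)] .
  then have "v \<in> set ys" using assms by auto
  then obtain as bs where ab: "ys = as @ v # bs" by (meson split_list)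
  then have s: "seg (f w) (g w) n as v" "seg (f w) (g w) v bs n" using ys(3) by (auto simp: seg_append)
  have m: "g w v \<in> insert n (set as)" "f w v \<in> insert n (set bs)" using seg_pred[OF s(1)] seg_succ[OF s(2)] .
  show "f w v \<noteq> v" "g w v \<noteq> v" "f w v \<le> n" "g w v \<le> n" using m ys(1,4) ab by auto
  have last: "seg h h' a xs b \<Longrightarrow> h (h' b) = b" for h h' a xs and b :: nat
    by (induction xs arbitrary: a) auto
  show "f w (g w v) = v" using last[OF s(1)] .
  show "g w (f w v) = v" using s(2) by (cases bs) auto
qed

text \<open>Nothing is claimed about the row of \<open>v\<close>: rows of deleted vertices are
  frozen, and \<open>restore\<close> later walks along this frozen row to find the lists in which
  \<open>v\<close> has to be linked again.\<close>

lemma adjacency_rep_remove: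
  assumes "adjacency_rep X f g" "v < n" "v \<notin> X" "D = {w. adj v w \<and> w \<notin> X}"
  shows "adjacency_rep (insert v X) (unlink D f g v) (unlink D g f v)"
  unfolding adjacency_rep_def
proof (intro allI impI)
  fix u assume u: "u < n" "u \<notin> insert v X"
  then have u': "u \<notin> X" by auto
  obtain ys where ys: "distinct ys" "set ys = {x. adj u x \<and> x \<notin> X}" "seg (f u) (g u) n ys n" "set ys \<subseteq> {..<n}"
    using adjacency_repE[OF assms(1) u(1) u'] .
  show "\<exists>ys. distinct ys \<and> set ys = {w. adj u w \<and> w \<notin> insert v X} \<and> seg (unlink D f g v u) (unlink D g f v u) n ys n"
  proof (cases "u \<in> D")
    case True
    then have "v \<in> set ys" using ys(2) assms(3,4) adj_sym by auto
    then obtain as bs where ab: "ys = as @ v # bs" by (meson split_list)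
    have "n \<notin> set ys" using ys(4) by auto
    then have "seg ((f u)(g u v := f u v)) ((g u)(f u v := g u v)) n (as @ bs) n"
      using seg_remove[of "f u" "g u" n as v bs n] ys(1,3) ab by simp
    moreover have "unlink D f g v u = (f u)(g u v := f u v)" "unlink D g f v u = (g u)(f u v := g u v)"
      using True by (auto simp: unlink_def)
    moreover have "set (as @ bs) = {w. adj u w \<and> w \<notin> insert v X}"
    proof -
      have "set (as @ bs) = set ys - {v}" using ab ys(1) by auto
      then show ?thesis using ys(2) by auto
    qed
    ultimately show ?thesis using ab ys(1) by (intro exI[of _ "as @ bs"]) auto
  next
    case False
    then have "\<not> adj u v" using assms(4) u' adj_sym by auto
    then have "set ys = {w. adj u w \<and> w \<notin> insert v X}" using ys(2) by auto
    moreover have "unlink D f g v u = f u" "unlink D g f v u = g u" using False by (auto simp: unlink_def)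
    ultimately show ?thesis using ys by auto
  qed
qed

lemma wp_remove:
  assumes "const_regs \<sigma>" "rg \<sigma> 13 = v" "v < n" "v \<notin> X" "adjacency_rep X (ar \<sigma> 0) (ar \<sigma> 1)" "D = {w. adj v w \<and> w \<notin> X}"
    "\<And>\<sigma>'. same_except {18,21,22,23} \<sigma> \<sigma>' \<Longrightarrow>
       ar \<sigma>' = (ar \<sigma>)(0 := unlink D (ar \<sigma> 0) (ar \<sigma> 1) v, 1 := unlink D (ar \<sigma> 1) (ar \<sigma> 0) v) \<Longrightarrow>
       ou \<sigma>' = ou \<sigma> \<Longrightarrow> tm \<sigma>' \<le> tm \<sigma> + 8 * live_deg X v + 4 \<Longrightarrow> Q \<sigma>'"
  shows "WP remove Q \<sigma>"
proof -
  let ?f = "ar \<sigma> 0" and ?g = "ar \<sigma> 1"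
  obtain ys where ys: "distinct ys" "set ys = {w. adj v w \<and> w \<notin> X}" "seg (?f v) (?g v) n ys n"
    "set ys \<subseteq> {..<n}" "length ys = live_deg X v"
    using adjacency_repE[OF assms(5,3,4)] .
  show ?thesis unfolding remove_def
  proof (rule wp_ForList[where w = v and ys = ys and f = "?f v" and g = "?g v" and I = "\<lambda>j \<sigma>'. same_except {18,21,22,23} \<sigma> \<sigma>' \<and>
       ar \<sigma>' = (ar \<sigma>)(0 := unlink (set (take j ys)) ?f ?g v, 1 := unlink (set (take j ys)) ?g ?f v) \<and>
       ou \<sigma>' = ou \<sigma> \<and> tm \<sigma>' \<le> tm \<sigma> + 8 * j + 2"], goal_cases)
    case (12 j \<sigma>')
    note I = 12(1) and j = 12(2-)
    have const_regs': "const_regs \<sigma>'" using const_regs_same_except[OF assms(1)] I by auto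
    let ?w = "ys ! j" and ?D = "set (take j ys)"
    have wm: "?w \<in> set ys" using j(1) by simp
    then have w: "adj ?w v" "?w \<notin> X" using ys(2) adj_sym by auto
    have wD: "?w \<notin> ?D" using ys(1) j(1) by (auto simp: in_set_conv_nth nth_eq_iff_index_eq)
    have vD: "v \<notin> insert ?w ?D" using ys(2) adj_irrefl set_take_subset[of j ys] wm by blast
    have vw: "v \<noteq> ?w" using vD by simp
    note e = adjacency_rep_entry[OF assms(5) w assms(4)]
    have d: "insert ?w ?D = set (take (Suc j) ys)" using j(1) by (simp add: take_Suc_conv_app_nth)
    have r: "unlink ?D f g v ?w = f ?w" for f g using wD by (auto simp: unlink_def)
    have rv: "unlink E f g v v = f v" if "v \<notin> E" for f g E using that by (auto simp: unlink_def)
    have u: "update2 (unlink ?D f g v) ?w (g ?w v) (f ?w v) = unlink (insert ?w ?D) f g v" for f g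
      using wD by (auto simp: unlink_def update2_def fun_eq_iff)
    have r13: "rg \<sigma>' 13 = v" using I assms(2) by (simp add: same_except_def)
    have b: "v \<le> n" using assms(3) by simp
    show ?case
      using I j r u e d[symmetric] rv[OF vD] b r13 const_regsD[OF const_regs'] vw
      by (simp add: same_except_def)
  next
    case (13 \<sigma>')
    then show ?case by (intro assms(7)) (use ys assms(6) in \<open>simp_all add: same_except_def\<close>)
  qed (use assms ys const_regsD[OF assms(1)] in \<open>simp_all add: same_except_def unlink_def fun_eq_iff\<close>)
qed

lemma wp_restore:
  assumes "const_regs \<sigma>" "rg \<sigma> 13 = v" "v < n" "v \<notin> X" "adjacency_rep X f g" "D = {w. adj v w \<and> w \<notin> X}"
    "ar \<sigma> 0 = unlink D f g v" "ar \<sigma> 1 = unlink D g f v"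
    "\<And>\<sigma>'. same_except {18,21,22,23} \<sigma> \<sigma>' \<Longrightarrow> ar \<sigma>' = (ar \<sigma>)(0 := f, 1 := g) \<Longrightarrow>
       ou \<sigma>' = ou \<sigma> \<Longrightarrow> tm \<sigma>' \<le> tm \<sigma> + 8 * live_deg X v + 4 \<Longrightarrow> Q \<sigma>'"
  shows "WP restore Q \<sigma>"
proof -
  obtain ys where ys: "distinct ys" "set ys = {w. adj v w \<and> w \<notin> X}" "seg (f v) (g v) n ys n"
    "set ys \<subseteq> {..<n}" "length ys = live_deg X v"
    using adjacency_repE[OF assms(5,3,4)] .
  have D: "D = set ys" using ys(2) assms(6) by simp
  have vD: "v \<notin> D" using assms(6) adj_irrefl by simp
  have rv: "unlink E f g v v = f v" if "E \<subseteq> D" for f g E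
  proof -
    have "v \<notin> E" using that vD by blast
    then show ?thesis by (simp add: unlink_def)
  qed
  show ?thesis unfolding restore_def
  proof (rule wp_ForList[where w = v and ys = ys and f = "f v" and g = "g v" and I = "\<lambda>j \<sigma>'. same_except {18,21,22,23} \<sigma> \<sigma>' \<and>
       ar \<sigma>' = (ar \<sigma>)(0 := unlink (set (drop j ys)) f g v, 1 := unlink (set (drop j ys)) g f v) \<and>
       ou \<sigma>' = ou \<sigma> \<and> tm \<sigma>' \<le> tm \<sigma> + 8 * j + 2"], goal_cases)
    case (12 j \<sigma>')
    note I = 12(1) and j = 12(2-)
    have const_regs': "const_regs \<sigma>'" using const_regs_same_except[OF assms(1)] I by auto
    let ?w = "ys ! j" and ?D = "set (drop j ys)" and ?E = "set (drop (Suc j) ys)"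
    have wm: "?w \<in> set ys" using j(1) by simp
    then have w: "adj ?w v" "?w \<notin> X" using ys(2) adj_sym by auto
    have dr: "drop j ys = ?w # drop (Suc j) ys" using j(1) by (simp add: Cons_nth_drop_Suc)
    have wE: "?w \<notin> ?E" using ys(1) dr by (metis distinct.simps(2) distinct_drop)
    have vw: "v \<noteq> ?w" using vD D wm by auto
    note e = adjacency_rep_entry[OF assms(5) w assms(4)]
    have d: "?D = insert ?w ?E" using dr by simp
    \<comment> \<open>A list entry is neither its own predecessor nor its own successor, so the
      links stored at \<open>v\<close> in the row of \<open>?w\<close> have survived the
      unlinking.\<close>
    have r: "unlink ?D f g v ?w v = f ?w v" "unlink ?D g f v ?w v = g ?w v" using e by (auto simp: unlink_def)
    have u: "update2 (unlink ?D f g v) ?w (g ?w v) v = unlink ?E f g v" "update2 (unlink ?D g f v) ?w (f ?w v) v = unlink ?E g f v"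
      using wE e unfolding d by (auto simp: unlink_def update2_def fun_eq_iff)
    have ED: "?E \<subseteq> D" using D set_drop_subset by metis
    have r13: "rg \<sigma>' 13 = v" using I assms(2) by (simp add: same_except_def)
    have b: "v \<le> n" using assms(3) by simp
    show ?case
      using I j r u e rv[OF ED] b r13 const_regsD[OF const_regs'] vw
      by (simp add: same_except_def)
  next
    case (13 \<sigma>')
    then show ?case by (intro assms(9)) (use ys assms(6) in \<open>simp_all add: same_except_def unlink_def\<close>)
  next
    case 10
    show ?case using assms(7) rv[of D f g] by simp
  next
    case 11
    have "ar \<sigma> = (ar \<sigma>)(0 := unlink D f g v, 1 := unlink D g f v)"
      using assms(7,8) by (metis fun_upd_triv)
    then show ?case using D by (simp add: same_except_def)
  qed (use assms ys const_regsD[OF assms(1)] in \<open>simp_all add: same_except_def\<close>)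
qed

text \<open>\<open>j\<close> is the number of list entries that are read. A scan that stops at the
  \<open>k\<close>-th vertex must not be charged for the whole list, whose length may exceed
  anything the found set pays for; so the caller learns that all entries read lie in the queue,
  apart from \<open>v\<close>.\<close>

lemma wp_scan:
  assumes "const_regs \<sigma>" "rg \<sigma> 13 = v" "v \<le> n" "rg \<sigma> 20 = u" "rg \<sigma> 8 = R"
    "seg (ar \<sigma> 0 u) (ar \<sigma> 1 u) n ys n" "distinct ys" "set ys \<subseteq> {..<n}"
    "rg \<sigma> 9 = length qs" "length qs < k" "distinct qs"
    "\<And>i. i < length qs \<Longrightarrow> ar \<sigma> 3 R i = qs ! i" "ar \<sigma> 5 = marks (set qs)"
    "\<And>\<sigma>' more j. same_except {9,18,21,22,23} \<sigma> \<sigma>' \<Longrightarrow> rg \<sigma>' 9 = length (qs @ more) \<Longrightarrow> length (qs @ more) \<le> k \<Longrightarrow>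
       distinct (qs @ more) \<Longrightarrow> set more \<subseteq> set ys - {v} \<Longrightarrow> set (take j ys) \<subseteq> insert v (set (qs @ more)) \<Longrightarrow>
       j \<le> length ys \<Longrightarrow> (length (qs @ more) < k \<Longrightarrow> j = length ys) \<Longrightarrow>
       (\<And>i. i < length (qs @ more) \<Longrightarrow> ar \<sigma>' 3 R i = (qs @ more) ! i) \<Longrightarrow> ar \<sigma>' 5 = marks (set (qs @ more)) \<Longrightarrow>
       (\<And>r. r \<noteq> R \<Longrightarrow> ar \<sigma>' 3 r = ar \<sigma> 3 r) \<Longrightarrow> (\<And>a. a \<noteq> 3 \<Longrightarrow> a \<noteq> 5 \<Longrightarrow> ar \<sigma>' a = ar \<sigma> a) \<Longrightarrow>
       ou \<sigma>' = ou \<sigma> \<Longrightarrow> tm \<sigma>' \<le> tm \<sigma> + 15 * j + 5 \<Longrightarrow> Q \<sigma>'"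
  shows "WP scan Q \<sigma>"
proof -
  define P where "P \<sigma>' j more \<longleftrightarrow> same_except {9,18,21,22,23} \<sigma> \<sigma>' \<and> rg \<sigma>' 9 = length (qs @ more) \<and> length (qs @ more) \<le> k \<and>
     distinct (qs @ more) \<and> set more \<subseteq> set ys - {v} \<and> set (take j ys) \<subseteq> insert v (set (qs @ more)) \<and> j \<le> length ys \<and>
     (\<forall>i < length (qs @ more). ar \<sigma>' 3 R i = (qs @ more) ! i) \<and> ar \<sigma>' 5 = marks (set (qs @ more)) \<and>
     (\<forall>r. r \<noteq> R \<longrightarrow> ar \<sigma>' 3 r = ar \<sigma> 3 r) \<and> (\<forall>a. a \<noteq> 3 \<longrightarrow> a \<noteq> 5 \<longrightarrow> ar \<sigma>' a = ar \<sigma> a) \<and> ou \<sigma>' = ou \<sigma>" for \<sigma>' j more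
  define I where "I i \<sigma>' \<longleftrightarrow> (\<exists>j more. i = length ys - j \<and> P \<sigma>' j more \<and> rg \<sigma>' 21 = (ys @ [n]) ! j \<and>
     (rg \<sigma>' 18 \<noteq> 0 \<longleftrightarrow> j < length ys \<and> length (qs @ more) < k) \<and> tm \<sigma>' + 2 \<le> tm \<sigma> + 15 * j + 5)" for i \<sigma>'
  define frame_step where "frame_step = (Atom (ASub 22 21 13) ;; Atom (ASub 23 13 21) ;; Atom (AAdd 22 22 23) ;;
       IfNZ 22 (Atom (AGet 22 5 21 0) ;;
         IfNZ 22 Skip (Atom (APut 3 8 9 21) ;; Atom (APut 5 21 0 1) ;; Atom (AAdd 9 9 1))) Skip)"
  define tail where "tail = (Atom (AGet 21 0 20 21) ;; Atom (ASub 18 3 21) ;; IfNZ 18 (Atom (ASub 18 4 9)) Skip)"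
  have up: "update2 g a b c r = g r" if "r \<noteq> a" for g a b c r using that by (auto simp: update2_def)
  have le: "(ys @ [n]) ! j \<le> n \<and> ((ys @ [n]) ! j < n \<longleftrightarrow> j < length ys)" if "j \<le> length ys" for j
  proof (cases "j < length ys")
    case True
    then have "ys ! j \<in> set ys" by simp
    then have "ys ! j < n" using assms(8) by blast
    then show ?thesis using True by (simp add: nth_append)
  qed (use that in auto)
  have W: "WP (WhileNZ 18 (frame_step ;; tail)) Q \<sigma>'" if "I i \<sigma>'" for i \<sigma>'
  proof (rule wp_while[where I = I, OF that], goal_cases)
    case (1 i \<sigma>')
    then obtain j more where j: "i = length ys - j" "P \<sigma>' j more" "rg \<sigma>' 21 = (ys @ [n]) ! j" "j < length ys"
       "length (qs @ more) < k" "tm \<sigma>' + 2 \<le> tm \<sigma> + 15 * j + 5" unfolding I_def by blast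
    note P = j(2)[unfolded P_def]
    have const_regs': "const_regs \<sigma>'" using const_regs_same_except[OF assms(1)] P by auto
    have x: "rg \<sigma>' 21 = ys ! j" using j(3,4) by (simp add: nth_append)
    have xm: "ys ! j \<in> set ys" using j(4) by simp
    then have xn: "ys ! j < n" using assms(8) by blast
    have r: "rg \<sigma>' 13 = v" "rg \<sigma>' 20 = u" "rg \<sigma>' 8 = R" using P assms(2,4,5) by (simp_all add: same_except_def)
    have tk: "set (take (Suc j) ys) = insert (ys ! j) (set (take j ys))"
      using j(4) by (simp add: take_Suc_conv_app_nth)
    have S: "P \<sigma>1 (Suc j) more1 \<Longrightarrow> tm \<sigma>1 \<le> tm \<sigma>' + 10 \<Longrightarrow> rg \<sigma>1 21 = ys ! j \<Longrightarrow>
       WP tail (\<lambda>\<sigma>'. \<exists>i'<i. I i' \<sigma>') \<sigma>1" for \<sigma>1 more1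
    proof -
      assume P1: "P \<sigma>1 (Suc j) more1" and t1: "tm \<sigma>1 \<le> tm \<sigma>' + 10" and x1: "rg \<sigma>1 21 = ys ! j"
      note P1' = P1[unfolded P_def]
      have st1: "const_regs \<sigma>1" using const_regs_same_except[OF assms(1)] P1' by auto
      have r1: "rg \<sigma>1 20 = u" using P1' assms(4) by (simp add: same_except_def)
      have a: "ar \<sigma>1 0 u (ys ! j) = (ys @ [n]) ! Suc j" using P1' seg_nth[OF assms(6) j(4)] by simp
      have m: "Suc j \<le> length ys" using j(4) by simp
      show "WP tail (\<lambda>\<sigma>'. \<exists>i'<i. I i' \<sigma>') \<sigma>1"
        unfolding tail_def
      proof (cases "n - (ys @ [n]) ! Suc j = 0")
        case True
        have jl: "Suc j = length ys" using le[OF m] True m by linarith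
        show "WP (Atom (AGet 21 0 20 21) ;; Atom (ASub 18 3 21) ;; IfNZ 18 (Atom (ASub 18 4 9)) Skip)
           (\<lambda>\<sigma>'. \<exists>i'<i. I i' \<sigma>') \<sigma>1"
          using True const_regsD[OF st1] x1 r1 a xn
          apply simp
          apply (rule exI[of _ "length ys - Suc j"], rule conjI)
          subgoal using j(1,4) by simp
          unfolding I_def
          apply (rule exI[of _ "Suc j"], rule exI[of _ more1])
          using P1' t1 j(6) jl by (simp add: same_except_def P_def not_le)
      next
        case False
        have jl: "Suc j < length ys" using le[OF m] False m by linarith
        show "WP (Atom (AGet 21 0 20 21) ;; Atom (ASub 18 3 21) ;; IfNZ 18 (Atom (ASub 18 4 9)) Skip)
           (\<lambda>\<sigma>'. \<exists>i'<i. I i' \<sigma>') \<sigma>1"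
          using False const_regsD[OF st1] x1 r1 a xn
          apply simp
          apply (rule exI[of _ "length ys - Suc j"], rule conjI)
          subgoal using j(1,4) by simp
          unfolding I_def
          apply (rule exI[of _ "Suc j"], rule exI[of _ more1])
          using P1' t1 j(6) jl by (simp add: same_except_def P_def not_le)
      qed
    qed
    have vn: "ys ! j - v + (v - ys ! j) \<noteq> 0 \<longleftrightarrow> ys ! j \<noteq> v" by linarith
    have bd: "ys ! j - v + (v - ys ! j) < B" "Suc (length (qs @ more)) < B" "length (qs @ more) \<le> n"
      using xn assms(3) B_large j(5) k_le_n by linarith+
    consider (a) "ys ! j = v" | (b) "ys ! j \<noteq> v" "ys ! j \<in> set (qs @ more)" | (c) "ys ! j \<noteq> v" "ys ! j \<notin> set (qs @ more)" by blast
    then have "WP frame_step (WP tail (\<lambda>\<sigma>'. \<exists>i'<i. I i' \<sigma>')) (tick \<sigma>')"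
    proof cases
      case a
      show ?thesis unfolding frame_step_def
        using const_regsD[OF const_regs'] x r bd(1) a
        by simp (rule S[of _ more]; use P j(4) tk a x in \<open>simp add: same_except_def P_def\<close>)
    next
      case b
      have m: "marks (set (qs @ more)) (ys ! j) 0 = 1" using b by (simp add: marks_def)
      show ?thesis unfolding frame_step_def
        using const_regsD[OF const_regs'] x r bd(1) b vn m P
        by simp (rule S[of _ more]; use P j(4) tk b x in \<open>simp add: same_except_def P_def\<close>)
    next
      case c
      have m: "marks (set (qs @ more)) (ys ! j) 0 = 0" using c by (simp add: marks_def)
      have ap: "qs @ more @ [ys ! j] = (qs @ more) @ [ys ! j]" by simp
      have row: "update2 (ar \<sigma>' 3) R (length (qs @ more)) (ys ! j) R i = (qs @ more @ [ys ! j]) ! i"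
        if "i < Suc (length (qs @ more))" for i
        using that P unfolding ap nth_append by (auto simp: update2_def less_Suc_eq)
      have sb: "set (take j ys) \<subseteq> insert v (insert (ys ! j) (set qs \<union> set more))" using P by auto
      have ix: "update2 (marks (set (qs @ more))) (ys ! j) 0 (Suc 0) = marks (set (qs @ more @ [ys ! j]))"
        unfolding update2_marks by simp
      show ?thesis unfolding frame_step_def
        using const_regsD[OF const_regs'] x r bd c vn m P
        by simp (rule S[of _ "more @ [ys ! j]"]; use P j(4,5) tk c x xm row ix up sb in \<open>simp add: same_except_def P_def\<close>)
    qed
    then show ?case by simp
  next
    case (2 i \<sigma>')
    then obtain j more where j: "P \<sigma>' j more" "\<not> (j < length ys \<and> length (qs @ more) < k)"
       "tm \<sigma>' + 2 \<le> tm \<sigma> + 15 * j + 5" unfolding I_def by blast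
    show ?case by (rule assms(14)[of _ more j]) (use j in \<open>simp_all add: same_except_def P_def\<close>)
  qed
  have f: "ar \<sigma> 0 u n = (ys @ [n]) ! 0" using seg_first[OF assms(6)] .
  have z: "n - (ys @ [n]) ! 0 \<noteq> 0 \<longleftrightarrow> 0 < length ys" using le[of 0] by linarith
  show ?thesis unfolding scan_def
    using const_regsD[OF assms(1)] assms(4) f
    by simp (rule W[unfolded frame_step_def tail_def wp_seq One_nat_def, of "length ys"], unfold I_def, rule exI[of _ 0], rule exI[of _ "[]"],
      use assms z in \<open>simp add: same_except_def P_def\<close>)
qed

text \<open>\<open>h'\<close> counts completely scanned elements only. The last scan of a successful
  search may be cut short; it is left out of \<open>h'\<close>, so that the closure statement stays
  true, and is paid by the separate term \<open>20 * (k + 2)\<close>.\<close>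

lemma wp_search:
  assumes "const_regs \<sigma>" "rg \<sigma> 13 = v" "v \<le> n" "rg \<sigma> 8 = R" "R \<le> n" "adjacency_rep X (ar \<sigma> 0) (ar \<sigma> 1)"
    "rg \<sigma> 9 = length qs" "length qs \<le> k" "distinct qs" "set qs \<subseteq> {..<n} - X" "v \<notin> set qs" "prefix_conn qs" "qs \<noteq> []"
    "rg \<sigma> 10 = h" "h \<le> length qs" "\<And>i y. i < h \<Longrightarrow> adj (qs ! i) y \<Longrightarrow> y \<notin> X \<Longrightarrow> y \<in> insert v (set qs)"
    "\<And>i. i < length qs \<Longrightarrow> ar \<sigma> 3 R i = qs ! i" "ar \<sigma> 5 = marks (set qs)"
    "\<And>\<sigma>' more h'. same_except {9,10,18,20,21,22,23,24} \<sigma> \<sigma>' \<Longrightarrow> rg \<sigma>' 9 = length (qs @ more) \<Longrightarrow> length (qs @ more) \<le> k \<Longrightarrow>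
       distinct (qs @ more) \<Longrightarrow> set (qs @ more) \<subseteq> {..<n} - X \<Longrightarrow> v \<notin> set (qs @ more) \<Longrightarrow> prefix_conn (qs @ more) \<Longrightarrow>
       h \<le> h' \<Longrightarrow> h' \<le> length (qs @ more) \<Longrightarrow>
       (\<And>i y. i < h' \<Longrightarrow> adj ((qs @ more) ! i) y \<Longrightarrow> y \<notin> X \<Longrightarrow> y \<in> insert v (set (qs @ more))) \<Longrightarrow>
       (length (qs @ more) < k \<Longrightarrow> rg \<sigma>' 10 = h' \<and> h' = length (qs @ more)) \<Longrightarrow>
       (\<And>i. i < length (qs @ more) \<Longrightarrow> ar \<sigma>' 3 R i = (qs @ more) ! i) \<Longrightarrow> ar \<sigma>' 5 = marks (set (qs @ more)) \<Longrightarrow>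
       (\<And>r. r \<noteq> R \<Longrightarrow> ar \<sigma>' 3 r = ar \<sigma> 3 r) \<Longrightarrow> (\<And>a. a \<noteq> 3 \<Longrightarrow> a \<noteq> 5 \<Longrightarrow> ar \<sigma>' a = ar \<sigma> a) \<Longrightarrow>
       ou \<sigma>' = ou \<sigma> \<Longrightarrow>
       tm \<sigma>' \<le> tm \<sigma> + 20 * (\<Sum>i = h..<h'. live_deg X ((qs @ more) ! i) + 1) + (if length (qs @ more) < k then 0 else 20 * (k + 2)) + 6 \<Longrightarrow>
       Q \<sigma>'"
  shows "WP search Q \<sigma>"
proof -
  define P where "P \<sigma>' h' more \<longleftrightarrow> same_except {9,10,18,20,21,22,23,24} \<sigma> \<sigma>' \<and> rg \<sigma>' 9 = length (qs @ more) \<and>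
       length (qs @ more) \<le> k \<and> distinct (qs @ more) \<and> set (qs @ more) \<subseteq> {..<n} - X \<and> v \<notin> set (qs @ more) \<and>
       prefix_conn (qs @ more) \<and> h \<le> h' \<and> h' \<le> length (qs @ more) \<and>
       (\<forall>i y. i < h' \<longrightarrow> adj ((qs @ more) ! i) y \<longrightarrow> y \<notin> X \<longrightarrow> y \<in> insert v (set (qs @ more))) \<and>
       (length (qs @ more) < k \<longrightarrow> rg \<sigma>' 10 = h') \<and> rg \<sigma>' 10 \<le> k \<and>
       (\<forall>i < length (qs @ more). ar \<sigma>' 3 R i = (qs @ more) ! i) \<and> ar \<sigma>' 5 = marks (set (qs @ more)) \<and>
       (\<forall>r. r \<noteq> R \<longrightarrow> ar \<sigma>' 3 r = ar \<sigma> 3 r) \<and> (\<forall>a. a \<noteq> 3 \<longrightarrow> a \<noteq> 5 \<longrightarrow> ar \<sigma>' a = ar \<sigma> a) \<and>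
       ou \<sigma>' = ou \<sigma> \<and>
       tm \<sigma>' \<le> tm \<sigma> + 20 * (\<Sum>i = h..<h'. live_deg X ((qs @ more) ! i) + 1) + (if length (qs @ more) < k then 0 else 20 * (k + 2)) + 5"
     for \<sigma>' h' more
  \<comment> \<open>The variant follows register 10 and not \<open>h'\<close>: a scan cut short by
    the \<open>k\<close>-th vertex advances only the register.\<close>
  define I where "I i \<sigma>' \<longleftrightarrow> (\<exists>h' more. i = k - rg \<sigma>' 10 \<and> P \<sigma>' h' more \<and>
     (rg \<sigma>' 24 \<noteq> 0 \<longleftrightarrow> length (qs @ more) < k \<and> rg \<sigma>' 10 < length (qs @ more)))" for i \<sigma>'
  define tail where "tail = (Atom (AAdd 10 10 1) ;; Atom (ASub 24 4 9) ;; IfNZ 24 (Atom (ASub 24 9 10)) Skip)"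
  have W: "WP (WhileNZ 24 (Atom (AGet 20 3 8 10) ;; scan ;; tail)) Q \<sigma>'" if "I i \<sigma>'" for i \<sigma>'
  proof (rule wp_while[where I = I, OF that], goal_cases)
    case (1 i \<sigma>')
    then obtain h' more where j: "i = k - rg \<sigma>' 10" "P \<sigma>' h' more" "length (qs @ more) < k" "rg \<sigma>' 10 < length (qs @ more)"
      unfolding I_def by blast
    note P = j(2)[unfolded P_def]
    let ?qs = "qs @ more" let ?u = "?qs ! h'"
    have h': "rg \<sigma>' 10 = h'" "h' < length ?qs" using P j(3,4) by auto
    have const_regs': "const_regs \<sigma>'" using const_regs_same_except[OF assms(1)] P by auto
    have um: "?u \<in> set ?qs" using h'(2) by (rule nth_mem)
    then have u: "?u < n" "?u \<notin> X" using P by auto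
    obtain ys where ys: "distinct ys" "set ys = {w. adj ?u w \<and> w \<notin> X}" "seg (ar \<sigma> 0 ?u) (ar \<sigma> 1 ?u) n ys n"
      "set ys \<subseteq> {..<n}" "length ys = live_deg X ?u"
      using adjacency_repE[OF assms(6) u] .
    have r: "rg \<sigma>' 13 = v" "rg \<sigma>' 8 = R" using P assms(2,4) by (simp_all add: same_except_def)
    have t': "tm \<sigma>' \<le> tm \<sigma> + 20 * (\<Sum>i = h..<h'. live_deg X (?qs ! i) + 1) + 5" using P j(3) by simp
    have g: "ar \<sigma>' 3 R h' = ?u" using P h'(2) by blast
    have h'n: "h' \<le> n" using h'(2) j(3) k_le_n by linarith
    have "WP scan (WP tail (\<lambda>\<sigma>'. \<exists>i'<i. I i' \<sigma>')) (setr 20 ?u (tick \<sigma>'))"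
    proof (rule wp_scan[where v = v and R = R and u = ?u and ys = ys and qs = ?qs], goal_cases)
      case (14 \<sigma>1 more1 jj)
      note s = 14
      note append_assoc [simp del]
      let ?qs1 = "?qs @ more1"
      have st1: "const_regs \<sigma>1" using const_regs_same_except[OF _ s(1)] const_regs' by (auto simp: const_regs_def)
      have r1: "rg \<sigma>1 10 = h'" using s(1) h' by (simp add: same_except_def)
      have sm: "same_except {9,10,18,20,21,22,23,24} \<sigma> \<sigma>1" using s(1) P unfolding same_except_def by simp
      have sub: "set ?qs1 \<subseteq> {..<n} - X" "v \<notin> set ?qs1" using P s(5) ys(2) adj_less' by auto
      have pc: "prefix_conn (?qs @ xs)" if "set xs \<subseteq> set more1" for xs
        using that
      proof (induction xs rule: rev_induct)
        case Nil
        then show ?case using P by simp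
      next
        case (snoc x xs)
        then have "adj ?u x" "prefix_conn (?qs @ xs)" using s(5) ys(2) by auto
        then have "prefix_conn ((?qs @ xs) @ [x])" unfolding prefix_conn_snoc using um by (metis Un_iff set_append)
        then show ?case by (simp add: append_assoc)
      qed
      have qi: "?qs1 ! i = ?qs ! i" if "i < length ?qs" for i
        using that by (simp only: nth_append[of ?qs more1] if_True)
      have qi': "?qs1 ! i = ?qs ! i" if "i < Suc h'" for i using that qi h'(2) by auto
      have hle: "h \<le> h'" using P by blast
      have old: "y \<in> insert v (set ?qs1)" if "i < h'" "adj (?qs1 ! i) y" "y \<notin> X" for i y
      proof -
        have "y \<in> insert v (set ?qs)" using that P qi' by auto
        then show ?thesis by auto
      qed
      have new: "y \<in> insert v (set ?qs1)" if "length ?qs1 < k" "adj ?u y" "y \<notin> X" for y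
      proof -
        have "y \<in> set ys" using that ys(2) by simp
        then show ?thesis using s(6,8) that(1) by auto
      qed
      \<comment> \<open>The entries read are distinct and lie in a set of at most
        \<open>k + 1\<close> vertices, the queue and \<open>v\<close>.\<close>
      have jj: "jj \<le> k + 1"
      proof -
        have "jj = card (set (take jj ys))" using s(7) ys(1) distinct_card[of "take jj ys"] by simp
        also have "\<dots> \<le> card (insert v (set ?qs1))" using s(6) by (intro card_mono) auto
        also have "\<dots> \<le> Suc (card (set ?qs1))" by (rule card_insert_le_m1) auto
        also have "card (set ?qs1) \<le> k" using s(3) card_length le_trans by blast
        finally show ?thesis by simp
      qed
      have t1: "tm \<sigma>1 \<le> tm \<sigma> + 20 * (\<Sum>i = h..<h'. live_deg X (?qs1 ! i) + 1) + 15 * jj + 12"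
      proof -
        have "(\<Sum>i = h..<h'. live_deg X (?qs1 ! i) + 1) = (\<Sum>i = h..<h'. live_deg X (?qs ! i) + 1)"
          by (intro sum.cong refl) (subst qi', simp_all)
        then show ?thesis using t' s(14) by simp
      qed
      have common: "same_except {9,10,18,20,21,22,23,24} \<sigma> \<sigma>1" "rg \<sigma>1 9 = length ?qs1" "length ?qs1 \<le> k"
         "distinct ?qs1" "set ?qs1 \<subseteq> {..<n} - X" "v \<notin> set ?qs1" "prefix_conn ?qs1"
         "\<forall>i < length ?qs1. ar \<sigma>1 3 R i = ?qs1 ! i" "ar \<sigma>1 5 = marks (set ?qs1)"
         "\<forall>r. r \<noteq> R \<longrightarrow> ar \<sigma>1 3 r = ar \<sigma> 3 r" "\<forall>a. a \<noteq> 3 \<longrightarrow> a \<noteq> 5 \<longrightarrow> ar \<sigma>1 a = ar \<sigma> a" "ou \<sigma>1 = ou \<sigma>"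
        using sm s(2-4,9-13) sub pc[of more1] P by simp_all
      have h'B: "Suc h' < B" using h'n less_B by simp
      show ?case
      proof (cases "length ?qs1 < k")
        case True
        have jl: "jj = live_deg X ?u" using s(8) True ys(5) by simp
        have c: "\<forall>i y. i < Suc h' \<longrightarrow> adj (?qs1 ! i) y \<longrightarrow> y \<notin> X \<longrightarrow> y \<in> insert v (set ?qs1)"
          using old new[OF True] qi[OF h'(2)] by (metis less_Suc_eq)
        have t2: "tm \<sigma>1 + 7 \<le> tm \<sigma> + 20 * (\<Sum>i = h..<Suc h'. live_deg X (?qs1 ! i) + 1) + 5"
          using t1 hle jl qi[OF h'(2)] by simp
        define \<sigma>2 where "\<sigma>2 = setr 24 (length ?qs1 - Suc h') (tick (setr 24 (k - length ?qs1) (setr 10 (Suc h') \<sigma>1)))"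
        have "P \<sigma>2 (Suc h') (more @ more1)"
          unfolding P_def append_assoc[symmetric] \<sigma>2_def
          using common c t2 True hle h'(2) by (simp add: same_except_def del: append_assoc)
        moreover have "rg \<sigma>2 10 = Suc h'" "rg \<sigma>2 24 = length ?qs1 - Suc h'" unfolding \<sigma>2_def by simp_all
        ultimately have "I (k - Suc h') \<sigma>2" unfolding I_def using True
          by (intro exI[of _ "Suc h'"] exI[of _ "more @ more1"]) (simp, linarith)
        moreover have "k - Suc h' < i" using j(1) h' j(3) by simp
        ultimately have "\<exists>i'<i. I i' \<sigma>2" by blast
        then show ?thesis unfolding tail_def \<sigma>2_def
          using const_regsD[OF st1] r1 common(2) h'B True by simp
      next
        case False
        then have lk: "length ?qs1 = k" using s(3) by simp
        define \<sigma>2 where "\<sigma>2 = tick (setr 24 0 (setr 10 (Suc h') \<sigma>1))"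
        have c: "\<forall>i y. i < h' \<longrightarrow> adj (?qs1 ! i) y \<longrightarrow> y \<notin> X \<longrightarrow> y \<in> insert v (set ?qs1)"
          using old by blast
        have t2: "tm \<sigma>1 + 7 \<le> tm \<sigma> + 20 * (\<Sum>i = h..<h'. live_deg X (?qs1 ! i) + 1) + 20 * (k + 2) + 5"
        proof -
          have "15 * jj + 19 \<le> 20 * (k + 2) + 5" using jj by simp
          moreover have "x + 7 \<le> y + c" if "x \<le> y + d + 12" "d + 19 \<le> c" for x y c d :: nat
            using that by linarith
          ultimately show ?thesis using t1 by (metis (no_types, lifting) add.assoc)
        qed
        have "P \<sigma>2 h' (more @ more1)"
          unfolding P_def append_assoc[symmetric] \<sigma>2_def
          using common c t2 lk hle h'(2) j(3) by (simp add: same_except_def del: append_assoc)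
        moreover have "rg \<sigma>2 10 = Suc h'" "rg \<sigma>2 24 = 0" unfolding \<sigma>2_def by simp_all
        ultimately have "I (k - Suc h') \<sigma>2" unfolding I_def using lk
          by (intro exI[of _ "h'"] exI[of _ "more @ more1"]) simp
        moreover have "k - Suc h' < i" using j(1) h' j(3) by simp
        ultimately have "\<exists>i'<i. I i' \<sigma>2" by blast
        then show ?thesis unfolding tail_def \<sigma>2_def
          using const_regsD[OF st1] r1 common(2) h'B lk by simp
      qed
    qed (use const_regs' r assms(3) ys P j(3) in \<open>simp_all add: const_regs_def\<close>)
    then show ?case using r h' h'n g by simp
  next
    case (2 i \<sigma>')
    then obtain h' more where j: "P \<sigma>' h' more" "\<not> (length (qs @ more) < k \<and> rg \<sigma>' 10 < length (qs @ more))"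
      unfolding I_def by blast
    note P = j(1)[unfolded P_def]
    show ?case by (rule assms(19)[of _ more h']) (use P j(2) in \<open>auto simp: same_except_def\<close>)
  qed
  note W' = W[unfolded tail_def wp_seq One_nat_def]
  show ?thesis
  proof (cases "length qs < k")
    case True
    have "I (k - h) (setr 24 (length qs - h) (tick (setr 24 (k - length qs) \<sigma>)))"
      unfolding I_def P_def
      using assms True by (intro exI[of _ h] exI[of _ "[]"]) (auto simp: same_except_def)
    from W'[OF this] show ?thesis unfolding search_def using const_regsD[OF assms(1)] assms(7,14) True by simp
  next
    \<comment> \<open>The queue has \<open>k\<close> vertices already and avoids \<open>v\<close>,
      so the search succeeds without a scan.\<close>
    case False
    then have "I (k - h) (tick (setr 24 0 \<sigma>))"
      unfolding I_def P_def
      using assms by (intro exI[of _ h] exI[of _ "[]"]) (auto simp: same_except_def)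
    from W'[OF this] show ?thesis unfolding search_def using const_regsD[OF assms(1)] assms(7,8,14) False by simp
  qed
qed

end

section \<open>Output of the base case\<close>

definition edges_within :: "(nat \<Rightarrow> nat \<Rightarrow> bool) \<Rightarrow> nat set \<Rightarrow> nat set set" where
  "edges_within adj T = {{u, v} | u v. adj u v \<and> u \<in> T \<and> v \<in> T}"

text \<open>\<open>lists_exactly_once\<close> with vertex sets in place of subgraphs. In this form
  the outputs of the two children of a node are simply concatenated, because their solutions are
  disjoint.\<close>

definition listing :: "(nat \<Rightarrow> nat \<Rightarrow> bool) \<Rightarrow> nat list \<Rightarrow> nat set set \<Rightarrow> bool" where
  "listing adj ys SS \<longleftrightarrow> (\<exists>Ts ess. distinct Ts \<and> set Ts = SS \<and>
     list_all2 (\<lambda>T es. lists_edges es (edges_within adj T)) Ts ess \<and> ys = concat (map encode_edges ess))"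

lemma listing_empty [simp]: "listing adj [] {}"
  unfolding listing_def by (intro exI[of _ "[]"]) simp

lemma listing_append:
  assumes "listing adj xs A" "listing adj ys C" "A \<inter> C = {}"
  shows "listing adj (xs @ ys) (A \<union> C)"
proof -
  obtain Ts ess where 1: "distinct Ts" "set Ts = A" "list_all2 (\<lambda>T es. lists_edges es (edges_within adj T)) Ts ess"
    "xs = concat (map encode_edges ess)" using assms(1) by (auto simp: listing_def)
  obtain Ts' ess' where 2: "distinct Ts'" "set Ts' = C" "list_all2 (\<lambda>T es. lists_edges es (edges_within adj T)) Ts' ess'"
    "ys = concat (map encode_edges ess')" using assms(2) by (auto simp: listing_def)
  show ?thesis unfolding listing_def
    by (intro exI[of _ "Ts @ Ts'"] exI[of _ "ess @ ess'"]) (use 1 2 assms(3) in \<open>auto intro: list_all2_appendI\<close>)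
qed

text \<open>The length prefix precedes the edges, so the number of neighbours in S must be known for
  each candidate before anything is printed. One pass over the lists of S counts them all in array
  6; a count of zero reveals a new candidate. Edges inside S are recorded from their smaller
  endpoint.\<close>

definition emit_step :: com where
  "emit_step = Atom (AGet 23 5 21 0) ;;
     IfNZ 23 (Atom (ASub 23 21 20) ;;
       IfNZ 23 (Atom (APut 8 26 0 20) ;; Atom (APut 9 26 0 21) ;; Atom (AAdd 26 26 1)) Skip)
     (Atom (AGet 23 6 21 0) ;;
       IfNZ 23 Skip (Atom (APut 7 27 0 21) ;; Atom (AAdd 27 27 1)) ;;
       Atom (AGet 23 6 21 0) ;; Atom (AAdd 23 23 1) ;; Atom (APut 6 21 0 23))"

text \<open>The neighbours of the candidate in S are found by \<open>k - 1\<close> lookups in the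
  matrix, since its adjacency list may be far longer than the solution has edges. The last store
  clears its counter for the next base case.\<close>

definition emit_one :: com where
  "emit_one = Atom (AGet 20 7 19 0) ;; Atom (AGet 24 6 20 0) ;; Atom (AAdd 24 26 24) ;; Atom (AOut 24) ;;
     For 22 23 26 (Atom (AGet 24 8 23 0) ;; Atom (AOut 24) ;; Atom (AGet 24 9 23 0) ;; Atom (AOut 24)) ;;
     For 22 23 6 (Atom (AGet 21 4 23 0) ;; Atom (AGet 24 2 21 20) ;; IfNZ 24 (Atom (AOut 21) ;; Atom (AOut 20)) Skip) ;;
     Atom (APut 6 20 0 0)"

definition emit :: com where
  "emit = For 18 19 6 (Atom (AGet 21 4 19 0) ;; Atom (APut 5 21 0 1)) ;;
     Atom (AConst 26 0) ;; Atom (AConst 27 0) ;;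
     For 18 19 6 (Atom (AGet 20 4 19 0) ;; ForList 21 22 20 emit_step) ;;
     For 18 19 27 emit_one ;;
     For 18 19 6 (Atom (AGet 21 4 19 0) ;; Atom (APut 5 21 0 0))"

context alg
begin

lemma lists_edges_insert:
  assumes "distinct ss" "w \<notin> set ss" "distinct es" "set es = {(u, x). u \<in> set ss \<and> x \<in> set ss \<and> adj u x \<and> u < x}"
  shows "lists_edges (es @ map (\<lambda>u. (u, w)) (filter (\<lambda>u. adj u w) ss)) (edges_within adj (insert w (set ss)))"
proof -
  let ?f = "\<lambda>(u, v). {u, v} :: nat set"
  have i1: "inj_on ?f (set es)" unfolding assms(4) by (auto simp: inj_on_def doubleton_eq_iff)
  have m2: "map ?f (map (\<lambda>u. (u, w)) (filter (\<lambda>u. adj u w) ss)) = map (\<lambda>u. {u, w}) (filter (\<lambda>u. adj u w) ss)"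
    by simp
  have i2: "inj_on (\<lambda>u. {u, w}) (set ss)" by (auto simp: inj_on_def doubleton_eq_iff)
  have d: "distinct (map ?f es)" "distinct (map (\<lambda>u. {u, w}) (filter (\<lambda>u. adj u w) ss))"
    using i1 assms(3) assms(1) inj_on_subset[OF i2] by (auto simp: distinct_map)
  have s1: "?f ` set es = edges_within adj (set ss)"
  proof (intro equalityI subsetI)
    fix e assume "e \<in> ?f ` set es"
    then show "e \<in> edges_within adj (set ss)" unfolding assms(4) edges_within_def by auto
  next
    fix e assume "e \<in> edges_within adj (set ss)"
    then obtain u v where e: "e = {u, v}" "adj u v" "u \<in> set ss" "v \<in> set ss" unfolding edges_within_def by blast
    have "u \<noteq> v" using e(2) adj_irrefl by auto
    then consider "u < v" | "v < u" by linarith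
    then show "e \<in> ?f ` set es"
    proof cases
      case 1
      then show ?thesis using e assms(4) by (intro image_eqI[of _ _ "(u, v)"]) auto
    next
      case 2
      then show ?thesis using e assms(4) adj_sym[OF e(2)] insert_commute[of u v "{}"] by (intro image_eqI[of _ _ "(v, u)"]) auto
    qed
  qed
  have s2: "edges_within adj (insert w (set ss)) = edges_within adj (set ss) \<union> (\<lambda>u. {u, w}) ` {u \<in> set ss. adj u w}" 
  proof (intro equalityI subsetI)
    fix e assume "e \<in> edges_within adj (insert w (set ss))"
    then obtain u v where e: "e = {u, v}" "adj u v" "u \<in> insert w (set ss)" "v \<in> insert w (set ss)" unfolding edges_within_def by blast
    consider "u \<in> set ss" "v \<in> set ss" | "u = w" "v = w" | "u = w" "v \<in> set ss" | "v = w" "u \<in> set ss" using e by blast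
    then show "e \<in> edges_within adj (set ss) \<union> (\<lambda>u. {u, w}) ` {u \<in> set ss. adj u w}"
    proof cases
      case 1 then show ?thesis using e unfolding edges_within_def by blast
    next
      case 2 then show ?thesis using e adj_irrefl by blast
    next
      case 3 then show ?thesis using e adj_sym[OF e(2)] by (auto simp: doubleton_eq_iff)
    next
      case 4 then show ?thesis using e by auto
    qed
  qed (auto simp: edges_within_def dest: adj_sym)
  have dj: "edges_within adj (set ss) \<inter> (\<lambda>u. {u, w}) ` {u \<in> set ss. adj u w} = {}"
    using assms(2) by (auto simp: edges_within_def doubleton_eq_iff)
  show ?thesis
    unfolding lists_edges_def map_append m2 set_append distinct_append
    using d dj s1 s2 by (simp add: image_image)
qed

text \<open>PS is the set of pairs (u, x) scanned so far, es the edges found inside S, cs the candidates w.\<close>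

definition scan_inv :: "nat set \<Rightarrow> hstate \<Rightarrow> (nat \<times> nat) set \<Rightarrow> (nat \<times> nat) list \<Rightarrow> nat list \<Rightarrow> hstate \<Rightarrow> bool" where
  "scan_inv S \<sigma>0 PS es cs \<sigma> \<longleftrightarrow> same_except {18,19,20,21,22,23,26,27} \<sigma>0 \<sigma> \<and>
     rg \<sigma> 26 = length es \<and> distinct es \<and> set es = {(u, x). (u, x) \<in> PS \<and> x \<in> S \<and> u < x} \<and>
     (\<forall>i < length es. ar \<sigma> 8 i 0 = fst (es ! i) \<and> ar \<sigma> 9 i 0 = snd (es ! i)) \<and>
     rg \<sigma> 27 = length cs \<and> distinct cs \<and> set cs = {x. x \<notin> S \<and> (\<exists>u. (u, x) \<in> PS)} \<and>
     (\<forall>i < length cs. ar \<sigma> 7 i 0 = cs ! i) \<and>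
     ar \<sigma> 6 = (\<lambda>x j. if j = 0 \<and> x \<notin> S then card {u. (u, x) \<in> PS} else 0) \<and>
     (\<forall>a. a \<notin> {6,7,8,9} \<longrightarrow> ar \<sigma> a = ar \<sigma>0 a) \<and> ou \<sigma> = ou \<sigma>0"

lemma wp_emit_step:
  assumes scan_inv: "scan_inv S \<sigma>0 PS es cs \<sigma>" and s0: "const_regs \<sigma>0" "ar \<sigma>0 5 = marks S"
    and PS: "PS \<subseteq> {..<n} \<times> {..<n}" "(u, x) \<notin> PS" "u < n" "x < n" "rg \<sigma> 20 = u" "rg \<sigma> 21 = x"
    and Q: "\<And>\<sigma>' es' cs'. scan_inv S \<sigma>0 (insert (u, x) PS) es' cs' \<sigma>' \<Longrightarrow> same_except {23,26,27} \<sigma> \<sigma>' \<Longrightarrow> tm \<sigma>' \<le> tm \<sigma> + 10 \<Longrightarrow> Q \<sigma>'"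
  shows "WP emit_step Q \<sigma>"
proof -
  note scan_inv' = scan_inv[unfolded scan_inv_def]
  have const_regs: "const_regs \<sigma>" using const_regs_same_except[OF s0(1)] scan_inv' by auto
  have fP: "finite PS" using PS(1) finite_subset by blast
  have fu: "finite {u. (u, x) \<in> PS}" by (rule finite_subset[of _ "{..<n}"]) (use PS(1) in auto)
  have cu: "card {u. (u, x) \<in> PS} \<le> n"
    using card_mono[of "{..<n}" "{u. (u, x) \<in> PS}"] PS(1) by auto
  have le: "length es \<le> n * n"
  proof -
    have "length es = card (set es)" using scan_inv' distinct_card by metis
    also have "\<dots> \<le> card ({..<n} \<times> {..<n})" using scan_inv' PS(1) by (intro card_mono) auto
    finally show ?thesis by simp
  qed
  have lc: "length cs \<le> n"
  proof -
    have "length cs = card (set cs)" using scan_inv' distinct_card by metis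
    also have "\<dots> \<le> card {..<n}" using scan_inv' PS(1) by (intro card_mono) auto
    finally show ?thesis by simp
  qed
  have bd: "Suc (length es) < B" "Suc (length cs) < B" "Suc (card {u. (u, x) \<in> PS}) < B"
    using le lc cu B_large by linarith+
  have m: "ar \<sigma> 5 = marks S" using scan_inv' s0(2) by simp
  have c6: "ar \<sigma> 6 x 0 = (if x \<in> S then 0 else card {u. (u, x) \<in> PS})" using scan_inv' by simp
  have cnt: "card {u'. (u', y) \<in> insert (u, x) PS} = (if y = x then Suc (card {u. (u, x) \<in> PS}) else card {u. (u, y) \<in> PS})" for y
  proof (cases "y = x")
    case True
    have "{u'. (u', x) \<in> insert (u, x) PS} = insert u {u. (u, x) \<in> PS}" by auto
    then show ?thesis using True fu PS(2) by simp
  qed simp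
  show ?thesis
  proof (cases "x \<in> S")
    case True
    show ?thesis
    proof (cases "u < x")
      case lt: True
      have "WP emit_step (\<lambda>\<sigma>'. scan_inv S \<sigma>0 (insert (u, x) PS) (es @ [(u, x)]) cs \<sigma>' \<and> same_except {23,26,27} \<sigma> \<sigma>' \<and> tm \<sigma>' \<le> tm \<sigma> + 10) \<sigma>"
        unfolding emit_step_def scan_inv_def
        using True lt scan_inv' m const_regsD[OF const_regs] PS bd cnt
        by (auto simp: same_except_def marks_def nth_append update2_def less_Suc_eq fun_eq_iff)
      then show ?thesis by (rule wp_mono) (use Q in blast)
    next
      case ge: False
      have "WP emit_step (\<lambda>\<sigma>'. scan_inv S \<sigma>0 (insert (u, x) PS) es cs \<sigma>' \<and> same_except {23,26,27} \<sigma> \<sigma>' \<and> tm \<sigma>' \<le> tm \<sigma> + 10) \<sigma>"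
        unfolding emit_step_def scan_inv_def
        using True ge scan_inv' m const_regsD[OF const_regs] PS bd cnt
        by (auto simp: same_except_def marks_def fun_eq_iff)
      then show ?thesis by (rule wp_mono) (use Q in blast)
    qed
  next
    case False
    show ?thesis
    proof (cases "{u. (u, x) \<in> PS} = {}")
      case True
      then have z: "card {u. (u, x) \<in> PS} = 0" by simp
      have "WP emit_step (\<lambda>\<sigma>'. scan_inv S \<sigma>0 (insert (u, x) PS) es (cs @ [x]) \<sigma>' \<and> same_except {23,26,27} \<sigma> \<sigma>' \<and> tm \<sigma>' \<le> tm \<sigma> + 10) \<sigma>"
        unfolding emit_step_def scan_inv_def
        using False True z c6 scan_inv' m const_regsD[OF const_regs] PS bd cnt
        by (auto simp: same_except_def marks_def nth_append update2_def less_Suc_eq fun_eq_iff)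
      then show ?thesis by (rule wp_mono) (use Q in blast)
    next
      case ne: False
      then have z: "card {u. (u, x) \<in> PS} \<noteq> 0" using fu by simp
      have "WP emit_step (\<lambda>\<sigma>'. scan_inv S \<sigma>0 (insert (u, x) PS) es cs \<sigma>' \<and> same_except {23,26,27} \<sigma> \<sigma>' \<and> tm \<sigma>' \<le> tm \<sigma> + 10) \<sigma>"
        unfolding emit_step_def scan_inv_def
        using False ne z c6 scan_inv' m const_regsD[OF const_regs] PS bd cnt
        by (auto simp: same_except_def marks_def update2_def fun_eq_iff)
      then show ?thesis by (rule wp_mono) (use Q in blast)
    qed
  qed
qed

lemma wp_emit_scan:
  assumes "const_regs \<sigma>" "rg \<sigma> 6 = length ss" "distinct ss" "set ss \<subseteq> {..<n} - X" "adjacency_rep X (ar \<sigma> 0) (ar \<sigma> 1)"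
    "\<And>i. i < length ss \<Longrightarrow> ar \<sigma> 4 i 0 = ss ! i" "ar \<sigma> 5 = marks (set ss)" "ar \<sigma> 6 = (\<lambda>_ _. 0)"
    "rg \<sigma> 26 = 0" "rg \<sigma> 27 = 0" "length ss \<le> n"
    "\<And>\<sigma>' es cs. scan_inv (set ss) \<sigma> {(u, x). u \<in> set ss \<and> adj u x \<and> x \<notin> X} es cs \<sigma>' \<Longrightarrow>
       tm \<sigma>' \<le> tm \<sigma> + 13 * (\<Sum>u \<in> set ss. live_deg X u) + 10 * length ss + 3 \<Longrightarrow> Q \<sigma>'"
  shows "WP (For 18 19 6 (Atom (AGet 20 4 19 0) ;; ForList 21 22 20 emit_step)) Q \<sigma>"
proof -
  define PS where "PS i = {(u, x). u \<in> set (take i ss) \<and> adj u x \<and> x \<notin> X}" for i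
  have PSn: "PS i \<subseteq> {..<n} \<times> {..<n}" for i unfolding PS_def by (auto dest: adj_less adj_less')
  show ?thesis
  proof (rule wp_For[where m = "length ss" and I = "\<lambda>i \<sigma>'. \<exists>es cs. scan_inv (set ss) \<sigma> (PS i) es cs \<sigma>' \<and>
       tm \<sigma>' \<le> tm \<sigma> + 13 * (\<Sum>u \<in> set (take i ss). live_deg X u) + 10 * i + 2"], goal_cases)
    case (9)
    show ?case
      by (intro exI[of _ "[]"]) (use assms in \<open>simp add: scan_inv_def PS_def same_except_def fun_eq_iff\<close>)
  next
    case (10 i \<sigma>')
    obtain es cs where scan_inv: "scan_inv (set ss) \<sigma> (PS i) es cs \<sigma>'"
      and t: "tm \<sigma>' \<le> tm \<sigma> + 13 * (\<Sum>u \<in> set (take i ss). live_deg X u) + 10 * i + 2" using 10(1) by blast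
    note i = 10(2-)
    note scan_inv' = scan_inv[unfolded scan_inv_def]
    let ?u = "ss ! i"
    have const_regs': "const_regs \<sigma>'" using const_regs_same_except[OF assms(1)] scan_inv' by auto
    have um: "?u \<in> set ss" using i(1) by simp
    then have u: "?u < n" "?u \<notin> X" using assms(4) by auto
    have unot: "?u \<notin> set (take i ss)" using assms(3) i(1) by (auto simp: in_set_conv_nth nth_eq_iff_index_eq)
    obtain ys where ys: "distinct ys" "set ys = {w. adj ?u w \<and> w \<notin> X}" "seg (ar \<sigma> 0 ?u) (ar \<sigma> 1 ?u) n ys n"
      "set ys \<subseteq> {..<n}" "length ys = live_deg X ?u"
      using adjacency_repE[OF assms(5) u] .
    have tk: "set (take (Suc i) ss) = insert ?u (set (take i ss))" using i(1) by (simp add: take_Suc_conv_app_nth)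
    have PSS: "PS (Suc i) = PS i \<union> {?u} \<times> set ys" unfolding PS_def tk ys(2) by auto
    have sm: "(\<Sum>u \<in> set (take (Suc i) ss). live_deg X u) = live_deg X ?u + (\<Sum>u \<in> set (take i ss). live_deg X u)"
      unfolding tk using unot by simp
    have Gs: "scan_inv (set ss) \<sigma> P es cs (setr r y \<sigma>1) \<longleftrightarrow> scan_inv (set ss) \<sigma> P es cs \<sigma>1" if "r \<in> {18,19,20,21,22,23}" for P es cs r y \<sigma>1
      using that unfolding scan_inv_def same_except_def by auto
    have Gt: "scan_inv (set ss) \<sigma> P es cs (tick \<sigma>1) \<longleftrightarrow> scan_inv (set ss) \<sigma> P es cs \<sigma>1" for P es cs \<sigma>1
      unfolding scan_inv_def same_except_def by auto
    have "WP (ForList 21 22 20 emit_step) (\<lambda>\<sigma>''. rg \<sigma>'' 19 = i \<and> rg \<sigma>'' 6 = length ss \<and> rg \<sigma>'' 1 = 1 \<and>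
        (\<exists>es cs. scan_inv (set ss) \<sigma> (PS (Suc i)) es cs (setr 18 (length ss - Suc i) (setr 19 (Suc i) \<sigma>'')) \<and>
          tm (setr 18 (length ss - Suc i) (setr 19 (Suc i) \<sigma>''))
            \<le> tm \<sigma> + 13 * (\<Sum>u \<in> set (take (Suc i) ss). live_deg X u) + 10 * Suc i + 2))
        (setr 20 ?u (tick \<sigma>'))"
    proof (rule wp_ForList[where w = ?u and ys = ys and f = "ar \<sigma> 0 ?u" and g = "ar \<sigma> 1 ?u" and
         I = "\<lambda>j \<sigma>''. rg \<sigma>'' 20 = ?u \<and> rg \<sigma>'' 19 = i \<and> (\<exists>es cs. scan_inv (set ss) \<sigma> (PS i \<union> {?u} \<times> set (take j ys)) es cs \<sigma>'') \<and>
           tm \<sigma>'' \<le> tm \<sigma>' + 13 * j + 4"], goal_cases)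
      case (12 j \<sigma>1)
      then obtain es1 cs1 where G1: "scan_inv (set ss) \<sigma> (PS i \<union> {?u} \<times> set (take j ys)) es1 cs1 \<sigma>1" by blast
      note j = 12
      let ?x = "ys ! j"
      have xm: "?x \<in> set ys" using j(2) by simp
      have xnot: "?x \<notin> set (take j ys)" using ys(1) j(2) by (auto simp: in_set_conv_nth nth_eq_iff_index_eq)
      have nP: "(?u, ?x) \<notin> PS i \<union> {?u} \<times> set (take j ys)" using unot xnot by (auto simp: PS_def)
      have sb: "PS i \<union> {?u} \<times> set (take j ys) \<subseteq> {..<n} \<times> {..<n}"
        using PSn[of i] ys(4) u(1) set_take_subset[of j ys] by auto
      have ins: "insert (?u, ?x) (PS i \<union> {?u} \<times> set (take j ys)) = PS i \<union> {?u} \<times> set (take (Suc j) ys)"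
        using j(2) by (auto simp: take_Suc_conv_app_nth)
      show ?case
      proof (rule wp_emit_step[where S = "set ss" and ?\<sigma>0.0 = \<sigma> and PS = "PS i \<union> {?u} \<times> set (take j ys)" and u = ?u and x = ?x and es = es1 and cs = cs1], goal_cases)
        case (10 \<sigma>2 es2 cs2)
        note G2 = 10(1)[unfolded ins]
        have "ar \<sigma>2 0 = ar \<sigma> 0" using G2 by (simp add: scan_inv_def)
        then show ?case using G2 10(2,3) j Gs[of 21] Gs[of 22] by (auto simp: same_except_def)
      next
        case 7
        show ?case using xm ys(4) by auto
      qed (use G1 Gt assms(1,7) nP sb u j in simp_all)
    next
      case (13 \<sigma>1)
      then obtain es1 cs1 where G1: "scan_inv (set ss) \<sigma> (PS (Suc i)) es1 cs1 \<sigma>1" unfolding PSS by auto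
      have "rg \<sigma>1 6 = length ss" "rg \<sigma>1 1 = 1" using G1 assms(2) const_regsD[OF assms(1)] by (auto simp: scan_inv_def same_except_def)
      moreover have "scan_inv (set ss) \<sigma> (PS (Suc i)) es1 cs1 (setr 18 (length ss - Suc i) (setr 19 (Suc i) (tick \<sigma>1)))"
        using G1 Gs[of 18] Gs[of 19] Gt by simp
      ultimately show ?case using 13 sm t ys(5) by (auto simp del: One_nat_def)
    next
      case 11
      have "scan_inv (set ss) \<sigma> (PS i) es cs (setr 22 (n - (ys @ [n]) ! 0) (setr 21 ((ys @ [n]) ! 0) (setr 20 ?u (tick \<sigma>'))))"
        using scan_inv Gs Gt by simp
      then show ?case using i by auto
    qed (use scan_inv' ys const_regsD[OF const_regs'] in auto)
    moreover have "ar \<sigma>' 4 i 0 = ?u" using scan_inv' assms(6)[OF i(1)] by simp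
    ultimately show ?case using i const_regsD[OF const_regs'] by simp
  next
    case (11 \<sigma>')
    then obtain es cs where "scan_inv (set ss) \<sigma> (PS (length ss)) es cs \<sigma>'"
        "tm \<sigma>' \<le> tm \<sigma> + 13 * (\<Sum>u \<in> set ss. live_deg X u) + 10 * length ss + 2" by auto
    then show ?case by (intro assms(12)[of es cs]) (auto simp: scan_inv_def same_except_def PS_def)
  qed (use assms(2,11) const_regsD[OF assms(1)] less_B in auto)
qed

lemma wp_emit_one:
  assumes "const_regs \<sigma>" "rg \<sigma> 6 = length ss" "distinct ss" "set ss \<subseteq> {..<n}" "length ss \<le> n"
    "\<And>i. i < length ss \<Longrightarrow> ar \<sigma> 4 i 0 = ss ! i" "\<And>u w. u < n \<Longrightarrow> w < n \<Longrightarrow> ar \<sigma> 2 u w = (if adj u w then 1 else 0)"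
    "rg \<sigma> 26 = length es" "length es \<le> n * n" "\<And>i. i < length es \<Longrightarrow> ar \<sigma> 8 i 0 = fst (es ! i) \<and> ar \<sigma> 9 i 0 = snd (es ! i)"
    "ar \<sigma> 7 (rg \<sigma> 19) 0 = w" "w < n" "ar \<sigma> 6 w 0 = card {u \<in> set ss. adj u w}"
    "\<And>\<sigma>'. same_except {20,21,22,23,24} \<sigma> \<sigma>' \<Longrightarrow> ar \<sigma>' = (ar \<sigma>)(6 := update2 (ar \<sigma> 6) w 0 0) \<Longrightarrow>
       ou \<sigma>' = ou \<sigma> @ encode_edges (es @ map (\<lambda>u. (u, w)) (filter (\<lambda>u. adj u w) ss)) \<Longrightarrow>
       tm \<sigma>' \<le> tm \<sigma> + 7 * length es + 8 * length ss + 11 \<Longrightarrow> Q \<sigma>'"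
  shows "WP emit_one Q \<sigma>"
proof -
  let ?c = "card {u \<in> set ss. adj u w}" and ?fl = "filter (\<lambda>u. adj u w) ss"
  have c: "?c = length ?fl"
    using assms(3) distinct_card[of ?fl] by simp
  have cn: "?c \<le> n" unfolding c using length_filter_le assms(5) le_trans by blast
  have bd: "length es + ?c < B" "length es < B" "length ss < B" using cn assms(5,9) B_large by linarith+
  define L1 where "L1 = (Atom (AGet 24 8 23 0) ;; Atom (AOut 24) ;; Atom (AGet 24 9 23 0) ;; Atom (AOut 24))"
  define L2 where "L2 = (Atom (AGet 21 4 23 0) ;; Atom (AGet 24 2 21 20) ;; IfNZ 24 (Atom (AOut 21) ;; Atom (AOut 20)) Skip)"
  define hd where "hd = ou \<sigma> @ [length es + ?c]"
  let ?p = "\<lambda>(u, v). [u, v] :: nat list"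
  have W1: "WP (For 22 23 26 L1) Q1 \<sigma>1" if a: "same_except {20,24} \<sigma> \<sigma>1" "ar \<sigma>1 = ar \<sigma>" "rg \<sigma>1 20 = w" "ou \<sigma>1 = hd"
    and q: "\<And>\<sigma>'. same_except {20,22,23,24} \<sigma> \<sigma>' \<Longrightarrow> ar \<sigma>' = ar \<sigma> \<Longrightarrow> rg \<sigma>' 20 = w \<Longrightarrow> ou \<sigma>' = hd @ concat (map ?p es) \<Longrightarrow>
      tm \<sigma>' \<le> tm \<sigma>1 + 7 * length es + 3 \<Longrightarrow> Q1 \<sigma>'" for Q1 \<sigma>1
    unfolding L1_def
  proof (rule wp_For[where m = "length es" and I = "\<lambda>j \<sigma>'. same_except {20,22,23,24} \<sigma> \<sigma>' \<and> ar \<sigma>' = ar \<sigma> \<and> rg \<sigma>' 20 = w \<and>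
      ou \<sigma>' = hd @ concat (map ?p (take j es)) \<and> tm \<sigma>' \<le> tm \<sigma>1 + 7 * j + 2"], goal_cases)
    case (10 j \<sigma>')
    have const_regs': "const_regs \<sigma>'" using const_regs_same_except[OF assms(1)] 10 by auto
    obtain x y where xy: "es ! j = (x, y)" by fastforce
    show ?case using 10 assms(10)[OF 10(2)] const_regsD[OF const_regs'] xy
      by (simp add: same_except_def take_Suc_conv_app_nth)
  next
    case (11 \<sigma>')
    then show ?case by (intro q) (simp_all add: same_except_def)
  next
    case 9
    then show ?case using a by (simp add: same_except_def)
  qed (use a assms(8) bd const_regsD[OF const_regs_same_except[OF assms(1) a(1)]] in \<open>simp_all add: same_except_def\<close>)
  let ?q = "\<lambda>u. [u, w]"
  have W2: "WP (For 22 23 6 L2) Q1 \<sigma>1" if a: "same_except {20,22,23,24} \<sigma> \<sigma>1" "ar \<sigma>1 = ar \<sigma>" "rg \<sigma>1 20 = w" "ou \<sigma>1 = h1"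
    and q: "\<And>\<sigma>'. same_except {20,21,22,23,24} \<sigma> \<sigma>' \<Longrightarrow> ar \<sigma>' = ar \<sigma> \<Longrightarrow> rg \<sigma>' 20 = w \<Longrightarrow> ou \<sigma>' = h1 @ concat (map ?q ?fl) \<Longrightarrow>
      tm \<sigma>' \<le> tm \<sigma>1 + 8 * length ss + 3 \<Longrightarrow> Q1 \<sigma>'" for Q1 \<sigma>1 h1
    unfolding L2_def
  proof (rule wp_For[where m = "length ss" and I = "\<lambda>j \<sigma>'. same_except {20,21,22,23,24} \<sigma> \<sigma>' \<and> ar \<sigma>' = ar \<sigma> \<and> rg \<sigma>' 20 = w \<and>
      ou \<sigma>' = h1 @ concat (map ?q (filter (\<lambda>u. adj u w) (take j ss))) \<and> tm \<sigma>' \<le> tm \<sigma>1 + 8 * j + 2"], goal_cases)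
    case (10 j \<sigma>')
    have const_regs': "const_regs \<sigma>'" using const_regs_same_except[OF assms(1)] 10 by auto
    have um: "ss ! j \<in> set ss" using 10 by simp
    then have un: "ss ! j < n" using assms(4) by blast
    show ?case using 10 assms(6)[OF 10(2)] const_regsD[OF const_regs'] assms(7)[OF un assms(12)] assms(12)
      by (simp add: same_except_def take_Suc_conv_app_nth)
  next
    case (11 \<sigma>')
    then show ?case by (intro q) (simp_all add: same_except_def)
  next
    case 9
    then show ?case using a by (simp add: same_except_def)
  qed (use a assms(2) bd const_regsD[OF const_regs_same_except[OF assms(1) a(1)]] in \<open>simp_all add: same_except_def\<close>)
  let ?\<sigma>1 = "putout (length es + ?c) (setr 24 (length es + ?c) (setr 24 ?c (setr 20 w \<sigma>)))"
  have enc: "encode_edges (es @ map (\<lambda>u. (u, w)) ?fl) = (length es + ?c) # concat (map ?p es) @ concat (map ?q ?fl)"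
    unfolding encode_edges_def c by (simp add: o_def)
  have "WP (For 22 23 26 L1) (WP (For 22 23 6 L2) (WP (Atom (APut 6 20 0 0)) Q)) ?\<sigma>1"
  proof (rule W1)
    fix \<sigma>2 assume 2: "same_except {20,22,23,24} \<sigma> \<sigma>2" "ar \<sigma>2 = ar \<sigma>" "rg \<sigma>2 20 = w" "ou \<sigma>2 = hd @ concat (map ?p es)"
      "tm \<sigma>2 \<le> tm ?\<sigma>1 + 7 * length es + 3"
    show "WP (For 22 23 6 L2) (WP (Atom (APut 6 20 0 0)) Q) \<sigma>2"
    proof (rule W2[OF 2(1-4)])
      fix \<sigma>3 assume 3: "same_except {20,21,22,23,24} \<sigma> \<sigma>3" "ar \<sigma>3 = ar \<sigma>" "rg \<sigma>3 20 = w"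
        "ou \<sigma>3 = (hd @ concat (map ?p es)) @ concat (map ?q ?fl)" "tm \<sigma>3 \<le> tm \<sigma>2 + 8 * length ss + 3"
      have st3: "const_regs \<sigma>3" using const_regs_same_except[OF assms(1) 3(1)] by auto
      have "Q (setm 6 w 0 0 \<sigma>3)"
        by (rule assms(14)) (use 2 3 enc in \<open>simp_all add: same_except_def hd_def\<close>)
      then show "WP (Atom (APut 6 20 0 0)) Q \<sigma>3" using const_regsD[OF st3] 3(3) by simp
    qed
  qed (simp_all add: same_except_def hd_def)
  then show ?thesis unfolding emit_one_def L1_def L2_def
    using const_regsD[OF assms(1)] assms(8,11,13) bd(1) by simp
qed

text \<open>Scanning the lists is paid by \<open>live_deg_base_sum\<close>; each solution pays for a
  copy of the edges inside S and for the lookups. \<open>T0\<close> guarantees that some solution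
  exists to pay the costs of order \<open>k\<close> that arise once.\<close>

lemma wp_emit:
  assumes "const_regs \<sigma>" "rg \<sigma> 6 = length ss" "distinct ss" "set ss \<subseteq> {..<n} - X" "length ss = k - 1" "conn (set ss)"
    "T0 \<in> completions (set ss) X" "adjacency_rep X (ar \<sigma> 0) (ar \<sigma> 1)"
    "\<And>i. i < length ss \<Longrightarrow> ar \<sigma> 4 i 0 = ss ! i" "ar \<sigma> 5 = marks {}" "ar \<sigma> 6 = (\<lambda>_ _. 0)"
    "\<And>u w. u < n \<Longrightarrow> w < n \<Longrightarrow> ar \<sigma> 2 u w = (if adj u w then 1 else 0)"
    "\<And>\<sigma>' ys. same_except {18,19,20,21,22,23,24,26,27} \<sigma> \<sigma>' \<Longrightarrow> (\<And>a. a \<notin> {7,8,9} \<Longrightarrow> ar \<sigma>' a = ar \<sigma> a) \<Longrightarrow>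
       ou \<sigma>' = ou \<sigma> @ ys \<Longrightarrow> listing adj ys (completions (set ss) X) \<Longrightarrow>
       tm \<sigma>' \<le> tm \<sigma> + 100 * (\<Sum>T \<in> completions (set ss) X. degsum T) \<Longrightarrow> Q \<sigma>'"
  shows "WP emit Q \<sigma>"
proof -
  let ?S = "set ss"
  have kn: "length ss \<le> n" using assms(5) k_le_n by simp
  have lB: "length ss < B" using kn less_B by simp
  have cardS: "card ?S = k - 1" using assms(3,5) by (simp add: distinct_card)
  define PS where "PS = {(u, x). u \<in> ?S \<and> adj u x \<and> x \<notin> X}"
  have W1: "WP (For 18 19 6 (Atom (AGet 21 4 19 0) ;; Atom (APut 5 21 0 1))) Q1 \<sigma>"
    if q: "\<And>\<sigma>'. same_except {18,19,21} \<sigma> \<sigma>' \<Longrightarrow> ar \<sigma>' = (ar \<sigma>)(5 := marks ?S) \<Longrightarrow> ou \<sigma>' = ou \<sigma> \<Longrightarrow>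
      tm \<sigma>' \<le> tm \<sigma> + 5 * length ss + 3 \<Longrightarrow> Q1 \<sigma>'" for Q1
  proof (rule wp_For[where m = "length ss" and I = "\<lambda>j \<sigma>'. same_except {18,19,21} \<sigma> \<sigma>' \<and>
      ar \<sigma>' = (ar \<sigma>)(5 := marks (set (take j ss))) \<and> ou \<sigma>' = ou \<sigma> \<and> tm \<sigma>' \<le> tm \<sigma> + 5 * j + 2"], goal_cases)
    case (10 j \<sigma>')
    have const_regs': "const_regs \<sigma>'" using const_regs_same_except[OF assms(1)] 10 by auto
    have d: "insert (ss ! j) (set (take j ss)) = set (take (Suc j) ss)"
      using 10(2) by (simp add: take_Suc_conv_app_nth)
    show ?case using 10 assms(9)[OF 10(2)] const_regsD[OF const_regs'] d by (simp add: same_except_def update2_marks)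
  next
    case (11 \<sigma>')
    then show ?case by (intro q) (simp_all add: same_except_def)
  qed (use assms const_regsD[OF assms(1)] lB in \<open>simp_all add: same_except_def fun_eq_iff\<close>)
  have W4: "WP (For 18 19 6 (Atom (AGet 21 4 19 0) ;; Atom (APut 5 21 0 0))) Q1 \<sigma>1"
    if a: "const_regs \<sigma>1" "rg \<sigma>1 6 = length ss" "ar \<sigma>1 4 = ar \<sigma> 4" "ar \<sigma>1 5 = marks ?S"
    and q: "\<And>\<sigma>'. same_except {18,19,21} \<sigma>1 \<sigma>' \<Longrightarrow> ar \<sigma>' = (ar \<sigma>1)(5 := marks {}) \<Longrightarrow> ou \<sigma>' = ou \<sigma>1 \<Longrightarrow>
      tm \<sigma>' \<le> tm \<sigma>1 + 5 * length ss + 3 \<Longrightarrow> Q1 \<sigma>'" for Q1 \<sigma>1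
  proof (rule wp_For[where m = "length ss" and I = "\<lambda>j \<sigma>'. same_except {18,19,21} \<sigma>1 \<sigma>' \<and>
      ar \<sigma>' = (ar \<sigma>1)(5 := marks (set (drop j ss))) \<and> ou \<sigma>' = ou \<sigma>1 \<and> tm \<sigma>' \<le> tm \<sigma>1 + 5 * j + 2"], goal_cases)
    case (10 j \<sigma>')
    have const_regs': "const_regs \<sigma>'" using const_regs_same_except[OF a(1)] 10 by auto
    have d: "set (drop j ss) - {ss ! j} = set (drop (Suc j) ss)"
      using assms(3) 10(2) by (metis Cons_nth_drop_Suc Diff_insert_absorb distinct.simps(2) distinct_drop list.simps(15))
    show ?case using 10 assms(9)[OF 10(2)] a(3) const_regsD[OF const_regs'] d by (simp add: same_except_def update2_marks)
  next
    case (11 \<sigma>')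
    then show ?case by (intro q) (simp_all add: same_except_def)
  next
    case 9
    have "(ar \<sigma>1)(5 := marks ?S) = ar \<sigma>1" using a(4) by (metis fun_upd_triv)
    then show ?case by (simp add: same_except_def)
  qed (use a const_regsD[OF a(1)] lB in \<open>simp_all add: same_except_def\<close>)
  have W3: "WP (For 18 19 27 emit_one) Q1 \<sigma>1"
    if G1: "scan_inv ?S \<sigma>0 PS es cs \<sigma>1" and s0: "same_except {18,19,21,26,27} \<sigma> \<sigma>0" "ar \<sigma>0 = (ar \<sigma>)(5 := marks ?S)" "ou \<sigma>0 = ou \<sigma>"
    and q: "\<And>\<sigma>' ys. same_except {18,19,20,21,22,23,24,26,27} \<sigma> \<sigma>' \<Longrightarrow> (\<And>a. a \<notin> {5,7,8,9} \<Longrightarrow> ar \<sigma>' a = ar \<sigma> a) \<Longrightarrow>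
      ar \<sigma>' 5 = marks ?S \<Longrightarrow> ou \<sigma>' = ou \<sigma> @ ys \<Longrightarrow> listing adj ys (completions ?S X) \<Longrightarrow>
      tm \<sigma>' \<le> tm \<sigma>1 + 22 * (\<Sum>T \<in> completions ?S X. degsum T) + 3 \<Longrightarrow> Q1 \<sigma>'" for Q1 \<sigma>1 \<sigma>0 es cs
  proof -
    note scan_inv' = G1[unfolded scan_inv_def]
    have sm1: "same_except {18,19,20,21,22,23,26,27} \<sigma> \<sigma>1" using scan_inv' s0(1) by (auto simp: same_except_def)
    have st1: "const_regs \<sigma>1" using const_regs_same_except[OF assms(1) sm1] by auto
    have cs: "set cs = frontier ?S X" "distinct cs" using scan_inv' by (auto simp: PS_def frontier_def)
    have es: "distinct es" "set es = {(u, x). u \<in> ?S \<and> x \<in> ?S \<and> adj u x \<and> u < x}"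
      using scan_inv' assms(4) by (auto simp: PS_def)
    have csn: "set cs \<subseteq> {..<n}" unfolding cs frontier_def using adj_less' by auto
    have lcs: "length cs \<le> n" using card_mono[OF _ csn] cs(2) by (simp add: distinct_card)
    have lecard: "length es = card (set es)" using es(1) by (simp add: distinct_card)
    have "card (set es) \<le> card (SIGMA u : ?S. {w \<in> ?S. adj u w})"
      unfolding es(2) by (intro card_mono) auto
    then have led: "length es \<le> degsum ?S" unfolding lecard degsum_def deg_in_def by simp
    have "card (set es) \<le> card ({..<n} \<times> {..<n})" using es(2) assms(4) by (intro card_mono) auto
    then have lesn: "length es \<le> n * n" unfolding lecard by simp
    define enc where "enc w = encode_edges (es @ map (\<lambda>u. (u, w)) (filter (\<lambda>u. adj u w) ss))" for w
    define D where "D = 7 * length es + 8 * length ss + 14"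
    \<comment> \<open>The counters that are still set after \<open>j\<close> printed candidates. At
      the end the array is zero again, without a pass over all vertices.\<close>
    define c6 where "c6 j = (\<lambda>x (jj::nat). if jj = 0 \<and> x \<in> set (drop j cs) then card {u \<in> ?S. adj u x} else 0)" for j :: nat
    have "ar \<sigma>1 6 x jj = c6 0 x jj" for x jj
    proof (cases "x \<in> frontier ?S X")
      case True
      then have "{u. (u, x) \<in> PS} = {u \<in> ?S. adj u x}" "x \<notin> ?S" by (auto simp: PS_def frontier_def)
      then show ?thesis using True cs(1) scan_inv' by (simp add: c6_def)
    next
      case False
      then have "{u. (u, x) \<in> PS} = {} \<or> x \<in> ?S" by (auto simp: PS_def frontier_def)
      then show ?thesis using False cs(1) scan_inv' by (auto simp: c6_def)
    qed
    then have c60: "ar \<sigma>1 6 = c6 0" by (simp add: fun_eq_iff)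
    have c6e: "c6 (length cs) = (\<lambda>_ _. 0)" by (simp add: c6_def fun_eq_iff)
    show ?thesis
    proof (rule wp_For[where m = "length cs" and I = "\<lambda>j \<sigma>'. same_except {18,19,20,21,22,23,24} \<sigma>1 \<sigma>' \<and>
        ar \<sigma>' = (ar \<sigma>1)(6 := c6 j) \<and> ou \<sigma>' = ou \<sigma> @ concat (map enc (take j cs)) \<and> tm \<sigma>' \<le> tm \<sigma>1 + D * j + 2"], goal_cases)
      case (10 j \<sigma>')
      have const_regs': "const_regs \<sigma>'" using const_regs_same_except[OF st1] 10 by auto
      let ?w = "cs ! j"
      have wm: "?w \<in> set cs" using 10(2) by simp
      then have wn: "?w < n" using csn by auto
      have dr: "drop j cs = ?w # drop (Suc j) cs" using 10(2) by (simp add: Cons_nth_drop_Suc)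
      have wn': "?w \<notin> set (drop (Suc j) cs)" using cs(2) dr by (metis distinct.simps(2) distinct_drop)
      have u6: "update2 (c6 j) ?w 0 0 = c6 (Suc j)" using wn' unfolding c6_def dr update2_def by (auto simp: fun_eq_iff)
      have c6w: "c6 j ?w 0 = card {u \<in> ?S. adj u ?w}" unfolding c6_def dr by simp
      show ?case
      proof (rule wp_emit_one[where ss = ss and es = es and w = ?w], goal_cases)
        case (14 \<sigma>2)
        have t: "D * Suc j = D * j + D" by simp
        show ?case using 10 14 u6 t
          by (simp add: same_except_def take_Suc_conv_app_nth enc_def[symmetric] D_def)
      qed (use 10 const_regs' assms kn scan_inv' s0 sm1 lesn wn c6w in \<open>auto simp: same_except_def const_regs_def\<close>)
    next
      case (11 \<sigma>')
      let ?Ts = "map (\<lambda>w. insert w ?S) cs"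
      have sol: "set ?Ts = completions ?S X" using completions_base[OF cardS assms(6,4)] cs(1) by simp
      have dT: "distinct ?Ts" using cs inj_frontier by (auto simp: distinct_map)
      have li: "listing adj (concat (map enc cs)) (completions ?S X)"
        unfolding listing_def
      proof (intro exI conjI)
        show "distinct ?Ts" "set ?Ts = completions ?S X" by fact+
        show "list_all2 (\<lambda>T es. lists_edges es (edges_within adj T)) ?Ts
           (map (\<lambda>w. es @ map (\<lambda>u. (u, w)) (filter (\<lambda>u. adj u w) ss)) cs)"
          unfolding list_all2_conv_all_nth
        proof (intro conjI allI impI)
          fix i assume i: "i < length ?Ts"
          then have "cs ! i \<in> frontier ?S X" using cs(1) nth_mem[of i cs] by auto
          then have "cs ! i \<notin> ?S" by (simp add: frontier_def)
          from lists_edges_insert[OF assms(3) this es]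
          show "lists_edges (map (\<lambda>w. es @ map (\<lambda>u. (u, w)) (filter (\<lambda>u. adj u w) ss)) cs ! i) (edges_within adj (?Ts ! i))"
            using i by simp
        qed simp
        show "concat (map enc cs) = concat (map encode_edges (map (\<lambda>w. es @ map (\<lambda>u. (u, w)) (filter (\<lambda>u. adj u w) ss)) cs))"
          unfolding enc_def by (simp add: o_def)
      qed
      have "D * length cs = (\<Sum>w \<in> frontier ?S X. D)" using cs distinct_card by fastforce
      also have "\<dots> = (\<Sum>T \<in> completions ?S X. D)"
        unfolding completions_base[OF cardS assms(6,4)] by (simp add: card_image[OF inj_frontier])
      also have "\<dots> \<le> (\<Sum>T \<in> completions ?S X. 22 * degsum T)"
      proof (rule sum_mono)
        fix T assume T: "T \<in> completions ?S X"
        have "k \<le> degsum T" using degsum_completion[OF T] .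
        moreover have "degsum ?S \<le> degsum T" using completionsD[OF T] by (intro degsum_mono) auto
        ultimately show "D \<le> 22 * degsum T" unfolding D_def using led assms(5) k_ge_2 by linarith
      qed
      finally have Dle: "D * length cs \<le> 22 * (\<Sum>T \<in> completions ?S X. degsum T)" by (simp add: sum_distrib_left)
      show ?case
      proof (rule q)
        show "same_except {18,19,20,21,22,23,24,26,27} \<sigma> (tick \<sigma>')" using 11 sm1 by (auto simp: same_except_def)
        show "ar (tick \<sigma>') a = ar \<sigma> a" if "a \<notin> {5,7,8,9}" for a
          using that 11 scan_inv' s0(2) c6e assms(11) by auto
        show "ar (tick \<sigma>') 5 = marks ?S" using 11 scan_inv' s0(2) by simp
        show "ou (tick \<sigma>') = ou \<sigma> @ concat (map enc cs)" using 11 by simp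
        show "listing adj (concat (map enc cs)) (completions ?S X)" by fact
        show "tm (tick \<sigma>') \<le> tm \<sigma>1 + 22 * (\<Sum>T \<in> completions ?S X. degsum T) + 3" using 11 Dle by simp
      qed
    next
      case 9
      have "(ar \<sigma>1)(6 := c6 0) = ar \<sigma>1" using c60 by (metis fun_upd_triv)
      moreover have "ou \<sigma>1 = ou \<sigma>" using scan_inv' s0(3) by simp
      ultimately show ?case by (simp add: same_except_def)
    qed (use scan_inv' lcs less_B const_regsD[OF st1] in simp_all)
  qed
  let ?Sg = "\<Sum>T \<in> completions ?S X. degsum T"
  have kSg: "k \<le> ?Sg" using degsum_completion[OF assms(7)] degsum_le_sum_completions[OF assms(7)] by linarith
  have dSg: "(\<Sum>u \<in> ?S. live_deg X u) \<le> 2 * ?Sg" by (rule live_deg_base_sum[OF cardS assms(6,4,7)])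
  have ssx: "length ss \<le> k" using assms(5) by simp
  show ?thesis unfolding emit_def wp_seq
  proof (rule W1)
    fix \<sigma>1 assume 1: "same_except {18,19,21} \<sigma> \<sigma>1" "ar \<sigma>1 = (ar \<sigma>)(5 := marks ?S)" "ou \<sigma>1 = ou \<sigma>" "tm \<sigma>1 \<le> tm \<sigma> + 5 * length ss + 3"
    let ?\<sigma>0 = "setr 27 0 (setr 26 0 \<sigma>1)"
    have s0: "same_except {18,19,21,26,27} \<sigma> ?\<sigma>0" "ar ?\<sigma>0 = (ar \<sigma>)(5 := marks ?S)" "ou ?\<sigma>0 = ou \<sigma>"
      using 1 by (auto simp: same_except_def)
    have st0: "const_regs ?\<sigma>0" using const_regs_same_except[OF assms(1) s0(1)] by auto
    have "WP (For 18 19 6 (Atom (AGet 20 4 19 0) ;; ForList 21 22 20 emit_step))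
       (WP (For 18 19 27 emit_one) (WP (For 18 19 6 (Atom (AGet 21 4 19 0) ;; Atom (APut 5 21 0 0))) Q)) ?\<sigma>0"
    proof (rule wp_emit_scan[where ss = ss and X = X], goal_cases)
      case (12 \<sigma>2 es cs)
      note G2 = 12(1)[folded PS_def] and t2 = 12(2)
      show ?case
      proof (rule W3[OF G2 s0])
        fix \<sigma>3 ys assume 3: "same_except {18,19,20,21,22,23,24,26,27} \<sigma> \<sigma>3" "\<And>a. a \<notin> {5,7,8,9} \<Longrightarrow> ar \<sigma>3 a = ar \<sigma> a"
          "ar \<sigma>3 5 = marks ?S" "ou \<sigma>3 = ou \<sigma> @ ys" "listing adj ys (completions ?S X)" "tm \<sigma>3 \<le> tm \<sigma>2 + 22 * ?Sg + 3"
        show "WP (For 18 19 6 (Atom (AGet 21 4 19 0) ;; Atom (APut 5 21 0 0))) Q \<sigma>3"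
        proof (rule W4)
          show "const_regs \<sigma>3" using const_regs_same_except[OF assms(1) 3(1)] by auto
          show "rg \<sigma>3 6 = length ss" using 3(1) assms(2) by (simp add: same_except_def)
          show "ar \<sigma>3 4 = ar \<sigma> 4" using 3(2) by simp
          show "ar \<sigma>3 5 = marks ?S" by fact
          fix \<sigma>4 assume 4: "same_except {18,19,21} \<sigma>3 \<sigma>4" "ar \<sigma>4 = (ar \<sigma>3)(5 := marks {})" "ou \<sigma>4 = ou \<sigma>3" "tm \<sigma>4 \<le> tm \<sigma>3 + 5 * length ss + 3"
          show "Q \<sigma>4"
          proof (rule assms(13))
            show "same_except {18,19,20,21,22,23,24,26,27} \<sigma> \<sigma>4" using 3(1) 4(1) by (auto simp: same_except_def)
            show "ar \<sigma>4 a = ar \<sigma> a" if "a \<notin> {7,8,9}" for a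
              using that 3(2)[of a] 4(2) assms(10) by auto
            show "ou \<sigma>4 = ou \<sigma> @ ys" using 3 4 by simp
            show "listing adj ys (completions ?S X)" by fact
            have "tm ?\<sigma>0 = tm \<sigma>1 + 2" by simp
            then show "tm \<sigma>4 \<le> tm \<sigma> + 100 * ?Sg"
              using 1(4) t2 3(6) 4(4) kSg dSg ssx k_ge_2 by linarith
          qed
        qed
      qed
    qed (use st0 s0 assms kn in \<open>auto simp: same_except_def\<close>)
    then show "WP (Atom (AConst 26 0)) (WP (Atom (AConst 27 0)) (WP (For 18 19 6 (Atom (AGet 20 4 19 0) ;; ForList 21 22 20 emit_step))
       (WP (For 18 19 27 emit_one) (WP (For 18 19 6 (Atom (AGet 21 4 19 0) ;; Atom (APut 5 21 0 0))) Q)))) \<sigma>1"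
      using B_large by simp
  qed
qed

end

section \<open>The recursion\<close>

text \<open>Register 17 is the number of missing vertices, so zero means that \<open>v\<close> can
  be excluded. At \<open>q = 2\<close> the failure is known in advance and is entered as 1.\<close>

definition probe :: com where
  "probe = Atom (ASub 18 2 12) ;; IfNZ 18 (search ;; Atom (ASub 17 4 9)) (Atom (AConst 17 1))"

definition include_code :: com where
  "include_code = Atom (APut 4 6 0 13) ;; Atom (AAdd 6 6 1) ;; Atom (APut 3 8 9 13) ;; Atom (APut 5 13 0 1) ;;
     Atom (AAdd 9 9 1)"

text \<open>Row \<open>d + 1\<close> of array 3 holds the \<open>k\<close> vertices just found and
  turns into the witness of the excluding child when the depth is raised; nothing is copied.\<close>

definition descend :: com where
  "descend = clear ;; Atom (APut 10 7 0 13) ;; Atom (APut 11 7 0 6) ;; Atom (APut 12 7 0 12) ;; remove ;;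
     Atom (AAdd 7 7 1) ;; Atom (AAdd 8 8 1) ;; Atom (AConst 12 0) ;; reset"

definition stuck_code :: com where
  "stuck_code = clear ;; Atom (AAdd 12 12 1) ;; reset"

definition base_code :: com where
  "base_code = clear ;; emit ;; Atom (AConst 14 1)"

text \<open>The including child is a tail call: it takes over the depth and the witness row of its
  parent, so the depth counts only exclusions. The number of stuck runs is reloaded because it
  belongs to the witness, which is unchanged.\<close>

definition ascend :: com where
  "ascend = IfNZ 7 (Atom (ASub 7 7 1) ;; Atom (ASub 8 8 1) ;; Atom (AGet 13 10 7 0) ;; Atom (AGet 6 11 7 0) ;;
       Atom (AGet 12 12 7 0) ;; restore ;; Atom (APut 4 6 0 13) ;; Atom (AAdd 6 6 1) ;; Atom (AConst 14 0) ;; reset)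
     (Atom (AConst 15 0))"

definition frame_step :: com where
  "frame_step = IfNZ 14 ascend (Atom (ASub 18 5 6) ;;
     IfNZ 18 (pick ;; Atom (ASub 18 4 11) ;;
       IfNZ 18 (Atom (AGet 13 3 7 11) ;; probe ;; IfNZ 17 include_code descend) stuck_code) base_code)"

context alg
begin

lemma const_regs_simps [simp]: "5 < r \<Longrightarrow> const_regs (setr r x \<sigma>) = const_regs \<sigma>" "const_regs (tick \<sigma>) = const_regs \<sigma>" "const_regs (setm a i j x \<sigma>) = const_regs \<sigma>"
  unfolding const_regs_def by auto

text \<open>The work of the current run of failed searches, up to a constant factor.\<close>

definition effort :: "nat set \<Rightarrow> nat list \<Rightarrow> nat \<Rightarrow> nat \<Rightarrow> nat" where
  "effort X qs h p = (\<Sum>i<h. live_deg X (qs ! i) + 1) + length qs + p"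

definition closed :: "nat set \<Rightarrow> nat set \<Rightarrow> bool" where
  "closed X T \<longleftrightarrow> (\<forall>x \<in> T. \<forall>y. adj x y \<longrightarrow> y \<notin> X \<longrightarrow> y \<in> T)"

text \<open>What a parent relies on after a child has ended: linked lists, witness rows up to its
  own depth, its part of S and the frames below. Registers such as 6 and 12 are missing because
  \<open>ascend\<close> reloads them from the frame.\<close>

definition preserves :: "nat \<Rightarrow> nat \<Rightarrow> hstate \<Rightarrow> hstate \<Rightarrow> bool" where
  "preserves d s \<sigma> \<rho> \<longleftrightarrow> (\<forall>a \<in> {0,1,2,6,13}. ar \<rho> a = ar \<sigma> a) \<and> (\<forall>r \<le> d. ar \<rho> 3 r = ar \<sigma> 3 r) \<and>
     (\<forall>i < s. ar \<rho> 4 i = ar \<sigma> 4 i) \<and> (\<forall>a \<in> {10,11,12}. \<forall>i < d. ar \<rho> a i = ar \<sigma> a i) \<and>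
     (\<forall>r \<in> {0,1,2,3,4,5,7,8,15,16}. rg \<rho> r = rg \<sigma> r)"

lemma preserves_trans: "preserves d s \<sigma> \<sigma>' \<Longrightarrow> preserves d s' \<sigma>' \<rho> \<Longrightarrow> s \<le> s' \<Longrightarrow> preserves d s \<sigma> \<rho>"
  unfolding preserves_def by simp

text \<open>All neighbours of a scanned vertex outside \<open>X\<close> are in the queue, except
  possibly \<open>v\<close>. So the lists that were read are edges inside the queue and one extra
  entry per scanned vertex.\<close>

lemma sum_live_deg_le:
  assumes "distinct qs" "h \<le> length qs" "\<And>i y. i < h \<Longrightarrow> adj (qs ! i) y \<Longrightarrow> y \<notin> X \<Longrightarrow> y \<in> insert v (set qs)"
  shows "(\<Sum>i<h. live_deg X (qs ! i)) \<le> degsum (set qs) + h"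
proof -
  have "live_deg X (qs ! i) \<le> deg_in (qs ! i) (set qs) + 1" if i: "i < h" for i
  proof -
    have "{y. adj (qs ! i) y \<and> y \<notin> X} \<subseteq> insert v {w \<in> set qs. adj (qs ! i) w}" using assms(3)[OF i] by auto
    then have "live_deg X (qs ! i) \<le> card (insert v {w \<in> set qs. adj (qs ! i) w})"
      unfolding live_deg_def by (intro card_mono) auto
    also have "\<dots> \<le> Suc (deg_in (qs ! i) (set qs))" unfolding deg_in_def by (rule card_insert_le_m1) auto
    finally show ?thesis by simp
  qed
  then have "(\<Sum>i<h. live_deg X (qs ! i)) \<le> (\<Sum>i<h. deg_in (qs ! i) (set qs) + 1)" by (intro sum_mono) auto
  also have "\<dots> = (\<Sum>i<h. deg_in (qs ! i) (set qs)) + h" by (simp add: sum_Suc)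
  also have "(\<Sum>i<h. deg_in (qs ! i) (set qs)) \<le> (\<Sum>i<length qs. deg_in (qs ! i) (set qs))"
    using assms(2) by (intro sum_mono2) auto
  also have "\<dots> = degsum (set qs)"
    unfolding degsum_def using assms(1) by (simp add: sum.distinct_set_conv_list sum_list_sum_nth atLeast0LessThan)
  finally show ?thesis by simp
qed

text \<open>The four times \<open>k\<close> are the entries for \<open>v\<close>, the scans
  themselves, the length of the queue and the position in the witness.\<close>

lemma effort_le:
  assumes "distinct qs" "h \<le> length qs" "length qs \<le> k" "p \<le> k"
    "\<And>i y. i < h \<Longrightarrow> adj (qs ! i) y \<Longrightarrow> y \<notin> X \<Longrightarrow> y \<in> insert v (set qs)"
  shows "effort X qs h p \<le> degsum (set qs) + 4 * k"
proof -
  have "(\<Sum>i<h. live_deg X (qs ! i)) \<le> degsum (set qs) + h"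
    by (rule sum_live_deg_le[OF assms(1,2)]) (rule assms(5))
  then show ?thesis using assms(2-4) unfolding effort_def by (simp add: sum_Suc)
qed

end

text \<open>The lists ss, ts and qs hold S, the witness and the queue A, where the first h elements of A are
  scanned. After a reset A is S; within a run of failed searches everything but the last vertex of S is
  scanned. At q = 2 the witness is known to be a component, and searches are skipped.\<close>

locale node = alg +
  fixes X :: "nat set" and d :: nat and ss ts qs :: "nat list" and h p q :: nat and \<sigma> :: hstate
  assumes const_regs: "const_regs \<sigma>"
    and adj_ar: "\<And>u w. u < n \<Longrightarrow> w < n \<Longrightarrow> ar \<sigma> 2 u w = (if adj u w then 1 else 0)"
    and cnt0: "ar \<sigma> 6 = (\<lambda>_ _. 0)"
    and md: "rg \<sigma> 14 = 0" and run: "rg \<sigma> 15 \<noteq> 0"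
    and X: "X \<subseteq> {..<n}" and dX: "d \<le> card X"
    and adjacency_rep: "adjacency_rep X (ar \<sigma> 0) (ar \<sigma> 1)"
    and s: "rg \<sigma> 6 = length ss" "ss \<noteq> []" "length ss \<le> k - 1" "distinct ss" "prefix_conn ss"
    and ss_ar: "\<And>i. i < length ss \<Longrightarrow> ar \<sigma> 4 i 0 = ss ! i"
    and ss_ts: "set ss \<subseteq> set ts" and ss_qs: "set ss \<subseteq> set qs"
    and d: "rg \<sigma> 7 = d" "rg \<sigma> 8 = Suc d"
    and ts: "length ts = k" "distinct ts" "prefix_conn ts" "set ts \<subseteq> {..<n} - X" "ts ! 0 = ss ! 0"
    and ts_ar: "\<And>i. i < k \<Longrightarrow> ar \<sigma> 3 d i = ts ! i"
    and qs: "rg \<sigma> 9 = length qs" "length qs \<le> k" "distinct qs" "prefix_conn qs" "set qs \<subseteq> {..<n} - X" "qs ! 0 = ss ! 0"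
    and qs_ar: "\<And>i. i < length qs \<Longrightarrow> ar \<sigma> 3 (Suc d) i = qs ! i"
    and mark: "ar \<sigma> 5 = marks (set qs)"
    and h: "rg \<sigma> 10 = h" "h \<le> length qs"
    and p: "rg \<sigma> 11 = p" "p \<le> k" "\<And>i. i < p \<Longrightarrow> ts ! i \<in> set qs"
    and q: "rg \<sigma> 12 = q" "q \<le> 2"
    and clo: "\<And>i y. i < h \<Longrightarrow> adj (qs ! i) y \<Longrightarrow> y \<notin> X \<Longrightarrow> y \<in> set qs"
    and phase: "(qs = ss \<and> h = 0) \<or> (q < 2 \<and> Suc h = length qs \<and> qs ! h = last ss)"
    and q1: "q = 1 \<Longrightarrow> closed X (set ts) \<or>
       (\<exists>x \<in> set ss. \<exists>w. adj x w \<and> w \<notin> X \<and> w \<notin> set ts \<and> (h = 0 \<or> x \<noteq> last ss))"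
    and q2: "q = 2 \<Longrightarrow> closed X (set ts)"
begin

lemma qs_ne: "qs \<noteq> []" using ss_qs s(2) by auto

text \<open>Every level of depth excludes a vertex, and the vertices of S are never
  excluded.\<close>

lemma Suc_d_le: "Suc d \<le> n"
proof -
  obtain x where "x \<in> set ss" using s(2) by (meson list.set_sel(1))
  then have "X \<subset> {..<n}" using ss_ts ts(4) X by auto
  then have "card X < card {..<n}" by (intro psubset_card_mono) auto
  then show ?thesis using dX by simp
qed

lemma card_ts: "card (set ts) = k" using ts by (simp add: distinct_card)

lemma ts_ne: "ts \<noteq> []" using ts(1) k_ge_2 by auto

lemma ts_completion: "set ts \<in> completions (set ss) X"
  unfolding completions_def using ts ss_ts card_ts prefix_conn_conn[OF ts(3) ts_ne] by auto

lemma conn_ss: "conn (set ss)" using prefix_conn_conn[OF s(5,2)] .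

text \<open>By the order of the witness, \<open>ts ! p'\<close> is adjacent to the queue. Scanned
  elements have no neighbour outside the queue and \<open>X\<close>, so the neighbour is unscanned:
  the queue is S itself, or the only unscanned element is the last vertex of S. Thus S stays
  connected when this vertex is added.\<close>

lemma pick_adj:
  assumes "p' < k" "\<forall>i<p'. ts ! i \<in> set qs" "ts ! p' \<notin> set qs"
  shows "\<exists>x \<in> set ss. adj x (ts ! p')"
proof -
  have "ss ! 0 \<in> set qs" using s(2) ss_qs by (meson length_greater_0_conv nth_mem subsetD)
  then obtain x where x: "x \<in> set qs" "adj x (ts ! p')"
    using prefix_conn_adj[of ts p' "set qs"] ts(1,3,5) assms by auto
  have "ts ! p' \<in> set ts" using ts(1) assms(1) by simp
  then have v: "ts ! p' \<notin> X" using ts(4) by auto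
  from phase show ?thesis
  proof
    assume "qs = ss \<and> h = 0"
    then show ?thesis using x by auto
  next
    assume a: "q < 2 \<and> Suc h = length qs \<and> qs ! h = last ss"
    obtain i where i: "i < length qs" "qs ! i = x" using x(1) by (auto simp: in_set_conv_nth)
    have "\<not> i < h" using clo[of i "ts ! p'"] i(2) x(2) v assms(3) by auto
    then have "i = h" using i(1) a by linarith
    then have "x = last ss" using a i(2) by simp
    then show ?thesis using x(2) s(2) by auto
  qed
qed

text \<open>Executes a node up to its decision and leaves the continuations as hypotheses. At
  \<open>q = 2\<close> the missing search appears as one that found and scanned nothing.\<close>

lemma wp_frame_step:
  assumes "length ss < k - 1"
    and stuck: "\<And>\<sigma>'. same_except {11,18,21} \<sigma> \<sigma>' \<Longrightarrow> ar \<sigma>' = ar \<sigma> \<Longrightarrow> ou \<sigma>' = ou \<sigma> \<Longrightarrow> set ts \<subseteq> set qs \<Longrightarrow>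
       tm \<sigma>' \<le> tm \<sigma> + 8 * k + 20 \<Longrightarrow> WP stuck_code Q \<sigma>'"
    and probe: "\<And>\<sigma>' p' v qs' more h'. same_except {9,10,11,13,17,18,20,21,22,23,24} \<sigma> \<sigma>' \<Longrightarrow> rg \<sigma>' 11 = p' \<Longrightarrow> p \<le> p' \<Longrightarrow> p' < k \<Longrightarrow>
       (\<And>i. i < p' \<Longrightarrow> ts ! i \<in> set qs) \<Longrightarrow> v = ts ! p' \<Longrightarrow> rg \<sigma>' 13 = v \<Longrightarrow> \<exists>x \<in> set ss. adj x v \<Longrightarrow>
       qs' = qs @ more \<Longrightarrow> v \<notin> set qs' \<Longrightarrow>
       rg \<sigma>' 9 = length qs' \<Longrightarrow> length qs' \<le> k \<Longrightarrow> distinct qs' \<Longrightarrow> set qs' \<subseteq> {..<n} - X \<Longrightarrow> prefix_conn qs' \<Longrightarrow>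
       h \<le> h' \<Longrightarrow> h' \<le> length qs' \<Longrightarrow>
       (\<And>i y. i < h' \<Longrightarrow> adj (qs' ! i) y \<Longrightarrow> y \<notin> X \<Longrightarrow> y \<in> insert v (set qs')) \<Longrightarrow>
       (\<And>i. i < length qs' \<Longrightarrow> ar \<sigma>' 3 (Suc d) i = qs' ! i) \<Longrightarrow> ar \<sigma>' 5 = marks (set qs') \<Longrightarrow>
       (\<And>r. r \<noteq> Suc d \<Longrightarrow> ar \<sigma>' 3 r = ar \<sigma> 3 r) \<Longrightarrow> (\<And>a. a \<noteq> 3 \<Longrightarrow> a \<noteq> 5 \<Longrightarrow> ar \<sigma>' a = ar \<sigma> a) \<Longrightarrow>
       ou \<sigma>' = ou \<sigma> \<Longrightarrow>
       tm \<sigma>' \<le> tm \<sigma> + 8 * (p' - p) + 20 * (\<Sum>i = h..<h'. live_deg X (qs' ! i) + 1) +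
         (if length qs' < k then 0 else 20 * (k + 2)) + 30 \<Longrightarrow>
       (q < 2 \<and> (length qs' < k \<longrightarrow> h' = length qs' \<and> rg \<sigma>' 10 = h') \<and> rg \<sigma>' 17 = k - length qs') \<or>
         (q = 2 \<and> more = [] \<and> h' = h \<and> rg \<sigma>' 10 = h \<and> rg \<sigma>' 17 = 1) \<Longrightarrow>
       WP (IfNZ 17 include_code descend) Q \<sigma>'"
  shows "WP frame_step Q (tick \<sigma>)"
proof -
  note [simp] = const_regsD[OF const_regs]
  let ?\<sigma>0 = "tick (setr 18 (k - 1 - length ss) (tick (tick \<sigma>)))"
  have "WP pick (WP (Atom (ASub 18 4 11)) (WP (
       IfNZ 18 (Atom (AGet 13 3 7 11) ;; probe ;; IfNZ 17 include_code descend) stuck_code) Q)) ?\<sigma>0"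
  proof (rule wp_pick[where ts = ts and A = "set qs" and p = p], goal_cases)
    case (7 \<sigma>1 p')
    have sm1: "same_except {11,18,21} \<sigma> \<sigma>1" using 7(1) by (auto simp: same_except_def)
    have st1: "const_regs \<sigma>1" using const_regs_same_except[OF const_regs sm1] by auto
    have all: "\<forall>i<p'. ts ! i \<in> set qs" using 7(5) p(3) not_le by blast
    have t1: "tm \<sigma>1 \<le> tm \<sigma> + 8 * (p' - p) + 12" using 7(9) by simp
    have ar1: "ar \<sigma>1 = ar \<sigma>" "ou \<sigma>1 = ou \<sigma>" using 7(7,8) by simp_all
    show ?case
    proof (cases "p' < k")
      case False
      then have "p' = k" using 7(4) by simp
      then have sub: "set ts \<subseteq> set qs" using all ts(1) by (auto simp: in_set_conv_nth)
      have "WP stuck_code Q (tick (setr 18 0 \<sigma>1))"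
        by (rule stuck) (use sm1 ar1 sub t1 \<open>p' = k\<close> in \<open>auto simp: same_except_def\<close>)
      then show ?thesis using const_regsD[OF st1] 7(2) \<open>p' = k\<close> by simp
    next
      case True
      let ?v = "ts ! p'"
      have vq: "?v \<notin> set qs" using 7(6) True by simp
      have "?v \<in> set ts" using ts(1) True by simp
      then have vn: "?v \<in> {..<n} - X" using ts(4) by blast
      have r1: "rg \<sigma>1 7 = d" "rg \<sigma>1 8 = Suc d" "rg \<sigma>1 9 = length qs" "rg \<sigma>1 10 = h" "rg \<sigma>1 12 = q"
        using sm1 d qs(1) h(1) q(1) by (simp_all add: same_except_def)
      have pa: "\<exists>x \<in> set ss. adj x ?v" by (rule pick_adj[OF True all vq])
      let ?\<sigma>2 = "setr 13 ?v (tick (setr 18 (k - p') \<sigma>1))"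
      let ?\<sigma>3 = "tick (setr 18 (2 - q) ?\<sigma>2)"
      have "WP probe (WP (IfNZ 17 include_code descend) Q) ?\<sigma>2"
      proof (cases "q = 2")
        case q2: True
        have "WP (IfNZ 17 include_code descend) Q (setr 17 1 ?\<sigma>3)"
        proof (rule probe[where p' = p' and v = ?v and more = "[]" and h' = h and qs' = qs], goal_cases)
          case 18
          then show ?case using clo by blast
        qed (use sm1 7(2-4) True all pa vq qs qs_ar h clo mark ar1 t1 q2 in \<open>auto simp: same_except_def\<close>)
        then show ?thesis unfolding probe_def using const_regsD[OF st1] r1(5) q2 B_large by simp
      next
        case False
        then have ql: "q < 2" using q(2) by simp
        have "WP search (WP (Atom (ASub 17 4 9)) (WP (IfNZ 17 include_code descend) Q)) ?\<sigma>3"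
        proof (rule wp_search[where v = ?v and R = "Suc d" and X = X and qs = qs and h = h], goal_cases)
          case (19 \<sigma>4 more h')
          note S = 19
          have sm4: "same_except {9,10,11,13,17,18,20,21,22,23,24} \<sigma> \<sigma>4" using S(1) sm1 by (auto simp: same_except_def)
          have st4: "const_regs \<sigma>4" using const_regs_same_except[OF const_regs sm4] by auto
          have r4: "rg \<sigma>4 11 = p'" "rg \<sigma>4 13 = ?v" using S(1) 7(2) by (auto simp: same_except_def)
          have t4: "tm \<sigma>4 \<le> tm \<sigma>1 + 5 + 20 * (\<Sum>i = h..<h'. live_deg X ((qs @ more) ! i) + 1) + (if length (qs @ more) < k then 0 else 20 * (k + 2)) + 6"
            using S(17) by simp
          have "WP (IfNZ 17 include_code descend) Q (setr 17 (k - length (qs @ more)) \<sigma>4)"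
            by (rule probe[where p' = p' and v = ?v and more = more and h' = h' and qs' = "qs @ more"])
              (use sm4 7(3) True all pa S(2-16) r4 ar1 t1 t4 ql in \<open>auto simp: same_except_def\<close>)
          then show ?case using const_regsD[OF st4] S(2) by simp
        qed (use st1 vn r1 Suc_d_le adjacency_rep ar1 qs qs_ne vq h clo qs_ar mark in \<open>auto simp: same_except_def\<close>)
        then show ?thesis unfolding probe_def using const_regsD[OF st1] r1(5) ql by simp
      qed
      moreover have "ar \<sigma>1 3 (rg \<sigma>1 7) p' = ?v" using ts_ar[OF True] ar1 r1 by simp
      ultimately show ?thesis using const_regsD[OF st1] 7(2) True k_le_n by simp
    qed
  qed (use const_regs p ts mark d ts_ar in auto)
  moreover have "\<not> k \<le> Suc (length ss)" using assms(1) by linarith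
  ultimately show ?thesis unfolding frame_step_def using md s(1) by simp
qed

end

section \<open>Time accounting of a node\<close>

context alg
begin

abbreviation "steps \<equiv> (loop_iteration n B inp 15 frame_step)\<^sup>*"

text \<open>The entry state \<open>\<sigma>\<close> of the node is fixed, while the current state
  \<open>\<sigma>1\<close> varies; so a node may hand over to a successor node and inherit its
  result by transitivity. \<open>c\<close> is the time that must be left over. The marks have to be
  empty at the end because the parent continues with \<open>reset\<close>.\<close>

definition completes :: "nat \<Rightarrow> nat list \<Rightarrow> nat set \<Rightarrow> hstate \<Rightarrow> nat \<Rightarrow> hstate \<Rightarrow> bool" where
  "completes d ss X \<sigma> c \<sigma>1 \<longleftrightarrow> (\<exists>\<rho> ys. (\<sigma>1, \<rho>) \<in> steps \<and> preserves d (length ss) \<sigma> \<rho> \<and> rg \<rho> 14 = 1 \<and> ar \<rho> 5 = marks {} \<and>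
     ou \<rho> = ou \<sigma> @ ys \<and> listing adj ys (completions (set ss) X) \<and> tm \<rho> + c \<le> tm \<sigma> + potential 1500 16 (set ss) X)"

text \<open>Time that a node saves against the potential: the current run of failed searches, up to two stuck
  runs, and the search in the parent that has found the witness.\<close>

definition credit :: "nat set \<Rightarrow> nat list \<Rightarrow> nat list \<Rightarrow> nat \<Rightarrow> nat \<Rightarrow> nat \<Rightarrow> nat" where
  "credit X ts qs h p q = 50 * effort X qs h p + 300 * q * degsum (set ts) + 400 * degsum (set ts)"

text \<open>Exclusion enlarges \<open>X\<close>, inclusion enlarges S, a stuck run raises
  \<open>q\<close>. An exclusion sets \<open>q\<close> back to 0, which raises the last summand by
  at most 2; hence the weight 3.\<close>

definition remaining :: "nat set \<Rightarrow> nat list \<Rightarrow> nat \<Rightarrow> nat" where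
  "remaining X ss q = 3 * ((n - card X) + (k - length ss)) + (2 - q)"

lemma completes_iteration:
  assumes "wp n B inp frame_step (completes d ss X \<sigma> c) (tick \<sigma>)" "rg \<sigma> 15 \<noteq> 0"
  shows "completes d ss X \<sigma> c \<sigma>"
proof -
  obtain \<sigma>1 where 1: "big_step n B inp frame_step (tick \<sigma>) \<sigma>1" "completes d ss X \<sigma> c \<sigma>1" using assms(1) by (auto simp: wp_def)
  then have "(\<sigma>, \<sigma>1) \<in> steps" using assms(2) by (auto simp: loop_iteration_def)
  then show ?thesis using 1(2) unfolding completes_def by (meson rtrancl_trans)
qed

lemma preserves_const_regs: "preserves d s \<sigma> \<rho> \<Longrightarrow> const_regs \<sigma> \<Longrightarrow> const_regs \<rho>"
  unfolding preserves_def const_regs_def by simp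

end

section \<open>Base case, stuck run, inclusion and exclusion\<close>

context node
begin

lemma k_le_degsum: "k \<le> degsum (set ts)" using degsum_completion[OF ts_completion] .

lemma step_base:
  assumes "length ss = k - 1"
  shows "completes d ss X \<sigma> (credit X ts qs h p q) \<sigma>"
proof (rule completes_iteration[OF _ run])
  let ?Sg = "\<Sum>T \<in> completions (set ss) X. degsum T"
  \<comment> \<open>The queue contains S and has \<open>k - 1\<close> or \<open>k\<close> vertices:
    it is S, or it is a solution itself. In both cases some solution has at least its edges.\<close>
  have edq: "degsum (set qs) \<le> ?Sg"
  proof -
    have c: "card (set ss) = k - 1" "card (set qs) = length qs" using s qs assms by (simp_all add: distinct_card)
    then have "k - 1 \<le> length qs" using card_mono[OF _ ss_qs] by simp
    then consider "length qs = k - 1" | "length qs = k" using qs(2) by linarith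
    then show ?thesis
    proof cases
      case 1
      then have "set ss = set qs" using ss_qs c by (intro card_subset_eq) auto
      then have "degsum (set qs) \<le> degsum (set ts)" using ss_ts by (intro degsum_mono) auto
      then show ?thesis using degsum_le_sum_completions[OF ts_completion] by linarith
    next
      case 2
      then have "set qs \<in> completions (set ss) X"
        unfolding completions_def using qs c prefix_conn_conn[OF qs(4) qs_ne] ss_qs by auto
      then show ?thesis by (rule degsum_le_sum_completions)
    qed
  qed
  have spl: "effort X qs h p \<le> degsum (set qs) + 4 * k"
    using effort_le[OF qs(3) h(2) qs(2) p(2), of X 0] clo by blast
  have kS: "k \<le> ?Sg" "degsum (set ts) \<le> ?Sg" using k_le_degsum degsum_le_sum_completions[OF ts_completion] by linarith+
  have q600: "300 * q * degsum (set ts) \<le> 600 * degsum (set ts)" using q(2) by (intro mult_le_mono1) simp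
  \<comment> \<open>The credit is at most 250 + 600 + 400 times the sum, since the effort is at most
    five times it. The added 200 cover \<open>emit\<close> and the clearing of marks. This is where
    1500 comes from.\<close>
  have cl: "credit X ts qs h p q + 200 * ?Sg \<le> 1500 * ?Sg"
    unfolding credit_def using spl edq kS q600 by linarith
  have PL: "1500 * ?Sg \<le> potential 1500 16 (set ss) X" by (rule potential_lower)
  let ?\<sigma>1 = "tick (setr 18 0 (tick (tick \<sigma>)))"
  have "WP clear (WP emit (WP (Atom (AConst 14 1)) (completes d ss X \<sigma> (credit X ts qs h p q)))) ?\<sigma>1"
  proof (rule wp_clear[where qs = qs], goal_cases)
    case (7 \<sigma>1)
    have st1: "const_regs \<sigma>1" using const_regs_same_except[OF _ 7(1)] const_regs by auto
    show ?case
    proof (rule wp_emit[where ss = ss and X = X and ?T0.0 = "set ts"], goal_cases)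
      case (13 \<sigma>2 ys)
      have st2: "const_regs \<sigma>2" using const_regs_same_except[OF st1 13(1)] by auto
      have k: "preserves d (length ss) \<sigma> (setr 14 1 \<sigma>2)"
        unfolding preserves_def using 7(1,2) 13(1,2) by (auto simp: same_except_def)
      have "ar \<sigma>2 5 = marks {}" using 13(2)[of 5] 7(2) by simp
      moreover have "tm (setr 14 1 \<sigma>2) + credit X ts qs h p q \<le> tm \<sigma> + potential 1500 16 (set ss) X"
        using 7(4) 13(5) cl PL kS k_ge_2 qs(2) by simp
      ultimately have "completes d ss X \<sigma> (credit X ts qs h p q) (setr 14 1 \<sigma>2)"
        unfolding completes_def using k 13(3,4) 7(3) by (intro exI[of _ "setr 14 1 \<sigma>2"] exI[of _ ys]) simp
      then show ?case using B_large by simp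
    qed (use st1 7(1,2) s(1,4) ss_ts ts(4) assms conn_ss ts_completion adjacency_rep ss_ar cnt0 adj_ar in \<open>auto simp: same_except_def\<close>)
  qed (use const_regs qs d qs_ar mark k_le_n in auto)
  then show "WP frame_step (completes d ss X \<sigma> (credit X ts qs h p q)) (tick \<sigma>)"
    unfolding frame_step_def base_code_def using md s(1) assms const_regsD[OF const_regs] by simp
qed

text \<open>Only the last vertex of S can have a neighbour outside the witness here; this gives the alternative
  for q = 1 and, at the second time, a contradiction to it.\<close>

lemma step_stuck:
  assumes IH: "\<And>X' d' ss' ts' qs' h' p' q' \<sigma>'. node n k adj B X' d' ss' ts' qs' h' p' q' \<sigma>' \<Longrightarrow>
      remaining X' ss' q' < remaining X ss q \<Longrightarrow> completes d' ss' X' \<sigma>' (credit X' ts' qs' h' p' q') \<sigma>'"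
    and sm: "same_except {11,18,21} \<sigma> \<sigma>'" and ar: "ar \<sigma>' = ar \<sigma>" and ou: "ou \<sigma>' = ou \<sigma>"
    and sub: "set ts \<subseteq> set qs" and t: "tm \<sigma>' \<le> tm \<sigma> + 8 * k + 20" and sl: "length ss < k - 1"
  shows "WP stuck_code (completes d ss X \<sigma> (credit X ts qs h p q)) \<sigma>'"
proof -
  have cq: "card (set qs) = length qs" using qs by (simp add: distinct_card)
  have "k \<le> length qs" using card_mono[OF _ sub] card_ts cq by simp
  then have lq: "length qs = k" using qs(2) by simp
  then have eq: "set ts = set qs" using sub cq card_ts by (intro card_subset_eq) auto
  have "\<not> (qs = ss \<and> h = 0)" using lq sl by auto
  then have ph: "q < 2" "Suc h = length qs" "qs ! h = last ss" using phase by auto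
  have gate: "x = last ss" if g: "x \<in> set ts" "adj x w" "w \<notin> X" "w \<notin> set ts" for x w
  proof -
    obtain i where i: "i < length qs" "qs ! i = x" using g(1) eq by (auto simp: in_set_conv_nth)
    have "\<not> i < h" using clo[of i w] i g eq by auto
    then have "i = h" using i(1) ph(2) by linarith
    then show ?thesis using ph(3) i(2) by simp
  qed
  have hk: "h \<noteq> 0" using ph(2) lq k_ge_2 by simp
  have c1: "closed X (set ts) \<or> (\<exists>x \<in> set ss. \<exists>w. adj x w \<and> w \<notin> X \<and> w \<notin> set ts)"
  proof (rule disjCI)
    assume "\<not> (\<exists>x \<in> set ss. \<exists>w. adj x w \<and> w \<notin> X \<and> w \<notin> set ts)"
    moreover have "last ss \<in> set ss" using s(2) by simp
    ultimately show "closed X (set ts)" unfolding closed_def using gate by blast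
  qed
  \<comment> \<open>As \<open>h\<close> is not 0, \<open>q1\<close> would name a vertex of S other
    than the last that has a neighbour outside the witness. By \<open>gate\<close> there is none, so
    the first alternative of \<open>q1\<close> holds.\<close>
  have c2: "closed X (set ts)" if "q = 1"
    using q1[OF that] gate ss_ts hk by blast
  have const_regs': "const_regs \<sigma>'" using const_regs_same_except[OF const_regs sm] by auto
  have kn: "length ss \<le> n" using sl k_le_n by simp
  have spl: "effort X qs h p \<le> degsum (set ts) + 4 * k"
    using effort_le[OF qs(3) h(2) qs(2) p(2), of X 0] clo eq by simp
  show ?thesis unfolding stuck_code_def wp_seq
  proof (rule wp_clear[where qs = qs], goal_cases)
    case (7 \<sigma>1)
    have st1: "const_regs \<sigma>1" using const_regs_same_except[OF const_regs' 7(1)] by auto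
    have r1: "rg \<sigma>1 12 = q" "rg \<sigma>1 6 = length ss" "rg \<sigma>1 8 = Suc d" using 7(1) sm q s d by (simp_all add: same_except_def)
    let ?\<sigma>1 = "setr 12 (Suc q) \<sigma>1"
    have "WP reset (completes d ss X \<sigma> (credit X ts qs h p q)) ?\<sigma>1"
    proof (rule wp_reset[where ss = ss], goal_cases)
      case (6 \<sigma>2)
      have sm2: "same_except {9,10,11,12,18,19,21} \<sigma> \<sigma>2" using sm 7(1) 6(1) by (auto simp: same_except_def)
      have ar2: "ar \<sigma>2 a = ar \<sigma> a" if "a \<noteq> 3" "a \<noteq> 5" for a using 6(8)[of a] 7(2) ar that by simp
      have row2: "ar \<sigma>2 3 r = ar \<sigma> 3 r" if "r \<noteq> Suc d" for r using 6(7)[of r] 7(2) ar that r1(3) by simp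
      have row3: "ar \<sigma>2 3 (Suc d) i = ss ! i" if "i < length ss" for i using 6(6)[OF that] r1(3) by simp
      have r12: "rg \<sigma>2 12 = Suc q" using 6(1) by (simp add: same_except_def)
      have t2: "tm \<sigma>2 \<le> tm \<sigma> + 21 * k + 34" using t 7(4) 6(10) lq sl by simp
      have node': "node n k adj B X d ss ts ss 0 0 (Suc q) \<sigma>2"
      proof (rule node.intro[OF alg_axioms], rule node_axioms.intro)
        show "const_regs \<sigma>2" using const_regs_same_except[OF const_regs sm2] by auto
        show "Suc q = 1 \<Longrightarrow> closed X (set ts) \<or>
            (\<exists>x\<in>set ss. \<exists>w. adj x w \<and> w \<notin> X \<and> w \<notin> set ts \<and> (0 = 0 \<or> x \<noteq> last ss))" using c1 by simp
        show "Suc q = 2 \<Longrightarrow> closed X (set ts)" using c2 by simp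
      qed (use sm2 ar2 row2 row3 r12 6(2-5) adj_ar cnt0 md run X dX adjacency_rep s ss_ar ss_ts d ts ts_ar qs(5) k_ge_2 ph(1) in
          \<open>auto simp: same_except_def\<close>)
      have "completes d ss X \<sigma>2 (credit X ts ss 0 0 (Suc q)) \<sigma>2"
        by (rule IH[OF node']) (use ph(1) in \<open>simp add: remaining_def\<close>)
      then obtain \<rho> ys where \<rho>: "(\<sigma>2, \<rho>) \<in> steps" "preserves d (length ss) \<sigma>2 \<rho>" "rg \<rho> 14 = 1" "ar \<rho> 5 = marks {}"
        "ou \<rho> = ou \<sigma>2 @ ys" "listing adj ys (completions (set ss) X)"
        "tm \<rho> + credit X ts ss 0 0 (Suc q) \<le> tm \<sigma>2 + potential 1500 16 (set ss) X" unfolding completes_def by blast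
      have "preserves d (length ss) \<sigma> \<sigma>2" unfolding preserves_def using sm2 ar2 row2 by (auto simp: same_except_def)
      then have kp: "preserves d (length ss) \<sigma> \<rho>" using preserves_trans[OF _ \<rho>(2)] by simp
      \<comment> \<open>A higher \<open>q\<close> makes the continuation save 300 times the degree
        sum of the witness more. The finished run takes 250 of these, as its queue is the witness;
        the rest pays for clearing and resetting.\<close>
      have "credit X ts qs h p q + 21 * k + 34 \<le> credit X ts ss 0 0 (Suc q)"
      proof -
        have "credit X ts ss 0 0 (Suc q) \<ge> 300 * q * degsum (set ts) + 300 * degsum (set ts) + 400 * degsum (set ts)"
          unfolding credit_def by (simp add: add_mult_distrib)
        then show ?thesis unfolding credit_def[of X ts qs] using spl k_le_degsum k_ge_2 by linarith
      qed
      then have "tm \<rho> + credit X ts qs h p q \<le> tm \<sigma> + potential 1500 16 (set ss) X"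
        using \<rho>(7) t2 by linarith
      then show ?case unfolding completes_def using \<rho> kp 6(9) 7(3) ou
        by (intro exI[of _ \<rho>] exI[of _ ys]) simp
    qed (use st1 r1 s kn ss_ar ar 7(2) in auto)
    moreover have "Suc q < B" using q(2) B_large by linarith
    ultimately show ?case using const_regsD[OF st1] r1 by simp
  qed (use const_regs' sm ar qs d qs_ar mark k_le_n in \<open>auto simp: same_except_def\<close>)
qed

text \<open>No solution avoids \<open>v\<close>, so the child has the same solutions and the same
  witness. With \<open>v\<close> appended to S and to the queue, \<open>v\<close> is the last vertex
  of S and, within a run of searches, the only unscanned element; the next search resumes from
  there.\<close>

lemma step_include:
  assumes IH: "\<And>X' d' ss' ts' qs' h' p' q' \<sigma>'. node n k adj B X' d' ss' ts' qs' h' p' q' \<sigma>' \<Longrightarrow>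
      remaining X' ss' q' < remaining X ss q \<Longrightarrow> completes d' ss' X' \<sigma>' (credit X' ts' qs' h' p' q') \<sigma>'"
    and sm: "same_except {9,10,11,13,17,18,20,21,22,23,24} \<sigma> \<sigma>'" and p': "rg \<sigma>' 11 = p'" "p \<le> p'" "p' < k"
      "\<And>i. i < p' \<Longrightarrow> ts ! i \<in> set qs" and v: "v = ts ! p'" "rg \<sigma>' 13 = v" and pa: "\<exists>x \<in> set ss. adj x v"
    and qs': "qs' = qs @ ms" "v \<notin> set qs'"
      "rg \<sigma>' 9 = length qs'" "length qs' < k" "distinct qs'" "set qs' \<subseteq> {..<n} - X" "prefix_conn qs'"
    and h': "h \<le> h'" "h' \<le> length qs'" "rg \<sigma>' 10 = h'"
      "\<And>i y. i < h' \<Longrightarrow> adj (qs' ! i) y \<Longrightarrow> y \<notin> X \<Longrightarrow> y \<in> insert v (set qs')"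
    and row: "\<And>i. i < length qs' \<Longrightarrow> ar \<sigma>' 3 (Suc d) i = qs' ! i" and mk: "ar \<sigma>' 5 = marks (set qs')"
    and rows: "\<And>r. r \<noteq> Suc d \<Longrightarrow> ar \<sigma>' 3 r = ar \<sigma> 3 r" and arr: "\<And>a. a \<noteq> 3 \<Longrightarrow> a \<noteq> 5 \<Longrightarrow> ar \<sigma>' a = ar \<sigma> a"
    and ou: "ou \<sigma>' = ou \<sigma>" and t: "tm \<sigma>' \<le> tm \<sigma> + 8 * (p' - p) + 20 * (\<Sum>i = h..<h'. live_deg X (qs' ! i) + 1) + 30"
    and ph: "(q < 2 \<and> h' = length qs') \<or> (q = 2 \<and> ms = [] \<and> h' = h)"
    and sl: "length ss < k - 1"
  shows "WP include_code (completes d ss X \<sigma> (credit X ts qs h p q)) (tick \<sigma>')"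
proof -
  have const_regs': "const_regs \<sigma>'" using const_regs_same_except[OF const_regs sm] by auto
  have vts: "v \<in> set ts" using v(1) p'(3) ts(1) by simp
  then have vn: "v < n" "v \<notin> X" using ts(4) by auto
  have vss: "v \<notin> set ss" using qs'(1,2) ss_qs by auto
  have r1: "rg \<sigma>' 6 = length ss" "rg \<sigma>' 8 = Suc d" using sm s d by (simp_all add: same_except_def)
  let ?\<sigma>1 = "setr 9 (Suc (length qs')) (setm 5 v 0 1 (setm 3 (Suc d) (length qs') v (setr 6 (Suc (length ss))
      (setm 4 (length ss) 0 v (tick \<sigma>')))))"
  let ?ss = "ss @ [v]" and ?qs = "qs' @ [v]"
  have exec: "WP include_code Q (tick \<sigma>') \<longleftrightarrow> Q ?\<sigma>1" for Q
  proof -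
    have "Suc (length ss) < B" "Suc (length qs') < B" using sl qs'(4) k_le_n B_large by linarith+
    then show ?thesis unfolding include_code_def using const_regsD[OF const_regs'] r1 v(2) qs'(3,4) k_le_n vn by simp
  qed
  have sm1: "same_except {6,9,10,11,13,17,18,20,21,22,23,24} \<sigma> ?\<sigma>1" using sm by (auto simp: same_except_def)
  have ar1: "ar ?\<sigma>1 a = ar \<sigma> a" if "a \<noteq> 3" "a \<noteq> 4" "a \<noteq> 5" for a using arr[of a] that by simp
  have ar3: "ar ?\<sigma>1 3 r = ar \<sigma> 3 r" if "r \<noteq> Suc d" for r using rows[OF that] that by (auto simp: update2_def)
  have ar3': "ar ?\<sigma>1 3 (Suc d) i = ?qs ! i" if "i < Suc (length qs')" for i
    using that row by (auto simp: update2_def nth_append less_Suc_eq)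
  have ar4: "ar ?\<sigma>1 4 i 0 = ?ss ! i" if "i < Suc (length ss)" for i
    using that ss_ar arr[of 4] by (auto simp: update2_def nth_append less_Suc_eq)
  have ar4': "ar ?\<sigma>1 4 i = ar \<sigma> 4 i" if "i < length ss" for i
    using that arr[of 4] by (auto simp: update2_def)
  have ar5: "ar ?\<sigma>1 5 = marks (set ?qs)" using mk by (simp add: update2_marks)
  have hd: "?ss ! 0 = ss ! 0" "?qs ! 0 = ss ! 0" using s(2) qs(6) qs_ne qs'(1) by (simp_all add: nth_append)
  have pc: "prefix_conn ?ss" "prefix_conn ?qs" unfolding prefix_conn_snoc using s(5) pa qs'(7) ss_qs qs'(1) by auto
  have ph2: "q < 2 \<or> qs = ss \<and> h = 0 \<and> q = 2" using phase q(2) by linarith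
  have node': "node n k adj B X d ?ss ts ?qs h' p' q ?\<sigma>1"
  proof (rule node.intro[OF alg_axioms], rule node_axioms.intro)
    show "const_regs ?\<sigma>1" using const_regs_same_except[OF const_regs sm1] by auto
    \<comment> \<open>At \<open>q = 2\<close> no search was made: the queue was S with nothing
      scanned, and it remains so.\<close>
    show "(?qs = ?ss \<and> h' = 0) \<or> (q < 2 \<and> Suc h' = length ?qs \<and> ?qs ! h' = last ?ss)"
      using ph ph2 qs'(1) by (auto simp: nth_append)
    \<comment> \<open>The vertex named by \<open>q1\<close> belongs to the old S, so it differs from
      the new last vertex \<open>v\<close>.\<close>
    show "q = 1 \<Longrightarrow> closed X (set ts) \<or>
       (\<exists>x \<in> set ?ss. \<exists>w. adj x w \<and> w \<notin> X \<and> w \<notin> set ts \<and> (h' = 0 \<or> x \<noteq> last ?ss))"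
      using q1 vss by (metis Un_iff last_snoc set_append)
    show "\<And>i y. i < h' \<Longrightarrow> adj (?qs ! i) y \<Longrightarrow> y \<notin> X \<Longrightarrow> y \<in> set ?qs"
      using h'(2,4) by (auto simp: nth_append)
    show "\<And>i. i < p' \<Longrightarrow> ts ! i \<in> set ?qs" using p'(4) qs'(1) by auto
    show "\<And>i. i < length ?qs \<Longrightarrow> ar ?\<sigma>1 3 (Suc d) i = ?qs ! i" using ar3' by simp
    show "\<And>i. i < length ?ss \<Longrightarrow> ar ?\<sigma>1 4 i 0 = ?ss ! i" using ar4 by simp
    show "ar ?\<sigma>1 5 = marks (set ?qs)" by (rule ar5)
    show "\<And>i. i < k \<Longrightarrow> ar ?\<sigma>1 3 d i = ts ! i" using ar3[of d] ts_ar by simp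
    show "adjacency_rep X (ar ?\<sigma>1 0) (ar ?\<sigma>1 1)" using ar1[of 0] ar1[of 1] adjacency_rep by simp
    show "ar ?\<sigma>1 6 = (\<lambda>_ _. 0)" using ar1[of 6] cnt0 by simp
    show "\<And>u w. u < n \<Longrightarrow> w < n \<Longrightarrow> ar ?\<sigma>1 2 u w = (if adj u w then 1 else 0)" using ar1[of 2] adj_ar by simp
  qed (use sm h' p' qs' vn vss vts s sl hd pc q q2 ss_ts ss_qs d md run X dX ts in \<open>auto simp: same_except_def\<close>)
  have ins: "set ?ss = insert v (set ss)" by simp
  have "remaining X ?ss q < remaining X ss q" unfolding remaining_def using sl by simp
  then have "completes d ?ss X ?\<sigma>1 (credit X ts ?qs h' p' q) ?\<sigma>1" by (rule IH[OF node'])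
  then obtain \<rho> ys where \<rho>: "(?\<sigma>1, \<rho>) \<in> steps" "preserves d (Suc (length ss)) ?\<sigma>1 \<rho>" "rg \<rho> 14 = 1" "ar \<rho> 5 = marks {}"
    "ou \<rho> = ou ?\<sigma>1 @ ys" "listing adj ys (completions (insert v (set ss)) X)"
    "tm \<rho> + credit X ts ?qs h' p' q \<le> tm ?\<sigma>1 + potential 1500 16 (insert v (set ss)) X"
    unfolding completes_def ins by auto
  have emp: "completions (set ss) (insert v X) = {}"
  proof (cases "q < 2")
    case True
    then have "h' = length qs'" using ph by auto
    then have "\<And>x y. x \<in> set qs' \<Longrightarrow> adj x y \<Longrightarrow> y \<notin> insert v X \<Longrightarrow> y \<in> set qs'"
      using h'(4) by (metis in_set_conv_nth insert_iff)
    moreover have "card (set qs') < k" using qs'(4,5) by (simp add: distinct_card)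
    ultimately show ?thesis using s(2) ss_qs qs'(1) by (intro completions_empty[of _ "set qs'"]) auto
  next
    case False
    then have "closed X (set ts)" using q2 q(2) by simp
    then show ?thesis using s(2) ss_ts card_ts vts
      by (intro completions_empty_avoiding[of _ "set ts"]) (auto simp: closed_def)
  qed
  then have sol: "completions (insert v (set ss)) X = completions (set ss) X" using completions_split(1)[of "set ss" X v] by simp
  have PS: "potential 1500 16 (insert v (set ss)) X \<le> potential 1500 16 (set ss) X"
    using potential_split[OF vss, of 1500 16 X] by simp
  have "preserves d (length ss) \<sigma> ?\<sigma>1" unfolding preserves_def using sm1 ar1 ar3 ar4' by (auto simp: same_except_def)
  then have kp: "preserves d (length ss) \<sigma> \<rho>" using preserves_trans[OF _ \<rho>(2)] by simp
  \<comment> \<open>The elapsed time is charged to the growth of \<open>effort\<close>: 8 per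
    position, 20 per unit of scanning and 36 for the new queue element, each below the coefficient
    50.\<close>
  have c: "tm ?\<sigma>1 + credit X ts qs h p q \<le> tm \<sigma> + credit X ts ?qs h' p' q"
  proof -
    have e1: "(\<Sum>i<h'. live_deg X (?qs ! i) + 1) = (\<Sum>i<h. live_deg X (qs ! i) + 1) + (\<Sum>i = h..<h'. live_deg X (qs' ! i) + 1)"
    proof -
      have "(\<Sum>i<h'. live_deg X (?qs ! i) + 1) = (\<Sum>i<h'. live_deg X (qs' ! i) + 1)"
        using h'(2) by (intro sum.cong refl) (simp add: nth_append)
      also have "\<dots> = (\<Sum>i<h. live_deg X (qs' ! i) + 1) + (\<Sum>i = h..<h'. live_deg X (qs' ! i) + 1)"
      proof -
        have "{..<h'} = {..<h} \<union> {h..<h'}" using h'(1) by auto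
        then show ?thesis
          by (metis (no_types, lifting) finite_atLeastLessThan finite_lessThan ivl_disj_int_one(2) sum.union_disjoint)
      qed
      also have "(\<Sum>i<h. live_deg X (qs' ! i) + 1) = (\<Sum>i<h. live_deg X (qs ! i) + 1)"
        using h(2) qs'(1) by (intro sum.cong refl) (simp add: nth_append)
      finally show ?thesis .
    qed
    define A where "A = (\<Sum>i = h..<h'. live_deg X (qs' ! i) + 1)"
    have "effort X ?qs h' p' = effort X qs h p + A + (length qs' + 1 - length qs) + (p' - p)"
      unfolding effort_def e1 A_def[symmetric] using p'(2) qs'(1) by simp
    then have "effort X ?qs h' p' \<ge> effort X qs h p + A + 1 + (p' - p)" using qs'(1) by simp
    moreover have "tm ?\<sigma>1 \<le> tm \<sigma> + 8 * (p' - p) + 20 * A + 36" using t unfolding A_def by simp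
    ultimately show ?thesis unfolding credit_def by linarith
  qed
  have "completes d ss X \<sigma> (credit X ts qs h p q) ?\<sigma>1"
    unfolding completes_def
    by (intro exI[of _ \<rho>] exI[of _ ys]) (use \<rho> kp ou sol PS c in simp)
  then show ?thesis unfolding exec .
qed

text \<open>Two chains of iterations are joined by one iteration of \<open>ascend\<close>. The
  search and the run before it explored edges of the found set, apart from those to
  \<open>v\<close>; this set is the witness of the excluding child, whose credit therefore pays for
  them.\<close>

lemma step_descend:
  assumes IH: "\<And>X' d' ss' ts' qs' h' p' q' \<sigma>'. node n k adj B X' d' ss' ts' qs' h' p' q' \<sigma>' \<Longrightarrow>
      remaining X' ss' q' < remaining X ss q \<Longrightarrow> completes d' ss' X' \<sigma>' (credit X' ts' qs' h' p' q') \<sigma>'"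
    and sm: "same_except {9,10,11,13,17,18,20,21,22,23,24} \<sigma> \<sigma>'" and p': "p \<le> p'" "p' < k"
    and v: "v = ts ! p'" "rg \<sigma>' 13 = v" and pa: "\<exists>x \<in> set ss. adj x v"
    and qs': "qs' = qs @ ms" "v \<notin> set qs'"
      "rg \<sigma>' 9 = length qs'" "length qs' = k" "distinct qs'" "set qs' \<subseteq> {..<n} - X" "prefix_conn qs'"
    and h': "h \<le> h'" "h' \<le> length qs'"
      "\<And>i y. i < h' \<Longrightarrow> adj (qs' ! i) y \<Longrightarrow> y \<notin> X \<Longrightarrow> y \<in> insert v (set qs')"
    and row: "\<And>i. i < length qs' \<Longrightarrow> ar \<sigma>' 3 (Suc d) i = qs' ! i" and mk: "ar \<sigma>' 5 = marks (set qs')"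
    and rows: "\<And>r. r \<noteq> Suc d \<Longrightarrow> ar \<sigma>' 3 r = ar \<sigma> 3 r" and arr: "\<And>a. a \<noteq> 3 \<Longrightarrow> a \<noteq> 5 \<Longrightarrow> ar \<sigma>' a = ar \<sigma> a"
    and ou: "ou \<sigma>' = ou \<sigma>"
    and t: "tm \<sigma>' \<le> tm \<sigma> + 8 * (p' - p) + 20 * (\<Sum>i = h..<h'. live_deg X (qs' ! i) + 1) + 20 * (k + 2) + 30"
    and sl: "length ss < k - 1"
  shows "WP descend (completes d ss X \<sigma> (credit X ts qs h p q)) (tick \<sigma>')"
proof -
  let ?f = "ar \<sigma> 0" and ?g = "ar \<sigma> 1"
  define D where "D = {w. adj v w \<and> w \<notin> X}"
  let ?X = "insert v X" and ?ss = "ss @ [v]"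
  have const_regs': "const_regs \<sigma>'" using const_regs_same_except[OF const_regs sm] by auto
  have vts: "v \<in> set ts" using v(1) p'(2) ts(1) by simp
  then have vn: "v < n" "v \<notin> X" using ts(4) by auto
  have vss: "v \<notin> set ss" using qs'(1,2) ss_qs by auto
  have r1: "rg \<sigma>' 6 = length ss" "rg \<sigma>' 8 = Suc d" "rg \<sigma>' 7 = d" "rg \<sigma>' 12 = q"
    using sm s d q by (simp_all add: same_except_def)
  have kn: "length ss \<le> n" "length ?ss \<le> n" using sl k_le_n by simp_all
  have dB: "Suc d < B" "Suc (Suc d) < B" using Suc_d_le B_large by linarith+
  have cX: "card X \<le> n" using card_mono[OF _ X] by simp
  have cX': "card ?X = Suc (card X)" using vn X finite_subset by (metis card_insert_disjoint finite_lessThan)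
  have cXn: "Suc (card X) \<le> n" using card_mono[of "{..<n}" ?X] cX' X vn by simp
  have edl: "k \<le> degsum (set qs')"
  proof -
    have "qs' \<noteq> []" using qs'(4) k_ge_2 by auto
    then have "conn (set qs')" using prefix_conn_conn[OF qs'(7)] by simp
    then show ?thesis using degsum_ge_card[of "set qs'"] qs'(4,5) k_ge_2 by (simp add: distinct_card)
  qed
  show ?thesis unfolding descend_def wp_seq
  proof (rule wp_clear[where qs = qs'], goal_cases)
    case (7 \<sigma>1)
    have st1: "const_regs \<sigma>1" using const_regs_same_except[OF _ 7(1)] const_regs' by auto
    let ?\<sigma>2 = "setm 12 d 0 q (setm 11 d 0 (length ss) (setm 10 d 0 v \<sigma>1))"
    have r2: "rg \<sigma>1 6 = length ss" "rg \<sigma>1 8 = Suc d" "rg \<sigma>1 7 = d" "rg \<sigma>1 12 = q" "rg \<sigma>1 13 = v"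
      using r1 v(2) 7(1) by (simp_all add: same_except_def)
    have arr1: "ar \<sigma>1 a = ar \<sigma> a" if "a \<noteq> 3" "a \<noteq> 5" for a using 7(2) arr[of a] that by simp
    have "WP remove (WP (Atom (AAdd 7 7 1)) (WP (Atom (AAdd 8 8 1)) (WP (Atom (AConst 12 0))
        (WP reset (completes d ss X \<sigma> (credit X ts qs h p q)))))) ?\<sigma>2"
    proof (rule wp_remove[where v = v and X = X and D = D], goal_cases)
      case (7 \<sigma>3)
      note C = 7
      have st3: "const_regs \<sigma>3" using const_regs_same_except[OF _ C(1)] st1 by auto
      have r3: "rg \<sigma>3 6 = length ss" "rg \<sigma>3 8 = Suc d" "rg \<sigma>3 7 = d" "rg \<sigma>3 12 = q" "rg \<sigma>3 13 = v"
        using r2 C(1) by (simp_all add: same_except_def)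
      let ?\<sigma>4 = "setr 12 0 (setr 8 (Suc (Suc d)) (setr 7 (Suc d) \<sigma>3))"
      have "WP reset (completes d ss X \<sigma> (credit X ts qs h p q)) ?\<sigma>4"
      proof (rule wp_reset[where ss = ss], goal_cases)
        case (6 \<sigma>5)
        note E = 6
        have sm5: "same_except {7,8,9,10,11,12,13,17,18,19,20,21,22,23,24} \<sigma> \<sigma>5"
          using E(1) C(1) 7(1) \<open>same_except {18, 19, 21} (tick \<sigma>') \<sigma>1\<close> sm by (auto simp: same_except_def)
        have st5: "const_regs \<sigma>5" using const_regs_same_except[OF const_regs sm5] by auto
        have r5: "rg \<sigma>5 7 = Suc d" "rg \<sigma>5 8 = Suc (Suc d)" "rg \<sigma>5 12 = 0" using E(1) by (simp_all add: same_except_def)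
        have ar5: "ar \<sigma>5 a = ar \<sigma> a" if "a \<notin> {0,1,3,5,10,11,12}" for a
          using E(8)[of a] C(2) arr1[of a] that by simp
        have ar50: "ar \<sigma>5 0 = unlink D ?f ?g v" "ar \<sigma>5 1 = unlink D ?g ?f v"
          using E(8)[of 0] E(8)[of 1] C(2) arr1[of 0] arr1[of 1] by simp_all
        have arf: "ar \<sigma>5 10 = update2 (ar \<sigma> 10) d 0 v" "ar \<sigma>5 11 = update2 (ar \<sigma> 11) d 0 (length ss)"
          "ar \<sigma>5 12 = update2 (ar \<sigma> 12) d 0 q"
          using E(8)[of 10] E(8)[of 11] E(8)[of 12] C(2) arr1[of 10] arr1[of 11] arr1[of 12] by simp_all
        have row5: "ar \<sigma>5 3 r = ar \<sigma> 3 r" if "r < Suc d" for r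
          using E(7)[of r] C(2) \<open>ar \<sigma>1 = (ar (tick \<sigma>'))(5 := marks {})\<close> rows[of r] that by simp
        have row5': "ar \<sigma>5 3 (Suc d) i = qs' ! i" if "i < k" for i
          using E(7)[of "Suc d"] C(2) \<open>ar \<sigma>1 = (ar (tick \<sigma>'))(5 := marks {})\<close> row[of i] that qs'(4) by simp
        have row5'': "ar \<sigma>5 3 (Suc (Suc d)) i = ss ! i" if "i < length ss" for i
          using E(6)[OF that] by simp
        have t5: "tm \<sigma>5 \<le> tm \<sigma>' + 13 * k + 30 + 8 * live_deg X v"
          using E(10) C(4) \<open>tm \<sigma>1 \<le> tm (tick \<sigma>') + 6 * length qs' + 5\<close> sl qs'(4) by simp
        have ou5: "ou \<sigma>5 = ou \<sigma>" using E(9) C(3) \<open>ou \<sigma>1 = ou (tick \<sigma>')\<close> ou by simp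
        have node1: "node n k adj B ?X (Suc d) ss qs' ss 0 0 0 \<sigma>5"
        proof (rule node.intro[OF alg_axioms], rule node_axioms.intro)
          show "const_regs \<sigma>5" by fact
          show "adjacency_rep ?X (ar \<sigma>5 0) (ar \<sigma>5 1)"
            unfolding ar50 by (rule adjacency_rep_remove[OF adjacency_rep vn D_def])
          show "set ss \<subseteq> set qs'" using ss_qs qs'(1) by auto
          show "qs' ! 0 = ss ! 0" using qs(6) qs_ne qs'(1) by (simp add: nth_append)
          show "set ss \<subseteq> {..<n} - ?X" using vss ss_ts ts(4) by auto
          show "Suc d \<le> card ?X" using dX cX' by simp
          show "rg \<sigma>5 15 \<noteq> 0" using sm5 run by (simp add: same_except_def)
          show "rg \<sigma>5 14 = 0" using sm5 md by (simp add: same_except_def)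
          show "rg \<sigma>5 6 = length ss" using sm5 s(1) by (simp add: same_except_def)
          show "\<And>i. i < length ss \<Longrightarrow> ar \<sigma>5 4 i 0 = ss ! i" using ar5[of 4] ss_ar by simp
          show "ar \<sigma>5 6 = (\<lambda>_ _. 0)" using ar5[of 6] cnt0 by simp
          show "\<And>u w. u < n \<Longrightarrow> w < n \<Longrightarrow> ar \<sigma>5 2 u w = (if adj u w then 1 else 0)" using ar5[of 2] adj_ar by simp
        qed (use r5 E(2-5) row5' row5'' X vn s qs' in auto)
        have "remaining ?X ss 0 < remaining X ss q" unfolding remaining_def cX' using cXn by simp
        then have "completes (Suc d) ss ?X \<sigma>5 (credit ?X qs' ss 0 0 0) \<sigma>5" by (rule IH[OF node1])
        then obtain \<rho>1 ys1 where \<rho>1: "(\<sigma>5, \<rho>1) \<in> steps" "preserves (Suc d) (length ss) \<sigma>5 \<rho>1" "rg \<rho>1 14 = 1" "ar \<rho>1 5 = marks {}"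
          "ou \<rho>1 = ou \<sigma>5 @ ys1" "listing adj ys1 (completions (set ss) ?X)"
          "tm \<rho>1 + credit ?X qs' ss 0 0 0 \<le> tm \<sigma>5 + potential 1500 16 (set ss) ?X" unfolding completes_def by blast
        note K = \<rho>1(2)[unfolded preserves_def]
        have st6: "const_regs \<rho>1" using preserves_const_regs[OF \<rho>1(2) st5] .
        have r6: "rg \<rho>1 7 = Suc d" "rg \<rho>1 8 = Suc (Suc d)" "rg \<rho>1 15 \<noteq> 0" "rg \<rho>1 16 = rg \<sigma> 16" "rg \<rho>1 15 = rg \<sigma> 15"
          using K r5 sm5 run by (simp_all add: same_except_def)
        have fr6: "ar \<rho>1 10 d 0 = v" "ar \<rho>1 11 d 0 = length ss" "ar \<rho>1 12 d 0 = q"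
          using K arf by (simp_all add: update2_def)
        have ar6: "ar \<rho>1 0 = unlink D ?f ?g v" "ar \<rho>1 (Suc 0) = unlink D ?g ?f v" using K ar50 by simp_all
        have ar6': "ar \<rho>1 a = ar \<sigma> a" if "a \<in> {2,6,13}" for a using K ar5 that by auto
        have ar64: "ar \<rho>1 4 i = ar \<sigma> 4 i" if "i < length ss" for i using K ar5[of 4] that by simp
        have row6: "ar \<rho>1 3 r = ar \<sigma> 3 r" if "r < Suc d" for r using K row5 that by simp
        have fr6': "ar \<rho>1 a i = ar \<sigma> a i" if "a \<in> {10,11,12}" "i < d" for a i
        proof -
          have "ar \<rho>1 a i = ar \<sigma>5 a i" using K that by auto
          then show ?thesis using arf that by (auto simp: update2_def)
        qed
        \<comment> \<open>The excluding child has ended; the next iteration pops the frame and turns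
          it into the including child.\<close>
        have "WP frame_step (completes d ss X \<sigma> (credit X ts qs h p q)) (tick \<rho>1)"
        proof -
          let ?\<rho>2 = "setr 12 q (setr 6 (length ss) (setr 13 v (setr 8 (Suc d) (setr 7 d (tick (tick (tick \<rho>1)))))))"
          have "WP restore (WP (Atom (APut 4 6 0 13)) (WP (Atom (AAdd 6 6 1)) (WP (Atom (AConst 14 0))
              (WP reset (completes d ss X \<sigma> (credit X ts qs h p q)))))) ?\<rho>2"
          proof (rule wp_restore[where v = v and X = X and f = ?f and g = ?g and D = D], goal_cases)
            case (9 \<rho>3)
            note R = 9
            have st7: "const_regs \<rho>3" using const_regs_same_except[OF _ R(1)] st6 by auto
            let ?\<rho>4 = "setr 14 0 (setr 6 (Suc (length ss)) (setm 4 (length ss) 0 v \<rho>3))"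
            have r7: "rg \<rho>3 6 = length ss" "rg \<rho>3 13 = v" "rg \<rho>3 8 = Suc d" using R(1) by (simp_all add: same_except_def)
            have ss4: "ar ?\<rho>4 4 i 0 = ?ss ! i" if "i < Suc (length ss)" for i
              using that R(2) ar64[of i] ss_ar[of i] by (auto simp: update2_def nth_append less_Suc_eq)
            have ss4': "ar ?\<rho>4 4 i = ar \<sigma> 4 i" if "i < length ss" for i
              using that R(2) ar64[of i] by (auto simp: update2_def)
            have "WP reset (completes d ss X \<sigma> (credit X ts qs h p q)) ?\<rho>4"
            proof (rule wp_reset[where ss = ?ss], goal_cases)
              case (6 \<rho>5)
              note F = 6
              have st8: "const_regs \<rho>5" using const_regs_same_except[OF _ F(1)] st7 by auto
              have r8: "rg \<rho>5 6 = length ?ss" "rg \<rho>5 7 = d" "rg \<rho>5 8 = Suc d" "rg \<rho>5 12 = q" "rg \<rho>5 14 = 0"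
                 "rg \<rho>5 15 = rg \<sigma> 15" "rg \<rho>5 16 = rg \<sigma> 16"
                using F(1) R(1) r6 by (simp_all add: same_except_def)
              have ar8: "ar \<rho>5 a = ar \<sigma> a" if "a \<in> {0,1,2,6,13}" for a
                using F(8)[of a] R(2) ar6'[of a] that by auto
              have ar84: "ar \<rho>5 4 = ar ?\<rho>4 4" using F(8)[of 4] by simp
              have row8: "ar \<rho>5 3 r = ar \<sigma> 3 r" if "r < Suc d" for r
                using F(7)[of r] r7(3) R(2) row6 that by simp
              have row8': "ar \<rho>5 3 (Suc d) i = ?ss ! i" if "i < length ?ss" for i
                using F(6)[OF that] r7(3) by simp
              have fr8: "ar \<rho>5 a i = ar \<sigma> a i" if "a \<in> {10,11,12}" "i < d" for a i
                using F(8)[of a] R(2) fr6'[OF that] that by auto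
              have ou8: "ou \<rho>5 = ou \<sigma> @ ys1" using F(9) R(3) \<rho>1(5) ou5 by simp
              have t8: "tm \<rho>5 \<le> tm \<rho>1 + 7 * k + 25 + 8 * live_deg X v"
                using F(10) R(4) sl by simp
              have ph2: "q < 2 \<or> q = 2" using q(2) by linarith
              \<comment> \<open>The queue is S again and nothing is scanned, but \<open>q\<close>
                survives: \<open>q1\<close> and \<open>q2\<close> speak about the witness, and the
                vertex named by \<open>q1\<close> is still in S.\<close>
              have node2: "node n k adj B X d ?ss ts ?ss 0 0 q \<rho>5"
              proof (rule node.intro[OF alg_axioms], rule node_axioms.intro)
                show "const_regs \<rho>5" by fact
                show "adjacency_rep X (ar \<rho>5 0) (ar \<rho>5 1)" using ar8[of 0] ar8[of 1] adjacency_rep by simp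
                show "\<And>i. i < length ?ss \<Longrightarrow> ar \<rho>5 4 i 0 = ?ss ! i" using ss4 ar84 by simp
                show "ar \<rho>5 6 = (\<lambda>_ _. 0)" using ar8[of 6] cnt0 by simp
                show "\<And>u w. u < n \<Longrightarrow> w < n \<Longrightarrow> ar \<rho>5 2 u w = (if adj u w then 1 else 0)" using ar8[of 2] adj_ar by simp
                show "\<And>i. i < k \<Longrightarrow> ar \<rho>5 3 d i = ts ! i" using row8[of d] ts_ar by simp
                show "rg \<rho>5 15 \<noteq> 0" using r8(6) run by simp
                show "prefix_conn ?ss" "prefix_conn ?ss" using s(5) pa by (auto simp: prefix_conn_snoc)
                show "q = 1 \<Longrightarrow> closed X (set ts) \<or>
                   (\<exists>x \<in> set ?ss. \<exists>w. adj x w \<and> w \<notin> X \<and> w \<notin> set ts \<and> ((0::nat) = 0 \<or> x \<noteq> last ?ss))"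
                  using q1 by auto
              qed (use r8 F(2-5) row8' X dX vn vss vts s sl ss_ts ts q q2 in \<open>auto simp: nth_append\<close>)
              have "remaining X ?ss q < remaining X ss q" unfolding remaining_def using sl by simp
              then have "completes d ?ss X \<rho>5 (credit X ts ?ss 0 0 q) \<rho>5" by (rule IH[OF node2])
              then obtain \<rho> ys where \<rho>: "(\<rho>5, \<rho>) \<in> steps" "preserves d (Suc (length ss)) \<rho>5 \<rho>" "rg \<rho> 14 = 1" "ar \<rho> 5 = marks {}"
                "ou \<rho> = ou \<rho>5 @ ys" "listing adj ys (completions (insert v (set ss)) X)"
                "tm \<rho> + credit X ts ?ss 0 0 q \<le> tm \<rho>5 + potential 1500 16 (insert v (set ss)) X" unfolding completes_def by auto
              have "preserves d (length ss) \<sigma> \<rho>5"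
                unfolding preserves_def using ar8 row8 fr8 r8 ar84 ss4' const_regsD[OF st8] const_regsD[OF const_regs] d by auto
              then have kp: "preserves d (length ss) \<sigma> \<rho>" using preserves_trans[OF _ \<rho>(2)] by simp
              have li: "listing adj (ys1 @ ys) (completions (set ss) X)"
                unfolding completions_split(1)[of "set ss" X v] Un_commute[of "completions (insert v (set ss)) X"]
                using listing_append[OF \<rho>1(6) \<rho>(6)] completions_split(2)[of v "set ss" X] by (simp add: Int_commute)
              have dv: "live_deg X v \<le> (\<Sum>T \<in> completions (insert v (set ss)) X. deg_in v T)"
              proof (rule live_deg_le_completions)
                show "set ts \<in> completions (insert v (set ss)) X" using ts_completion vts by (auto simp: completions_def)
                show "conn (insert v (set ss))" using pa conn_insert[OF conn_ss] by blast
                have "card (insert v (set ss)) = Suc (length ss)" using vss s(4) by (simp add: distinct_card)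
                then show "card (insert v (set ss)) < k" using sl by simp
              qed
              have spl: "effort X qs h p + (p' - p) + (\<Sum>i = h..<h'. live_deg X (qs' ! i) + 1) \<le> degsum (set qs') + 4 * k"
              proof -
                have e1: "(\<Sum>i<h'. live_deg X (qs' ! i) + 1) = (\<Sum>i<h. live_deg X (qs ! i) + 1) + (\<Sum>i = h..<h'. live_deg X (qs' ! i) + 1)"
                proof -
                  have "{..<h'} = {..<h} \<union> {h..<h'}" using h'(1) by auto
                  then have "(\<Sum>i<h'. live_deg X (qs' ! i) + 1) = (\<Sum>i<h. live_deg X (qs' ! i) + 1) + (\<Sum>i = h..<h'. live_deg X (qs' ! i) + 1)"
                    by (metis (no_types, lifting) finite_atLeastLessThan finite_lessThan ivl_disj_int_one(2) sum.union_disjoint)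
                  also have "(\<Sum>i<h. live_deg X (qs' ! i) + 1) = (\<Sum>i<h. live_deg X (qs ! i) + 1)"
                    using h(2) qs'(1) by (intro sum.cong refl) (simp add: nth_append)
                  finally show ?thesis .
                qed
                have "effort X qs' h' p' \<le> degsum (set qs') + 4 * k"
                  using effort_le[OF qs'(5) h'(2), of p' X v] qs'(4) p'(2) h'(3) by simp
                moreover have "effort X qs h p + (p' - p) + (\<Sum>i = h..<h'. live_deg X (qs' ! i) + 1) \<le> effort X qs' h' p'"
                  unfolding effort_def e1 using qs'(1) p'(1) by simp
                ultimately show ?thesis by linarith
              qed
              have "tm \<rho> + credit X ts qs h p q \<le> tm \<sigma> + potential 1500 16 (set ss) X"
              proof -
                define A where "A = (\<Sum>i = h..<h'. live_deg X (qs' ! i) + 1)"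
                define DP where "DP = p' - p"
                define E1 where "E1 = degsum (set qs')"
                define Q1 where "Q1 = 300 * q * degsum (set ts)"
                define P1 where "P1 = potential 1500 16 (set ss) ?X"
                define P2 where "P2 = potential 1500 16 (insert v (set ss)) X"
                have c1: "credit ?X qs' ss 0 0 0 \<ge> 400 * E1" unfolding credit_def E1_def by simp
                have c2: "credit X ts ?ss 0 0 q \<ge> Q1 + 400 * degsum (set ts)" unfolding credit_def Q1_def by simp
                have c3: "credit X ts qs h p q = 50 * effort X qs h p + Q1 + 400 * degsum (set ts)" unfolding credit_def Q1_def by simp
                \<comment> \<open>8 per list entry for \<open>remove\<close> and 8 for
                  \<open>restore\<close>: the coefficient 16 in the potential.\<close>
                have P: "potential 1500 16 (set ss) X \<ge> P1 + P2 + 16 * live_deg X v"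
                  using potential_split[OF vss, of 1500 16 X] dv unfolding P1_def P2_def by simp
                have a1: "tm \<sigma>' + 50 * effort X qs h p \<le> tm \<sigma> + 50 * E1 + 220 * k + 70"
                proof -
                  have "8 * DP + 20 * A + 50 * effort X qs h p \<le> 50 * (effort X qs h p + DP + A)" by simp
                  also have "\<dots> \<le> 50 * (E1 + 4 * k)" using spl[folded A_def E1_def DP_def] by (rule mult_le_mono2)
                  finally show ?thesis using t[folded A_def DP_def] unfolding add_mult_distrib2 by linarith
                qed
                \<comment> \<open>Run, search, descent and return cost at most a constant times the
                  edges of the found set, by \<open>k <= E1\<close>. This determines the coefficient
                  400 in \<open>credit\<close>.\<close>
                have a2: "50 * E1 + 220 * k + 70 + 20 * k + 55 \<le> 400 * E1"
                  using edl[folded E1_def] k_ge_2 by linarith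
                have a3: "tm \<rho>1 + 400 * E1 + 50 * effort X qs h p + 7 * k + 25 \<le> tm \<sigma> + 400 * E1 + 8 * live_deg X v + P1"
                  using a1 a2 t5 c1 \<rho>1(7)[folded P1_def] by linarith
                have a4: "tm \<rho> + Q1 + 400 * degsum (set ts) \<le> tm \<rho>1 + 7 * k + 25 + 8 * live_deg X v + P2"
                  using t8 c2 \<rho>(7)[folded P2_def] by linarith
                show ?thesis using a3 a4 c3 P by linarith
              qed
              then show ?case unfolding completes_def using \<rho> kp ou8 li
                by (intro exI[of _ \<rho>] exI[of _ "ys1 @ ys"]) simp
            qed (use st7 r7 kn ss4 R(2) \<rho>1(4) in auto)
            moreover have "Suc (length ss) < B" using kn(1) B_large by linarith
            ultimately show ?case using const_regsD[OF st7] r7 by simp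
          qed (use st6 vn adjacency_rep D_def ar6 in auto)
          then show ?thesis unfolding frame_step_def ascend_def
            using \<rho>1(3) r6 fr6 const_regsD[OF st6] by simp
        qed
        then obtain \<sigma>9 where 9: "big_step n B inp frame_step (tick \<rho>1) \<sigma>9" "completes d ss X \<sigma> (credit X ts qs h p q) \<sigma>9"
          unfolding wp_def by blast
        have "(\<rho>1, \<sigma>9) \<in> loop_iteration n B inp 15 frame_step" using 9(1) r6(3) by (simp add: loop_iteration_def)
        then have "(\<sigma>5, \<sigma>9) \<in> steps" using \<rho>1(1) by (meson rtrancl.rtrancl_into_rtrancl)
        then show ?case using 9(2) unfolding completes_def by (meson rtrancl_trans)
      qed (use st3 r3 s kn ss_ar C(2) arr1 7(2) \<open>ar \<sigma>1 = (ar (tick \<sigma>'))(5 := marks {})\<close> in auto)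
      then show ?case using const_regsD[OF st3] r3 dB B_large by simp
    qed (use st1 r2 vn adjacency_rep arr1 D_def in auto)
    then show ?case using const_regsD[OF st1] r2 by simp
  qed (use const_regs' r1 qs' row mk k_le_n in auto)
qed

lemma completes_step:
  assumes IH: "\<And>X' d' ss' ts' qs' h' p' q' \<sigma>'. node n k adj B X' d' ss' ts' qs' h' p' q' \<sigma>' \<Longrightarrow>
      remaining X' ss' q' < remaining X ss q \<Longrightarrow> completes d' ss' X' \<sigma>' (credit X' ts' qs' h' p' q') \<sigma>'"
  shows "completes d ss X \<sigma> (credit X ts qs h p q) \<sigma>"
proof (cases "length ss = k - 1")
  case True
  then show ?thesis by (rule step_base)
next
  case False
  then have sl: "length ss < k - 1" using s(3) by simp
  show ?thesis
  proof (rule completes_iteration[OF _ run], rule wp_frame_step[OF sl], goal_cases)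
    case (1 \<sigma>')
    then show ?case using step_stuck[OF IH _ _ _ _ _ sl] by blast
  next
    case (2 \<sigma>' p' v qs' ms h')
    have const_regs': "const_regs \<sigma>'" using const_regs_same_except[OF const_regs 2(1)] by auto
    show ?case
    proof (cases "q < 2 \<and> length qs' = k")
      case True
      then have "rg \<sigma>' 17 = 0" using 2(25) by auto
      moreover have "WP descend (completes d ss X \<sigma> (credit X ts qs h p q)) (tick \<sigma>')"
        by (rule step_descend[OF IH 2(1,3,4,6,7,8,9,10,11) _ 2(13-23) _ sl]) (use True 2(24) in auto)
      ultimately show ?thesis by simp
    next
      case False
      have nz: "rg \<sigma>' 17 \<noteq> 0" using False 2(12,25) by auto
      have lk: "length qs' < k"
      proof (cases "q < 2")
        case True
        then show ?thesis using False 2(12) by simp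
      next
        case False
        then have "ms = []" "q = 2" using 2(25) by auto
        then have "qs' = ss" using phase 2(9) by auto
        then show ?thesis using sl by simp
      qed
      have "WP include_code (completes d ss X \<sigma> (credit X ts qs h p q)) (tick \<sigma>')"
        by (rule step_include[OF IH 2(1-11) lk 2(13-17) _ 2(18-23) _ _ sl]) (use lk 2(24,25) in auto)
      then show ?thesis using nz by simp
    qed
  qed
qed

end

lemma (in alg) completes_node:
  "node n k adj B X d ss ts qs h p q \<sigma> \<Longrightarrow> completes d ss X \<sigma> (credit X ts qs h p q) \<sigma>"
proof (induction "remaining X ss q" arbitrary: X d ss ts qs h p q \<sigma> rule: less_induct)
  case less
  interpret node n k adj B inp X d ss ts qs h p q \<sigma> by (rule less.prems)
  show ?case by (rule completes_step) (rule less.hyps)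
qed

section \<open>Input and roots\<close>

text \<open>A list under construction: the link back to the sentinel is missing until the last entry
  is known.\<close>

fun open_seg :: "(nat \<Rightarrow> nat) \<Rightarrow> (nat \<Rightarrow> nat) \<Rightarrow> nat \<Rightarrow> nat list \<Rightarrow> bool" where
  "open_seg f g a [] \<longleftrightarrow> True"
| "open_seg f g a (y # ys) \<longleftrightarrow> f a = y \<and> g y = a \<and> open_seg f g y ys"

lemma open_seg_snoc:
  "open_seg f g a ys \<Longrightarrow> distinct (ys @ [y]) \<Longrightarrow> a \<notin> set (ys @ [y]) \<Longrightarrow>
   open_seg (f(last (a # ys) := y)) (g(y := last (a # ys))) a (ys @ [y])"
proof (induction ys arbitrary: a)
  case (Cons x xs)
  have "last (x # xs) \<noteq> a" using Cons.prems(3) last_in_set[of "x # xs"] by fastforce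
  moreover have "open_seg (f(last (x # xs) := y)) (g(y := last (x # xs))) x (xs @ [y])"
    by (rule Cons.IH) (use Cons.prems in auto)
  moreover have "x \<noteq> y" using Cons.prems(2) by auto
  moreover have "(f(last (x # xs) := y)) a = x" "(g(y := last (x # xs))) x = a"
    using calculation Cons.prems(1) by auto
  moreover have "last (a # x # xs) = last (x # xs)" by simp
  ultimately show ?case by (simp only: append_Cons open_seg.simps)
qed simp

lemma open_seg_close:
  "open_seg f g a ys \<Longrightarrow> distinct ys \<Longrightarrow> a \<notin> set ys \<Longrightarrow> b \<notin> set ys \<Longrightarrow>
   seg (f(last (a # ys) := b)) (g(b := last (a # ys))) a ys b"
proof (induction ys arbitrary: a)
  case (Cons x xs)
  have "last (x # xs) \<noteq> a" using Cons.prems(3) last_in_set[of "x # xs"] by fastforce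
  moreover have "seg (f(last (x # xs) := b)) (g(b := last (x # xs))) x xs b"
    by (rule Cons.IH) (use Cons.prems in auto)
  moreover have "x \<noteq> b" using Cons.prems(4) by auto
  moreover have "(f(last (x # xs) := b)) a = x" "(g(b := last (x # xs))) x = a"
    using calculation Cons.prems(1) by auto
  moreover have "last (a # x # xs) = last (x # xs)" by simp
  ultimately show ?case by (simp only: seg.simps)
qed simp

definition read_list :: com where
  "read_list = Atom (AAdd 20 19 2) ;; Atom (AIn 21 20) ;; Atom (AAdd 20 20 1) ;; Atom (AIn 22 20) ;;
     Atom (AMove 23 3) ;; Atom (ASub 24 22 21) ;;
     WhileNZ 24 (Atom (AIn 25 21) ;; Atom (APut 0 19 23 25) ;; Atom (APut 1 19 25 23) ;; Atom (APut 2 19 25 1) ;;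
       Atom (AMove 23 25) ;; Atom (AAdd 21 21 1) ;; Atom (ASub 24 22 21)) ;;
     Atom (APut 0 19 23 3) ;; Atom (APut 1 19 3 23)"

definition setup_code :: com where
  "setup_code = Atom (AConst 1 1) ;; Atom (AConst 2 2) ;; Atom (AIn 3 0) ;; Atom (AIn 4 1) ;; Atom (ASub 5 4 1) ;;
     For 18 19 3 read_list"

text \<open>The search is reused with \<open>n\<close> as the skipped vertex, which is no vertex, so
  nothing is skipped. Its queue lies in row 0, where a node of depth 0 expects its witness.\<close>

definition root_probe :: com where
  "root_probe = Atom (APut 4 0 0 16) ;; Atom (AConst 6 1) ;; Atom (AConst 8 0) ;; Atom (APut 3 8 0 16) ;;
     Atom (APut 5 16 0 1) ;; Atom (AConst 9 1) ;; Atom (AConst 10 0) ;; Atom (AMove 13 3) ;; search ;;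
     Atom (ASub 17 4 9)"

definition root_dead :: com where
  "root_dead = For 18 19 9 (Atom (AGet 21 3 8 19) ;; Atom (APut 13 21 0 1)) ;; clear"

text \<open>The final \<open>remove\<close> is never undone: the solutions that contain this root
  are complete, and later roots must not find them again.\<close>

definition root_enter :: com where
  "root_enter = clear ;; Atom (AConst 7 0) ;; Atom (AConst 8 1) ;; Atom (AConst 12 0) ;; Atom (AConst 14 0) ;;
     Atom (AConst 15 1) ;; reset ;; WhileNZ 15 frame_step ;; Atom (AMove 13 16) ;; remove"

definition root_code :: com where
  "root_code = Atom (AGet 18 13 16 0) ;; IfNZ 18 Skip (root_probe ;; IfNZ 17 root_dead root_enter)"

definition main_code :: com where
  "main_code = setup_code ;; For 28 16 3 root_code"

section \<open>Roots and the solutions that contain them\<close>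

context alg
begin

definition hitting :: "nat set \<Rightarrow> nat set set" where
  "hitting X = {T. T \<subseteq> {..<n} \<and> card T = k \<and> conn T \<and> T \<inter> X \<noteq> {}}"

lemma finite_hitting [simp]: "finite (hitting X)"
  by (rule finite_subset[of _ "Pow {..<n}"]) (auto simp: hitting_def)

lemma hitting_insert: "hitting (insert r X) = hitting X \<union> completions {r} X" "hitting X \<inter> completions {r} X = {}"
  unfolding hitting_def completions_def by auto

text \<open>The vertices below j are processed: those in X have served as roots and are deleted, those in D lie
  in components with fewer than k vertices.\<close>

definition root_inv :: "nat \<Rightarrow> nat set \<Rightarrow> nat set \<Rightarrow> hstate \<Rightarrow> bool" where
  "root_inv j X D \<sigma> \<longleftrightarrow> const_regs \<sigma> \<and> adjacency_rep X (ar \<sigma> 0) (ar \<sigma> 1) \<and> (\<forall>u w. u < n \<longrightarrow> w < n \<longrightarrow> ar \<sigma> 2 u w = (if adj u w then 1 else 0)) \<and>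
     ar \<sigma> 5 = marks {} \<and> ar \<sigma> 6 = (\<lambda>_ _. 0) \<and> ar \<sigma> 13 = marks D \<and> X \<subseteq> {..<j} \<and> D \<subseteq> {..<n} \<and> {..<j} \<subseteq> X \<union> D \<and> D \<inter> X = {} \<and>
     (\<forall>x \<in> D. completions {x} X = {} \<and> (\<forall>y. adj x y \<longrightarrow> y \<notin> X \<longrightarrow> y \<in> D)) \<and> listing adj (ou \<sigma>) (hitting X) \<and>
     tm \<sigma> \<le> 8 * (\<Sum>u<n. live_deg {} u) + 13 * n + 12 + 100 * j + 40 * (\<Sum>u \<in> D. live_deg {} u + 1) + 8 * (\<Sum>u \<in> X. live_deg {} u) +
       1516 * (\<Sum>T \<in> hitting X. degsum T)"

lemma live_deg_le: "live_deg X u \<le> live_deg {} u"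
  unfolding live_deg_def by (intro card_mono) auto

lemma root_invD:
  assumes "root_inv j X D \<sigma>"
  shows "const_regs \<sigma>" "adjacency_rep X (ar \<sigma> 0) (ar \<sigma> (Suc 0))" "\<And>u w. u < n \<Longrightarrow> w < n \<Longrightarrow> ar \<sigma> 2 u w = (if adj u w then 1 else 0)"
    "ar \<sigma> 5 = marks {}" "ar \<sigma> 6 = (\<lambda>_ _. 0)" "ar \<sigma> 13 = marks D" "X \<subseteq> {..<j}" "D \<subseteq> {..<n}" "{..<j} \<subseteq> X \<union> D" "D \<inter> X = {}"
    "\<And>x. x \<in> D \<Longrightarrow> completions {x} X = {}" "\<And>x y. x \<in> D \<Longrightarrow> adj x y \<Longrightarrow> y \<notin> X \<Longrightarrow> y \<in> D" "listing adj (ou \<sigma>) (hitting X)"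
    "tm \<sigma> \<le> 8 * (\<Sum>u<n. live_deg {} u) + 13 * n + 12 + 100 * j + 40 * (\<Sum>u \<in> D. live_deg {} u + 1) + 8 * (\<Sum>u \<in> X. live_deg {} u) +
       1516 * (\<Sum>T \<in> hitting X. degsum T)"
  using assms unfolding root_inv_def One_nat_def by blast+

lemma wp_root_dead:
  assumes "const_regs \<sigma>" "rg \<sigma> 9 = length qs" "distinct qs" "length qs \<le> n"
    "\<And>i. i < length qs \<Longrightarrow> ar \<sigma> 3 (rg \<sigma> 8) i = qs ! i" "ar \<sigma> 5 = marks (set qs)" "ar \<sigma> 13 = marks D"
    "\<And>\<sigma>'. same_except {18,19,21} \<sigma> \<sigma>' \<Longrightarrow> ar \<sigma>' = (ar \<sigma>)(5 := marks {}, 13 := marks (D \<union> set qs)) \<Longrightarrow> ou \<sigma>' = ou \<sigma> \<Longrightarrow>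
       tm \<sigma>' \<le> tm \<sigma> + 12 * length qs + 8 \<Longrightarrow> Q \<sigma>'"
  shows "WP root_dead Q \<sigma>"
  unfolding root_dead_def wp_seq
proof (rule wp_For[where m = "length qs" and I = "\<lambda>j \<sigma>'. same_except {18,19,21} \<sigma> \<sigma>' \<and>
      ar \<sigma>' = (ar \<sigma>)(13 := marks (D \<union> set (take j qs))) \<and> ou \<sigma>' = ou \<sigma> \<and> tm \<sigma>' \<le> tm \<sigma> + 6 * j + 2"], goal_cases)
  case (10 j \<sigma>')
  have const_regs': "const_regs \<sigma>'" using const_regs_same_except[OF assms(1)] 10 by auto
  have "rg \<sigma>' 8 = rg \<sigma> 8" using 10 by (auto simp: same_except_def)
  then have q: "ar \<sigma>' 3 (rg \<sigma>' 8) j = qs ! j" using 10 assms(5)[of j] by simp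
  have d: "insert (qs ! j) (D \<union> set (take j qs)) = D \<union> set (take (Suc j) qs)"
    using 10(2) by (simp add: take_Suc_conv_app_nth)
  show ?case using 10 q d assms(4) const_regsD[OF const_regs'] by (simp add: update2_marks same_except_def)
next
  case (11 \<sigma>')
  have const_regs': "const_regs \<sigma>'" using const_regs_same_except[OF assms(1)] 11 by auto
  show ?case
  proof (rule wp_clear[where qs = qs], goal_cases)
    case (7 \<sigma>1)
    show ?case by (rule assms(8)) (use 7 11 in \<open>auto simp: same_except_def\<close>)
  qed (use 11 const_regs' assms in \<open>auto simp: same_except_def\<close>)
next
  case 9
  have "(ar \<sigma>)(13 := marks D) = ar \<sigma>" using assms(7) by (metis fun_upd_triv)
  then show ?case by (simp add: same_except_def)
qed (use assms const_regsD[OF assms(1)] less_B in \<open>auto simp: same_except_def\<close>)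

lemma wp_root_enter:
  assumes R: "root_inv r X D \<sigma>0" and r: "r < n" "r \<notin> X" "r \<notin> D" "rg \<sigma> 16 = r"
    and const_regs: "const_regs \<sigma>" and s6: "rg \<sigma> 6 = 1" "ar \<sigma> 4 0 0 = r" and r8: "rg \<sigma> 8 = 0"
    and qs: "rg \<sigma> 9 = length qs" "length qs = k" "distinct qs" "prefix_conn qs" "set qs \<subseteq> {..<n} - X" "qs ! 0 = r"
    and row: "\<And>i. i < length qs \<Longrightarrow> ar \<sigma> 3 0 i = qs ! i" and mk: "ar \<sigma> 5 = marks (set qs)"
    and arr: "\<And>a. a \<noteq> 3 \<Longrightarrow> a \<noteq> 4 \<Longrightarrow> a \<noteq> 5 \<Longrightarrow> ar \<sigma> a = ar \<sigma>0 a" and ou: "ou \<sigma> = ou \<sigma>0"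
    and t: "tm \<sigma> \<le> tm \<sigma>0 + 20 * degsum (set qs) + 60 * k + 70"
    and Q: "\<And>\<sigma>'. root_inv (Suc r) (insert r X) D \<sigma>' \<Longrightarrow> rg \<sigma>' 16 = r \<Longrightarrow> tm \<sigma>' + 14 \<le>
        8 * (\<Sum>u<n. live_deg {} u) + 13 * n + 12 + 100 * Suc r + 40 * (\<Sum>u \<in> D. live_deg {} u + 1) +
        8 * (\<Sum>u \<in> insert r X. live_deg {} u) + 1516 * (\<Sum>T \<in> hitting (insert r X). degsum T) \<Longrightarrow> Q \<sigma>'"
  shows "WP root_enter Q \<sigma>"
proof -
  note R' = root_invD[OF R]
  have rqs: "r \<in> set qs" using qs(2,6) k_ge_2 nth_mem[of 0 qs] by auto
  have Xn: "X \<subseteq> {..<n}" using R'(7) r(1) by auto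
  have finX: "finite X" using Xn finite_subset by blast
  have B1: "1 < B" "2 < B" using B_large by auto
  have qsne: "qs \<noteq> []" using qs(2) k_ge_2 by auto
  have edk: "k \<le> degsum (set qs)"
    using degsum_ge_card[OF prefix_conn_conn[OF qs(4) qsne]] qs(2,3) k_ge_2 by (simp add: distinct_card)
  show ?thesis unfolding root_enter_def wp_seq
  proof (rule wp_clear[where qs = qs], goal_cases)
    case (7 \<sigma>1)
    have st1: "const_regs \<sigma>1" using const_regs_same_except[OF const_regs 7(1)] by auto
    have ar1: "ar \<sigma>1 a = ar \<sigma> a" if "a \<noteq> 5" for a using 7(2) that by simp
    let ?\<sigma>2 = "setr 15 1 (setr 14 0 (setr 12 0 (setr 8 1 (setr 7 0 \<sigma>1))))"
    have "WP reset (WP (WhileNZ 15 frame_step) (WP (Atom (AMove 13 16)) (WP remove Q))) ?\<sigma>2"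
    proof (rule wp_reset[where ss = "[r]"], goal_cases)
      case (6 \<sigma>3)
      have r3: "rg \<sigma>3 16 = r" "rg \<sigma>3 6 = 1" "rg \<sigma>3 7 = 0" "rg \<sigma>3 8 = 1" "rg \<sigma>3 12 = 0" "rg \<sigma>3 14 = 0" "rg \<sigma>3 15 = 1"
        using 6(1) 7(1) r(4) s6(1) by (simp_all add: same_except_def)
      have st3: "const_regs \<sigma>3" using const_regs_same_except[OF _ 6(1)] st1 by auto
      have ar3: "ar \<sigma>3 a = ar \<sigma>0 a" if "a \<noteq> 3" "a \<noteq> 4" "a \<noteq> 5" for a using 6(8)[of a] ar1[of a] arr[of a] that by simp
      have ar34: "ar \<sigma>3 4 0 0 = r" using 6(8)[of 4] ar1[of 4] s6(2) by simp
      have node: "node n k adj B X 0 [r] qs [r] 0 0 0 \<sigma>3"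
      proof (rule node.intro[OF alg_axioms], rule node_axioms.intro)
        show "adjacency_rep X (ar \<sigma>3 0) (ar \<sigma>3 1)" using ar3[of 0] ar3[of 1] R'(2) by simp
        show "\<And>u w. u < n \<Longrightarrow> w < n \<Longrightarrow> ar \<sigma>3 2 u w = (if adj u w then 1 else 0)" using ar3[of 2] R'(3) by simp
        show "ar \<sigma>3 6 = (\<lambda>_ _. 0)" using ar3[of 6] R'(5) by simp
        show "\<And>i. i < k \<Longrightarrow> ar \<sigma>3 3 0 i = qs ! i" using 6(7)[of 0] ar1[of 3] row qs(2) by simp
        show "\<And>i. i < length [r] \<Longrightarrow> ar \<sigma>3 3 (Suc 0) i = [r] ! i" using 6(6) by simp
        show "length [r] \<le> k - 1" "length [r] \<le> k" using k_ge_2 by simp_all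
      qed (use st3 r3 6(2-5) ar34 r qs rqs Xn in auto)
      obtain \<rho> ys where \<rho>: "(\<sigma>3, \<rho>) \<in> steps" "preserves 0 (length [r]) \<sigma>3 \<rho>" "rg \<rho> 14 = 1" "ar \<rho> 5 = marks {}"
        "ou \<rho> = ou \<sigma>3 @ ys" "listing adj ys (completions (set [r]) X)"
        "tm \<rho> + credit X qs [r] 0 0 0 \<le> tm \<sigma>3 + potential 1500 16 (set [r]) X"
        using completes_node[OF node] unfolding completes_def by blast
      note K = \<rho>(2)[unfolded preserves_def]
      have st4: "const_regs \<rho>" using preserves_const_regs[OF \<rho>(2) st3] .
      have r4: "rg \<rho> 7 = 0" "rg \<rho> 15 = 1" "rg \<rho> 16 = r" using K r3 by simp_all
      let ?\<rho>1 = "setr 15 0 (tick (tick (tick \<rho>)))"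
      \<comment> \<open>At depth 0 there is no frame to pop; \<open>ascend\<close> clears register
        15, which ends the loop.\<close>
      have "WP frame_step (\<lambda>s. s = ?\<rho>1) (tick \<rho>)" unfolding frame_step_def ascend_def using \<rho>(3) r4 B_large by simp
      then have "big_step n B inp frame_step (tick \<rho>) ?\<rho>1" by (simp add: wp_def)
      then have "(\<rho>, ?\<rho>1) \<in> loop_iteration n B inp 15 frame_step" using r4 by (simp add: loop_iteration_def)
      then have "(\<sigma>3, ?\<rho>1) \<in> steps" using \<rho>(1) by (meson rtrancl.rtrancl_into_rtrancl)
      then have wh: "big_step n B inp (WhileNZ 15 frame_step) \<sigma>3 (tick ?\<rho>1)" by (rule while_of_iterations) simp
      have "WP (Atom (AMove 13 16)) (WP remove Q) (tick ?\<rho>1)"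
      proof -
        have "WP remove Q (setr 13 r (tick ?\<rho>1))"
        proof (rule wp_remove[where v = r and X = X and D = "{w. adj r w \<and> w \<notin> X}"], goal_cases)
          case (7 \<sigma>5)
          have st5: "const_regs \<sigma>5" using const_regs_same_except[OF _ 7(1)] st4 by auto
          have r5: "rg \<sigma>5 16 = r" using 7(1) r4 by (simp add: same_except_def)
          have arr4: "ar \<rho> a = ar \<sigma>0 a" if "a \<in> {0,1,2,6,13}" for a using K ar3 that by auto
          have l5: "adjacency_rep (insert r X) (ar \<sigma>5 0) (ar \<sigma>5 1)"
            using 7(2) adjacency_rep_remove[of X "ar \<rho> 0" "ar \<rho> 1" r "{w. adj r w \<and> w \<notin> X}"] arr4[of 0] arr4[of 1] R'(2) r by simp
          have ou5: "listing adj (ou \<sigma>5) (hitting (insert r X))"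
          proof -
            have "ou \<sigma>5 = ou \<sigma>0 @ ys" using 7(3) \<rho>(5) 6(9) \<open>ou \<sigma>1 = ou \<sigma>\<close> ou by simp
            then show ?thesis unfolding hitting_insert(1) using listing_append[OF _ \<rho>(6), of "ou \<sigma>0" "hitting X"] R'(13) hitting_insert(2) by simp
          qed
          have hs: "(\<Sum>T \<in> hitting (insert r X). degsum T) = (\<Sum>T \<in> hitting X. degsum T) + (\<Sum>T \<in> completions {r} X. degsum T)"
            unfolding hitting_insert(1) by (rule sum.union_disjoint) (simp_all add: hitting_insert(2))
          have ds: "(\<Sum>u \<in> insert r X. live_deg {} u) = live_deg {} r + (\<Sum>u \<in> X. live_deg {} u)"
            using finX r(2) by simp
          \<comment> \<open>1516 = 1500 + 16: the sum of degrees over a part of a solution is at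
            most its degree sum.\<close>
          have ph: "potential 1500 16 {r} X \<le> 1516 * (\<Sum>T \<in> completions {r} X. degsum T)"
            using potential_upper[of 1500 16 "{r}" X] by simp
          have c: "400 * degsum (set qs) \<le> credit X qs [r] 0 0 0" unfolding credit_def by simp
          have t5: "tm \<sigma>5 + 14 \<le> 8 * (\<Sum>u<n. live_deg {} u) + 13 * n + 12 + 100 * Suc r + 40 * (\<Sum>u \<in> D. live_deg {} u + 1) +
              8 * (\<Sum>u \<in> insert r X. live_deg {} u) + 1516 * (\<Sum>T \<in> hitting (insert r X). degsum T)"
          proof -
            have a: "tm \<sigma>3 \<le> tm \<sigma>0 + 20 * degsum (set qs) + 66 * k + 100"
              using 6(10) \<open>tm \<sigma>1 \<le> tm \<sigma> + 6 * length qs + 5\<close> qs(2) t by simp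
            have b: "tm \<sigma>5 \<le> tm \<rho> + 20 + 8 * live_deg {} r" using 7(4) live_deg_le[of X r] by simp
            have c': "tm \<rho> + 400 * degsum (set qs) \<le> tm \<sigma>3 + 1516 * (\<Sum>T \<in> completions {r} X. degsum T)"
              using \<rho>(7) c ph by simp
            \<comment> \<open>The credit of the first node pays for the search that found its
              witness at the root, as the credit of an excluding child does for the search in its
              parent.\<close>
            have d: "20 * degsum (set qs) + 66 * k + 100 + 34 \<le> 400 * degsum (set qs)" using edk k_ge_2 by linarith
            have e: "tm \<sigma>5 + 14 \<le> tm \<sigma>0 + 1516 * (\<Sum>T \<in> completions {r} X. degsum T) + 8 * live_deg {} r"
              using a b c' d by linarith
            show ?thesis unfolding hs ds add_mult_distrib2 using e R'(14) by simp
          qed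
          have Dcl: "\<forall>x\<in>D. completions {x} (insert r X) = {} \<and> (\<forall>y. adj x y \<longrightarrow> y \<notin> insert r X \<longrightarrow> y \<in> D)"
          proof (intro ballI conjI)
            fix x assume x: "x \<in> D"
            have "completions {x} (insert r X) \<subseteq> completions {x} X" unfolding completions_def by auto
            then show "completions {x} (insert r X) = {}" using R'(11)[OF x] by auto
            show "\<forall>y. adj x y \<longrightarrow> y \<notin> insert r X \<longrightarrow> y \<in> D" using R'(12)[OF x] by auto
          qed
          have "root_inv (Suc r) (insert r X) D \<sigma>5"
          proof -
            have "ar \<sigma>5 2 = ar \<sigma>0 2" "ar \<sigma>5 6 = ar \<sigma>0 6" "ar \<sigma>5 13 = ar \<sigma>0 13" "ar \<sigma>5 5 = marks {}"
              using 7(2) arr4 \<rho>(4) by simp_all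
            moreover have "insert r X \<subseteq> {..<Suc r}" "{..<Suc r} \<subseteq> insert r X \<union> D" "D \<inter> insert r X = {}"
              using R'(7,9,10) r(3) by (auto simp: lessThan_Suc)
            ultimately show ?thesis unfolding root_inv_def using st5 l5 ou5 t5 Dcl R'(3,5,6,8) by simp
          qed
          then show ?case using Q r5 t5 by blast
        qed (use st4 r4 r K ar3[of 0] ar3[of 1] R'(2) in simp_all)
        then show ?thesis using r4 by simp
      qed
      then show ?case using wh unfolding wp_def by blast
    qed (use st1 7 r s6 ar1 k_le_n k_ge_2 in \<open>auto simp: same_except_def\<close>)
    then show ?case using B1 B_large by simp
  qed (use const_regs qs row mk r8 k_le_n in auto)
qed

abbreviation "root_bound j X D \<equiv> 8 * (\<Sum>u<n. live_deg {} u) + 13 * n + 12 + 100 * j + 40 * (\<Sum>u \<in> D. live_deg {} u + 1) +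
   8 * (\<Sum>u \<in> X. live_deg {} u) + 1516 * (\<Sum>T \<in> hitting X. degsum T)"

lemma root_inv_shift: "root_inv j X D \<sigma> \<Longrightarrow> tm \<sigma> + 2 \<le> root_bound j X D \<Longrightarrow> root_inv j X D (setr 28 a (setr 16 b \<sigma>))"
  unfolding root_inv_def by simp

lemma sum_nth_set: "distinct xs \<Longrightarrow> (\<Sum>i<length xs. f (xs ! i)) = sum f (set xs)" for f :: "nat \<Rightarrow> nat"
  by (simp add: sum.distinct_set_conv_list sum_list_sum_nth atLeast0LessThan)

lemma wp_root:
  assumes R: "root_inv r X D \<sigma>" and r: "r < n" "rg \<sigma> 16 = r"
    and Q: "\<And>\<sigma>' X' D'. root_inv (Suc r) X' D' \<sigma>' \<Longrightarrow> rg \<sigma>' 16 = r \<Longrightarrow> tm \<sigma>' + 14 \<le> root_bound (Suc r) X' D' \<Longrightarrow> Q \<sigma>'"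
  shows "WP root_code Q (tick \<sigma>)"
proof -
  note R' = root_invD[OF R]
  have rX: "r \<notin> X" using R'(7) by auto
  have rn: "r \<le> n" using r by simp
  show ?thesis
  proof (cases "r \<in> D")
    case True
    let ?\<sigma>1 = "tick (setr 18 1 (tick \<sigma>))"
    have "root_inv (Suc r) X D ?\<sigma>1"
      using R True unfolding root_inv_def by (auto simp: lessThan_Suc)
    moreover have "tm ?\<sigma>1 + 14 \<le> root_bound (Suc r) X D" using R'(14) by simp
    ultimately have "Q ?\<sigma>1" using Q r by simp
    then show ?thesis unfolding root_code_def using R'(1,6) r True const_regsD[OF R'(1)] by (simp add: marks_def)
  next
    case False
    let ?\<sigma>1 = "setr 13 n (setr 10 0 (setr 9 1 (setm 5 r 0 1 (setm 3 0 0 r (setr 8 0 (setr 6 1 (setm 4 0 0 r (tick (setr 18 0 (tick \<sigma>))))))))))"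
    have rr: "r \<in> {..<n} - X" using r rX by simp
    have "WP search (WP (Atom (ASub 17 4 9)) (WP (IfNZ 17 root_dead root_enter) Q)) ?\<sigma>1"
    proof (rule wp_search[where v = n and R = 0 and X = X and qs = "[r]" and h = 0], goal_cases)
      case (19 \<sigma>2 more h')
      note S = 19
      let ?qs = "[r] @ more"
      have st2: "const_regs \<sigma>2" using const_regs_same_except[OF _ S(1)] R'(1) by auto
      have r2: "rg \<sigma>2 16 = r" "rg \<sigma>2 6 = 1" "rg \<sigma>2 8 = 0" using S(1) r by (simp_all add: same_except_def)
      have ar2: "ar \<sigma>2 a = ar \<sigma> a" if "a \<noteq> 3" "a \<noteq> 4" "a \<noteq> 5" for a using S(15)[of a] that by simp
      have ar24: "ar \<sigma>2 4 0 0 = r" using S(15)[of 4] by (simp add: update2_def)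
      have ndx: "y \<noteq> n" if "adj x y" for x y using adj_less'[OF that] by simp
      show ?case
      proof (cases "length ?qs < k")
        case True
        have h': "h' = length ?qs" using S(11) True by simp
        have ln: "length ?qs \<le> n" using True k_le_n by linarith
        have cl: "y \<in> set ?qs" if "x \<in> set ?qs" "adj x y" "y \<notin> X" for x y
        proof -
          obtain i where "i < h'" "?qs ! i = x" using \<open>x \<in> set ?qs\<close> unfolding h' in_set_conv_nth by blast
          then show ?thesis using S(10)[of i y] that ndx[OF that(2)] by auto
        qed
        \<comment> \<open>\<open>D\<close> is closed outside \<open>X\<close> and does not contain
          \<open>r\<close>. If a later queue element were in \<open>D\<close>, so would be its
          earlier neighbour. Hence each small component is explored only once and pays for
          itself.\<close>
        have nD: "?qs ! i \<notin> D" if "i < length ?qs" for i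
          using that
        proof (induction i rule: less_induct)
          case (less i)
          show ?case
          proof (cases "i = 0")
            case True
            then show ?thesis using False by simp
          next
            case i0: False
            then obtain j where j: "j < i" "adj (?qs ! j) (?qs ! i)" using S(7) less.prems by (auto simp: prefix_conn_def)
            have "?qs ! j \<in> set ?qs" using j(1) less.prems by (intro nth_mem) simp
            then have "?qs ! j \<notin> X" using S(5) by auto
            then show ?thesis using less.IH[OF j(1)] j less.prems R'(12)[OF _ adj_sym[OF j(2)]] by auto
          qed
        qed
        then have dj: "D \<inter> set ?qs = {}" by (metis disjoint_iff in_set_conv_nth)
        have cq: "card (set ?qs) < k" using True S(4) by (metis distinct_card)
        have "WP root_dead Q (tick (setr 17 (k - length ?qs) \<sigma>2))"
        proof (rule wp_root_dead[where qs = ?qs and D = D], goal_cases)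
          case (8 \<sigma>3)
          let ?D = "D \<union> set ?qs"
          have st3: "const_regs \<sigma>3" using const_regs_same_except[OF _ 8(1)] st2 by auto
          have r3: "rg \<sigma>3 16 = r" using 8(1) r2 by (simp add: same_except_def)
          have Ds: "(\<Sum>u \<in> ?D. live_deg {} u + 1) = (\<Sum>u \<in> D. live_deg {} u + 1) + (\<Sum>u \<in> set ?qs. live_deg {} u + 1)"
            using dj R'(8) finite_subset by (intro sum.union_disjoint) auto
          have dle: "(\<Sum>i = 0..<h'. live_deg X (?qs ! i) + 1) \<le> (\<Sum>u \<in> set ?qs. live_deg {} u + 1)"
          proof -
            have "(\<Sum>i = 0..<h'. live_deg X (?qs ! i) + 1) = (\<Sum>u \<in> set ?qs. live_deg X u + 1)"
              unfolding h' atLeast0LessThan by (rule sum_nth_set[OF S(4)])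
            also have "\<dots> \<le> (\<Sum>u \<in> set ?qs. live_deg {} u + 1)" by (intro sum_mono) (simp add: live_deg_le)
            finally show ?thesis .
          qed
          have lle: "length ?qs \<le> (\<Sum>u \<in> set ?qs. live_deg {} u + 1)"
          proof -
            have "length ?qs = card (set ?qs)" using S(4) by (metis distinct_card)
            also have "\<dots> = (\<Sum>u \<in> set ?qs. 1)" by simp
            also have "\<dots> \<le> (\<Sum>u \<in> set ?qs. live_deg {} u + 1)" by (intro sum_mono) simp
            finally show ?thesis .
          qed
          have t3: "tm \<sigma>3 + 14 \<le> root_bound (Suc r) X ?D"
          proof -
            define A where "A = (\<Sum>u \<in> set ?qs. live_deg {} u + 1)"
            have "tm \<sigma>3 \<le> tm \<sigma> + 20 * A + 12 * A + 40"
              using 8(4) S(17) dle[folded A_def] lle[folded A_def] True by simp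
            then show ?thesis unfolding Ds A_def[symmetric] add_mult_distrib2 using R'(14) by simp
          qed
          have ar3: "ar \<sigma>3 a = ar \<sigma> a" if "a \<notin> {3,4,5,13}" for a using 8(2) ar2[of a] that by simp
          have "root_inv (Suc r) X ?D \<sigma>3"
            unfolding root_inv_def
          proof (intro conjI)
            show "adjacency_rep X (ar \<sigma>3 0) (ar \<sigma>3 1)" using ar3[of 0] ar3[of 1] R'(2) by simp
            show "\<forall>u w. u < n \<longrightarrow> w < n \<longrightarrow> ar \<sigma>3 2 u w = (if adj u w then 1 else 0)" using ar3[of 2] R'(3) by simp
            show "ar \<sigma>3 5 = marks {}" "ar \<sigma>3 13 = marks ?D" using 8(2) by simp_all
            show "ar \<sigma>3 6 = (\<lambda>_ _. 0)" using ar3[of 6] R'(5) by simp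
            show "X \<subseteq> {..<Suc r}" "{..<Suc r} \<subseteq> X \<union> ?D" using R'(7,9) by (auto simp: lessThan_Suc)
            show "?D \<subseteq> {..<n}" "?D \<inter> X = {}" using R'(8,10) S(5) by auto
            show "\<forall>x \<in> ?D. completions {x} X = {} \<and> (\<forall>y. adj x y \<longrightarrow> y \<notin> X \<longrightarrow> y \<in> ?D)"
            proof
              fix x assume "x \<in> ?D"
              then consider "x \<in> D" | "x \<in> set ?qs" by blast
              then show "completions {x} X = {} \<and> (\<forall>y. adj x y \<longrightarrow> y \<notin> X \<longrightarrow> y \<in> ?D)"
              proof cases
                case 1
                then show ?thesis using R'(11,12) by blast
              next
                case 2
                have "completions {x} X = {}" by (rule completions_empty[of _ "set ?qs"]) (use 2 cq cl in auto)
                then show ?thesis using cl 2 by blast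
              qed
            qed
            show "listing adj (ou \<sigma>3) (hitting X)" using 8(3) S(16) R'(13) by simp
            show "tm \<sigma>3 \<le> root_bound (Suc r) X ?D" using t3 by linarith
          qed (rule st3)
          then show ?case using Q r3 t3 by blast
        qed (use st2 S(2,4,12,13) r2 ln ar2 R'(6) in \<open>auto simp del: append_Cons append_Nil\<close>)
        then show ?thesis using S(2) const_regsD[OF st2] True by simp
      next
        case lk: False
        then have lq: "length ?qs = k" using S(3) by simp
        have ct: "tm \<sigma>2 + 10 \<le> tm \<sigma> + 20 * degsum (set ?qs) + 60 * k + 70"
        proof -
          have "(\<Sum>i<h'. live_deg X (?qs ! i)) \<le> degsum (set ?qs) + h'"
            by (rule sum_live_deg_le[OF S(4,9)]) (rule S(10))
          moreover have "(\<Sum>i = 0..<h'. live_deg X (?qs ! i) + 1) = (\<Sum>i<h'. live_deg X (?qs ! i)) + h'"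
            by (simp add: atLeast0LessThan sum_Suc)
          ultimately have "(\<Sum>i = 0..<h'. live_deg X (?qs ! i) + 1) \<le> degsum (set ?qs) + 2 * k" using S(9) lq by simp
          then show ?thesis using S(17) lk by simp
        qed
        have "WP root_enter Q (tick (setr 17 0 \<sigma>2))"
          by (rule wp_root_enter[where qs = ?qs, OF R r(1) rX False])
            (use r2 st2 ar24 S(2,4,5,7,12,13,16) lq ar2 ct Q in \<open>auto simp del: append_Cons append_Nil simp: nth_append\<close>)
        then show ?thesis using S(2) const_regsD[OF st2] lq by simp
      qed
    qed (use R' rr r update2_marks[of "{}"] k_ge_2 in \<open>auto simp: update2_def marks_def dest: adj_less\<close>)
    moreover have "ar \<sigma> 13 r 0 = 0" using R'(6) False by (simp add: marks_def)
    ultimately show ?thesis unfolding root_code_def root_probe_def using const_regsD[OF R'(1)] r B_large rn by simp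
  qed
qed

end

section \<open>Reading the adjacency lists\<close>

locale input = alg +
  fixes al :: "nat list list"
  assumes al_len: "length al = n"
    and al_adj: "\<And>v. v < n \<Longrightarrow> distinct (al ! v) \<and> set (al ! v) = {w. adj v w}"
    and inp: "inp = encode_input k al"
begin

definition off :: "nat \<Rightarrow> nat" where
  "off v = n + 3 + length (concat (take v al))"

lemma inp_header: "inp ! 0 = n" "inp ! Suc 0 = k"
  unfolding inp encode_input_def using al_len by simp_all

lemma inp_off: "v \<le> n \<Longrightarrow> inp ! Suc (Suc v) = off v"
  unfolding inp encode_input_def off_def using al_len by (simp add: nth_append del: upt_Suc)

lemma inp_length: "length inp = off n"
  unfolding inp encode_input_def off_def using al_len by simp

lemma off_Suc: "v < n \<Longrightarrow> off (Suc v) = off v + length (al ! v)"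
  unfolding off_def using al_len by (simp add: take_Suc_conv_app_nth)

lemma off_mono: "v \<le> n \<Longrightarrow> off v \<le> off n"
proof -
  have "concat al = concat (take v al) @ concat (drop v al)"
    by (metis append_take_drop_id concat_append)
  then show ?thesis unfolding off_def using al_len by simp
qed

lemma inp_entry: "v < n \<Longrightarrow> i < length (al ! v) \<Longrightarrow> inp ! (off v + i) = al ! v ! i"
proof -
  assume v: "v < n" and i: "i < length (al ! v)"
  have "al = take v al @ (al ! v) # drop (Suc v) al" using v al_len by (simp add: id_take_nth_drop)
  then have c: "concat al = concat (take v al) @ al ! v @ concat (drop (Suc v) al)"
    by (metis concat.simps(2) concat_append)
  have "inp ! (off v + i) = concat al ! (length (concat (take v al)) + i)"
    unfolding inp encode_input_def off_def using al_len by (simp add: nth_append del: upt_Suc)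
  also have "\<dots> = al ! v ! i" unfolding c using i by (simp add: nth_append)
  finally show ?thesis .
qed

lemma al_len_deg: "v < n \<Longrightarrow> length (al ! v) = live_deg {} v"
  unfolding live_deg_def using al_adj distinct_card[of "al ! v"] by simp

lemma al_bd: "v < n \<Longrightarrow> w \<in> set (al ! v) \<Longrightarrow> w < n"
  using al_adj adj_less' by simp

lemma off_bd: "off n \<le> n * n + 3"
proof -
  have "length (al ! v) \<le> n - 1" if v: "v < n" for v
  proof -
    have "set (al ! v) \<subseteq> {..<n} - {v}" using al_adj[OF v] al_bd[OF v] adj_irrefl by auto
    then have "card (set (al ! v)) \<le> card ({..<n} - {v})" by (intro card_mono) auto
    moreover have "card (set (al ! v)) = length (al ! v)" using al_adj[OF v] distinct_card by blast
    ultimately show ?thesis using v by simp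
  qed
  then have "off v \<le> n + 3 + v * (n - 1)" if "v \<le> n" for v
    using that
  proof (induction v)
    case 0
    then show ?case by (simp add: off_def)
  next
    case (Suc v)
    then have "length (al ! v) \<le> n - 1" "off v \<le> n + 3 + v * (n - 1)" "off (Suc v) = off v + length (al ! v)"
      using off_Suc by auto
    then show ?case by simp
  qed
  from this[of n] have "off n \<le> n + 3 + n * (n - 1)" by simp
  moreover have "n + n * (n - 1) = n * n" using k_ge_2 k_le_n by (cases n) auto
  ultimately show ?thesis by linarith
qed

lemma off_n_bd: "v \<le> n \<Longrightarrow> off v < B"
  using off_mono[of v] off_bd B_large by linarith

definition row_ok :: "hstate \<Rightarrow> nat \<Rightarrow> bool" where
  "row_ok \<sigma> u \<longleftrightarrow> seg (ar \<sigma> 0 u) (ar \<sigma> 1 u) n (al ! u) n \<and> (\<forall>w. ar \<sigma> 2 u w = (if w \<in> set (al ! u) then 1 else 0))"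

text \<open>Only ones are written to the matrix; its zeros are initial memory. So a row costs the
  degree of its vertex and not \<open>n\<close>.\<close>

lemma wp_read_list:
  assumes "const_regs \<sigma>" "rg \<sigma> 19 = u" "u < n" "\<forall>w. ar \<sigma> 2 u w = 0"
    "\<And>\<sigma>'. same_except {20,21,22,23,24,25} \<sigma> \<sigma>' \<Longrightarrow> row_ok \<sigma>' u \<Longrightarrow>
       (\<And>a r. a \<le> 2 \<Longrightarrow> r \<noteq> u \<Longrightarrow> ar \<sigma>' a r = ar \<sigma> a r) \<Longrightarrow> (\<And>a. 2 < a \<Longrightarrow> ar \<sigma>' a = ar \<sigma> a) \<Longrightarrow>
       ou \<sigma>' = ou \<sigma> \<Longrightarrow> tm \<sigma>' \<le> tm \<sigma> + 8 * live_deg {} u + 9 \<Longrightarrow> Q \<sigma>'"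
  shows "WP read_list Q \<sigma>"
proof -
  let ?ys = "al ! u"
  have ys: "distinct ?ys" "set ?ys = {w. adj u w}" "set ?ys \<subseteq> {..<n}" "n \<notin> set ?ys"
    using al_adj[OF assms(3)] al_bd[OF assms(3)] by auto
  let ?lst = "\<lambda>j. last (n # take j ?ys)"
  have un: "Suc u \<le> n" using assms(3) by simp
  have ofs: "off (Suc u) = off u + length ?ys" using off_Suc[OF assms(3)] .
  have ofl: "off (Suc u) \<le> length inp" using off_mono[OF un] inp_length by simp
  define P where "P j \<sigma>' \<longleftrightarrow> same_except {20,21,22,23,24,25} \<sigma> \<sigma>' \<and> rg \<sigma>' 21 = off u + j \<and> rg \<sigma>' 22 = off (Suc u) \<and>
     rg \<sigma>' 23 = ?lst j \<and> rg \<sigma>' 24 = length ?ys - j \<and> open_seg (ar \<sigma>' 0 u) (ar \<sigma>' 1 u) n (take j ?ys) \<and>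
     (\<forall>w. ar \<sigma>' 2 u w = (if w \<in> set (take j ?ys) then 1 else 0)) \<and>
     (\<forall>a r. a \<le> 2 \<longrightarrow> r \<noteq> u \<longrightarrow> ar \<sigma>' a r = ar \<sigma> a r) \<and> (\<forall>a. 2 < a \<longrightarrow> ar \<sigma>' a = ar \<sigma> a) \<and> ou \<sigma>' = ou \<sigma> \<and>
     tm \<sigma>' \<le> tm \<sigma> + 8 * j + 6" for j \<sigma>'
  have lst: "?lst j \<le> n" for j
  proof (cases "take j ?ys = []")
    case False
    then have "?lst j \<in> set (take j ?ys)" by simp
    then have "?lst j \<in> {..<n}" using ys(3) set_take_subset[of j ?ys] by blast
    then show ?thesis by simp
  qed simp
  have up: "update2 g a b c r = g r" if "r \<noteq> a" for g a b c r using that by (auto simp: update2_def)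
  have upu: "update2 g a b c a = (g a)(b := c)" for g a b c by (auto simp: update2_def fun_eq_iff)
  have W: "WP (WhileNZ 24 (Atom (AIn 25 21) ;; Atom (APut 0 19 23 25) ;; Atom (APut 1 19 25 23) ;; Atom (APut 2 19 25 1) ;;
       Atom (AMove 23 25) ;; Atom (AAdd 21 21 1) ;; Atom (ASub 24 22 21)))
     (WP (Atom (APut 0 19 23 3)) (WP (Atom (APut 1 19 3 23)) Q)) \<sigma>'" if "P 0 \<sigma>'" for \<sigma>'
  proof (rule wp_while[where I = "\<lambda>i \<sigma>'. \<exists>j \<le> length ?ys. i = length ?ys - j \<and> P j \<sigma>'" and ?i0.0 = "length ?ys"], goal_cases)
    case 1
    show ?case using that by (intro exI[of _ 0]) simp
  next
    case (2 i \<sigma>1)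
    then obtain j where j: "j \<le> length ?ys" "i = length ?ys - j" "P j \<sigma>1" by blast
    note P = j(3)[unfolded P_def]
    have jl: "j < length ?ys" using P 2(2) by simp
    have st1: "const_regs \<sigma>1" using const_regs_same_except[OF assms(1)] P by auto
    let ?y = "?ys ! j"
    have ym: "?y \<in> set ?ys" using jl by simp
    then have yn: "?y < n" using ys(3) by auto
    have e: "inp ! (off u + j) = ?y" using inp_entry[OF assms(3) jl] .
    have al: "off u + j < length inp" using ofl ofs jl by simp
    have ab: "Suc (off u + j) < B" using off_n_bd[OF un] ofs jl by simp
    have r1: "rg \<sigma>1 19 = u" using P assms(2) by (simp add: same_except_def)
    have tk: "take (Suc j) ?ys = take j ?ys @ [?y]" using jl by (simp add: take_Suc_conv_app_nth)
    have dtk: "distinct (take j ?ys @ [?y])" "n \<notin> set (take j ?ys @ [?y])"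
      using ys(1,4) unfolding tk[symmetric] by (simp, metis in_set_takeD)
    have os: "open_seg ((ar \<sigma>1 0 u)(?lst j := ?y)) ((ar \<sigma>1 1 u)(?y := ?lst j)) n (take (Suc j) ?ys)"
      unfolding tk by (rule open_seg_snoc) (use P dtk in auto)
    have le2: "(a \<le> 2) = (a = 0)" if "a \<noteq> Suc 0" "a \<noteq> 2" for a :: nat using that by linarith
    have l1: "?lst (Suc j) = ?y" unfolding tk by simp
    let ?\<sigma>2 = "setr 24 (length ?ys - Suc j) (setr 21 (Suc (off u + j)) (setr 23 ?y (setm 2 u ?y 1 (setm 1 u ?y (?lst j)
       (setm 0 u (?lst j) ?y (setr 25 ?y (tick \<sigma>1)))))))"
    have "P (Suc j) ?\<sigma>2"
      unfolding P_def l1 using P os jl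
      by (simp add: same_except_def up upu tk le2)
    moreover have "length ?ys - Suc j < i" using j(2) jl by simp
    ultimately have "\<exists>i'<i. \<exists>j \<le> length ?ys. i' = length ?ys - j \<and> P j ?\<sigma>2" using jl Suc_leI by blast
    then show ?case using const_regsD[OF st1] P r1 e al ab lst[of j] yn ofs by simp
  next
    case (3 i \<sigma>1)
    then obtain j where j: "j \<le> length ?ys" "i = length ?ys - j" "P j \<sigma>1" by blast
    note P = j(3)[unfolded P_def]
    have jl: "j = length ?ys" using P 3(2) j(1) by simp
    have st1: "const_regs \<sigma>1" using const_regs_same_except[OF assms(1)] P by auto
    have r1: "rg \<sigma>1 19 = u" using P assms(2) by (simp add: same_except_def)
    let ?l = "?lst j"
    have sg: "seg ((ar \<sigma>1 0 u)(?l := n)) ((ar \<sigma>1 1 u)(n := ?l)) n ?ys n"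
      using open_seg_close[of "ar \<sigma>1 0 u" "ar \<sigma>1 1 u" n ?ys n] P ys jl by simp
    have "Q (setm 1 u n ?l (setm 0 u ?l n (tick \<sigma>1)))"
    proof (rule assms(5))
      show "row_ok (setm 1 u n ?l (setm 0 u ?l n (tick \<sigma>1))) u"
        unfolding row_ok_def using sg P jl by (simp add: upu)
      show "tm (setm 1 u n ?l (setm 0 u ?l n (tick \<sigma>1))) \<le> tm \<sigma> + 8 * live_deg {} u + 9"
        using P jl al_len_deg[OF assms(3)] by simp
    qed (use P up in \<open>auto simp: same_except_def\<close>)
    then show ?case using const_regsD[OF st1] P r1 lst[of j] by simp
  qed
  have "P 0 (setr 24 (off (Suc u) - off u) (setr 23 n (setr 22 (off (Suc u)) (setr 20 (u + 3) (setr 21 (off u) (setr 20 (u + 2) \<sigma>))))))"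
    unfolding P_def using assms(4) ofs by (simp add: same_except_def)
  from W[OF this] show ?thesis unfolding read_list_def
    using const_regsD[OF assms(1)] assms(2,3) inp_off[of u] inp_off[of "Suc u"] un B_large inp_length off_def[of n]
    by (simp add: numeral_3_eq_3)
qed

lemma wp_setup:
  assumes "\<And>\<sigma>'. const_regs \<sigma>' \<Longrightarrow> adjacency_rep {} (ar \<sigma>' 0) (ar \<sigma>' 1) \<Longrightarrow> (\<And>u w. u < n \<Longrightarrow> w < n \<Longrightarrow> ar \<sigma>' 2 u w = (if adj u w then 1 else 0)) \<Longrightarrow>
     (\<And>a. 2 < a \<Longrightarrow> ar \<sigma>' a = (\<lambda>_ _. 0)) \<Longrightarrow> ou \<sigma>' = [] \<Longrightarrow> tm \<sigma>' \<le> 8 * (\<Sum>u<n. live_deg {} u) + 13 * n + 10 \<Longrightarrow> Q \<sigma>'"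
  shows "WP setup_code Q initial_hstate"
proof -
  let ?\<sigma>0 = "setr 5 (k - 1) (setr 4 k (setr 3 n (setr 2 2 (setr 1 1 initial_hstate))))"
  have st0: "const_regs ?\<sigma>0" unfolding const_regs_def initial_hstate_def by simp
  have "WP (For 18 19 3 read_list) Q ?\<sigma>0"
  proof (rule wp_For[where m = n and I = "\<lambda>j \<sigma>'. same_except {18,19,20,21,22,23,24,25} ?\<sigma>0 \<sigma>' \<and> (\<forall>u<j. row_ok \<sigma>' u) \<and>
      (\<forall>u \<ge> j. \<forall>w. ar \<sigma>' 2 u w = 0) \<and> (\<forall>a. 2 < a \<longrightarrow> ar \<sigma>' a = (\<lambda>_ _. 0)) \<and> ou \<sigma>' = [] \<and>
      tm \<sigma>' \<le> 8 * (\<Sum>u<j. live_deg {} u) + 12 * j + 7"], goal_cases)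
    case (10 j \<sigma>')
    have const_regs': "const_regs \<sigma>'" using const_regs_same_except[OF st0] 10 by auto
    have sr: "row_ok (setr x y \<sigma>1) = row_ok \<sigma>1" "row_ok (tick \<sigma>1) = row_ok \<sigma>1" for x y \<sigma>1 by (auto simp: row_ok_def fun_eq_iff)
    show ?case
    proof (rule wp_read_list[where u = j], goal_cases)
      case (5 \<sigma>1)
      have "row_ok \<sigma>1 u" if "u < Suc j" for u
      proof (cases "u = j")
        case True
        then show ?thesis using 5(2) by simp
      next
        case False
        then have "row_ok (tick \<sigma>') u" using that 10(1) sr by simp
        then show ?thesis using 5(3)[of 0 u] 5(3)[of 1 u] 5(3)[of 2 u] False by (simp add: row_ok_def)
      qed
      then show ?case using 10 5(1,3-6) sr by (simp add: same_except_def)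
    qed (use 10 const_regs' in auto)
  next
    case (11 \<sigma>')
    have const_regs': "const_regs \<sigma>'" using const_regs_same_except[OF st0] 11 by auto
    show ?case
    proof (rule assms)
      show "adjacency_rep {} (ar (tick \<sigma>') 0) (ar (tick \<sigma>') 1)"
        unfolding adjacency_rep_def using 11 al_adj by (auto simp: row_ok_def)
      show "ar (tick \<sigma>') 2 u w = (if adj u w then 1 else 0)" if "u < n" "w < n" for u w
        using 11 al_adj[OF that(1)] that by (simp add: row_ok_def)
    qed (use 11 const_regs' in auto)
  qed (use less_B in \<open>auto simp: same_except_def initial_hstate_def\<close>)
  moreover have "0 < length inp" "Suc 0 < length inp" using inp_length by (simp_all add: off_def)
  ultimately show ?thesis unfolding setup_code_def
    using B_large inp_header by (simp add: initial_hstate_def)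
qed

end

section \<open>The size of the output dominates that of the input\<close>

context alg
begin

definition solutions :: "nat set set" where
  "solutions = {T. T \<subseteq> {..<n} \<and> card T = k \<and> conn T}"

lemma finite_solutions [simp]: "finite solutions"
  by (rule finite_subset[of _ "Pow {..<n}"]) (auto simp: solutions_def)

lemma live_deg_empty: "live_deg {} u = deg_in u {..<n}"
  unfolding live_deg_def deg_in_def by (rule arg_cong[of _ _ card]) (auto dest: adj_less')

text \<open>The two ends of an edge grow to a connected \<open>k\<close>-set, so every edge of a
  connected graph lies in some solution. This pays for reading the input and, with
  \<open>degsum_ge_card\<close>, for all costs per vertex.\<close>

lemma degsum_all_le:
  assumes "conn {..<n}"
  shows "degsum {..<n} \<le> (\<Sum>T \<in> solutions. degsum T)"
proof -
  let ?P = "\<lambda>T. {(u, w). u \<in> T \<and> w \<in> T \<and> adj u w}"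
  have "?P {..<n} \<subseteq> (\<Union>T \<in> solutions. ?P T)"
  proof
    fix e assume "e \<in> ?P {..<n}"
    then obtain u w where e: "e = (u, w)" "u < n" "w < n" "adj u w" by auto
    have "u \<noteq> w" using e(4) adj_irrefl by auto
    then have "card {w, u} \<le> k" using k_ge_2 by simp
    moreover have "conn {w, u}" using conn_insert[OF conn_single[of u], of u w] e(4) by simp
    ultimately obtain T where "{w, u} \<subseteq> T" "T \<subseteq> {..<n}" "conn T" "card T = k"
      using conn_grow[OF assms, of "{w, u}" k] e k_le_n by auto
    then show "e \<in> (\<Union>T \<in> solutions. ?P T)" using e by (auto simp: solutions_def)
  qed
  moreover have "finite (?P T)" if "T \<in> solutions" for T
    by (rule finite_subset[of _ "{..<n} \<times> {..<n}"]) (use that in \<open>auto simp: solutions_def\<close>)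
  ultimately have "card (?P {..<n}) \<le> card (\<Union>T \<in> solutions. ?P T)" by (intro card_mono) auto
  also have "\<dots> \<le> (\<Sum>T \<in> solutions. card (?P T))" by (rule card_UN_le) simp
  also have "\<dots> = (\<Sum>T \<in> solutions. degsum T)"
    by (intro sum.cong refl) (auto simp: degsum_pairs solutions_def finite_subset[of _ "{..<n}"])
  finally show ?thesis using degsum_pairs[of "{..<n}"] by simp
qed

end

context input
begin

lemma main_code_correct:
  assumes "conn {..<n}"
  shows "\<exists>\<sigma>. big_step n B inp main_code initial_hstate \<sigma> \<and> listing adj (ou \<sigma>) solutions \<and> tm \<sigma> \<le> 1800 * (\<Sum>T \<in> solutions. degsum T)"
proof -
  let ?S = "\<Sum>T \<in> solutions. degsum T" and ?V = "degsum {..<n}"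
  have V: "?V \<le> ?S" by (rule degsum_all_le[OF assms])
  have nV: "n \<le> ?V" using degsum_ge_card[OF assms] k_ge_2 k_le_n by simp
  have dV: "(\<Sum>u<n. live_deg {} u) = ?V" unfolding degsum_def by (simp add: live_deg_empty)
  have "WP main_code (\<lambda>\<sigma>. listing adj (ou \<sigma>) solutions \<and> tm \<sigma> \<le> 1800 * ?S) initial_hstate"
    unfolding main_code_def wp_seq
  proof (rule wp_setup)
    fix \<sigma>1 assume 1: "const_regs \<sigma>1" "adjacency_rep {} (ar \<sigma>1 0) (ar \<sigma>1 1)"
      "\<And>u w. u < n \<Longrightarrow> w < n \<Longrightarrow> ar \<sigma>1 2 u w = (if adj u w then 1 else 0)"
      "\<And>a. 2 < a \<Longrightarrow> ar \<sigma>1 a = (\<lambda>_ _. 0)" "ou \<sigma>1 = []" "tm \<sigma>1 \<le> 8 * (\<Sum>u<n. live_deg {} u) + 13 * n + 10"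
    show "WP (For 28 16 3 root_code) (\<lambda>\<sigma>. listing adj (ou \<sigma>) solutions \<and> tm \<sigma> \<le> 1800 * ?S) \<sigma>1"
    proof (rule wp_For[where m = n and I = "\<lambda>j \<sigma>. \<exists>X D. root_inv j X D \<sigma>"], goal_cases)
      case 9
      have i0: "marks {} = (\<lambda>_ _. 0)" by (simp add: marks_def fun_eq_iff)
      have H0: "hitting {} = {}" by (simp add: hitting_def)
      have "root_inv 0 {} {} (setr 28 n (setr 16 0 \<sigma>1))"
        unfolding root_inv_def using 1 i0 H0 by simp
      then show ?case by blast
    next
      case (10 j \<sigma>)
      then obtain X D where R: "root_inv j X D \<sigma>" by blast
      show ?case
      proof (rule wp_root[OF R 10(2,3)])
        fix \<sigma>' X' D' assume a: "root_inv (Suc j) X' D' \<sigma>'" "rg \<sigma>' 16 = j" "tm \<sigma>' + 14 \<le> root_bound (Suc j) X' D'"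
        have "root_inv (Suc j) X' D' (setr 28 (n - Suc j) (setr 16 (Suc j) \<sigma>'))"
          by (rule root_inv_shift[OF a(1)]) (use a(3) in linarith)
        then show "rg \<sigma>' 16 = j \<and> rg \<sigma>' 3 = n \<and> rg \<sigma>' 1 = 1 \<and>
            (\<exists>X D. root_inv (Suc j) X D (setr 28 (n - Suc j) (setr 16 (Suc j) \<sigma>')))"
          using a(2) const_regsD[OF root_invD(1)[OF a(1)]] by auto
      qed
    next
      case (11 \<sigma>)
      then obtain X D where R: "root_inv n X D \<sigma>" by blast
      note R' = root_invD[OF R]
      have H: "hitting X = solutions"
      proof (intro equalityI subsetI)
        fix T assume T: "T \<in> solutions"
        \<comment> \<open>A solution that contains no root would consist of vertices in
          \<open>D\<close>, from which no solution can be reached.\<close>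
        have "T \<inter> X \<noteq> {}"
        proof
          assume e: "T \<inter> X = {}"
          obtain x where x: "x \<in> T" using T by (auto simp: solutions_def conn_def)
          then have "x \<in> D" using T e R'(9) by (auto simp: solutions_def)
          moreover have "T \<in> completions {x} X" using T e x by (auto simp: solutions_def completions_def)
          ultimately show False using R'(11) by blast
        qed
        then show "T \<in> hitting X" using T by (simp add: solutions_def hitting_def)
      qed (auto simp: solutions_def hitting_def)
      have sub: "sum f A \<le> sum f {..<n}" if "A \<subseteq> {..<n}" for f :: "nat \<Rightarrow> nat" and A
        using that by (intro sum_mono2) auto
      have "(\<Sum>u \<in> D. live_deg {} u + 1) \<le> ?V + n"
        using sub[OF R'(8), of "\<lambda>u. live_deg {} u + 1"] dV by (simp add: sum_Suc)
      moreover have "(\<Sum>u \<in> X. live_deg {} u) \<le> ?V" using sub[OF R'(7)] dV by metis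
      \<comment> \<open>With \<open>n <= ?V <= ?S\<close>, all terms outside the solutions add less
        than 284 times \<open>?S\<close> to 1516 times \<open>?S\<close>.\<close>
      ultimately have "tm \<sigma> + 2 \<le> 1800 * ?S"
        using R'(14) V nV k_ge_2 k_le_n unfolding H dV by linarith
      then show ?case using R'(13) H by simp
    qed (use 1 const_regsD[OF 1(1)] less_B in auto)
  qed
  then show ?thesis by (auto simp: wp_def)
qed

end

section \<open>The theorem\<close>

text \<open>A path between the two sides of a cut crosses it; conversely, the set of vertices
  reachable from \<open>u\<close> is a cut that no edge leaves.\<close>

lemma connected_induced_iff:
  assumes "simple_graph Gr" "T \<subseteq> fst Gr" "kgraph n k adj" "\<And>u v. adj u v \<longleftrightarrow> {u, v} \<in> snd Gr"
  shows "connected_graph (induced_subgraph Gr T) \<longleftrightarrow> kgraph.conn adj T"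
proof -
  interpret kgraph n k adj by fact
  let ?R = "{(x, y). {x, y} \<in> induced_edges Gr T}"
  have R: "(x, y) \<in> ?R \<longleftrightarrow> adj x y \<and> x \<in> T \<and> y \<in> T" for x y
  proof
    assume "(x, y) \<in> ?R"
    then obtain u v where uv: "{x, y} = {u, v}" "{u, v} \<in> snd Gr" "u \<in> T" "v \<in> T"
      unfolding induced_edges_def by blast
    have "{x, y} \<in> snd Gr" unfolding uv(1) by (rule uv(2))
    then have "adj x y" unfolding assms(4) .
    moreover have "x \<in> T" "y \<in> T" using uv(1,3,4) by (auto simp: doubleton_eq_iff)
    ultimately show "adj x y \<and> x \<in> T \<and> y \<in> T" by simp
  next
    assume "adj x y \<and> x \<in> T \<and> y \<in> T"
    then have "{x, y} \<in> snd Gr \<and> x \<in> T \<and> y \<in> T" unfolding assms(4) .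
    then show "(x, y) \<in> ?R" unfolding induced_edges_def by blast
  qed
  have "(\<forall>u \<in> T. \<forall>v \<in> T. (u, v) \<in> ?R\<^sup>*) \<longleftrightarrow>
     (\<forall>A. A \<subseteq> T \<longrightarrow> A \<noteq> {} \<longrightarrow> A \<noteq> T \<longrightarrow> (\<exists>x \<in> A. \<exists>y \<in> T - A. adj x y))" (is "?L \<longleftrightarrow> ?C")
  proof
    assume L: ?L
    show ?C
    proof (intro allI impI, rule ccontr)
      fix A assume A: "A \<subseteq> T" "A \<noteq> {}" "A \<noteq> T" "\<not> (\<exists>x \<in> A. \<exists>y \<in> T - A. adj x y)"
      then obtain u v where uv: "u \<in> A" "v \<in> T - A" by blast
      have "u \<in> T" "v \<in> T" using uv A(1) by auto
      then have "(u, v) \<in> ?R\<^sup>*" by (rule L[rule_format])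
      then have "v \<in> A"
      proof (induction rule: rtrancl_induct)
        case base
        show ?case by (rule uv(1))
      next
        case (step y z)
        have "adj y z" "z \<in> T" using R[THEN iffD1, OF step.hyps(2)] by simp_all
        then show ?case using step.IH A(4) by blast
      qed
      then show False using uv(2) by simp
    qed
  next
    assume C: ?C
    show ?L
    proof (intro ballI, rule ccontr)
      fix u v assume u: "u \<in> T" and v: "v \<in> T" and n: "(u, v) \<notin> ?R\<^sup>*"
      let ?A = "{x \<in> T. (u, x) \<in> ?R\<^sup>*}"
      have uA: "u \<in> ?A" using u by simp
      have vA: "v \<notin> ?A" using n by simp
      have "?A \<subseteq> T" "?A \<noteq> {}" "?A \<noteq> T" using v uA vA by fast+
      then have "\<exists>x \<in> ?A. \<exists>y \<in> T - ?A. adj x y" by (rule C[rule_format])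
      then obtain x y where xy: "x \<in> ?A" "y \<in> T - ?A" "adj x y" by blast
      then have "(x, y) \<in> ?R" by (intro R[THEN iffD2]) simp
      then have "(u, y) \<in> ?R\<^sup>*" using xy(1) rtrancl_into_rtrancl[of u x ?R y] by simp
      then show False using xy(2) by simp
    qed
  qed
  then show ?thesis unfolding connected_graph_def conn_def induced_subgraph_def fst_conv snd_conv by (rule conj_cong[OF refl])
qed

lemma (in kgraph) degsum_le_edges:
  assumes "finite T"
  shows "degsum T \<le> 2 * card (edges_within adj T)"
proof -
  let ?P1 = "{(u, w). u \<in> T \<and> w \<in> T \<and> adj u w \<and> u < w}" and ?P2 = "{(u, w). u \<in> T \<and> w \<in> T \<and> adj u w \<and> w < u}"
  let ?f = "\<lambda>(u, w). {u, w} :: nat set"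
  have ne: "u < w \<or> w < u" if "adj u w" for u w
  proof -
    have "u \<noteq> w" using that adj_irrefl[of u] by blast
    then show ?thesis by linarith
  qed
  have fE: "finite (edges_within adj T)"
    by (rule finite_subset[of _ "Pow T"]) (use assms in \<open>auto simp: edges_within_def\<close>)
  have fP: "finite ?P1" "finite ?P2" by (rule finite_subset[of _ "T \<times> T"]; use assms in auto)+
  have "card ?P1 \<le> card (edges_within adj T)" "card ?P2 \<le> card (edges_within adj T)"
    by (rule card_inj_on_le[of ?f, OF _ _ fE]; auto simp: inj_on_def edges_within_def doubleton_eq_iff)+
  moreover have "degsum T \<le> card ?P1 + card ?P2"
  proof -
    have "{(u, w). u \<in> T \<and> w \<in> T \<and> adj u w} = ?P1 \<union> ?P2"
      using ne by blast
    then have "degsum T = card (?P1 \<union> ?P2)" using degsum_pairs[OF assms] by simp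
    then show ?thesis by (simp only: card_Un_le)
  qed
  ultimately show ?thesis by linarith
qed

text \<open>The word capacity is a pure power of \<open>n\<close>, so constant factors are absorbed
  through \<open>2 <= n\<close>: 32 into \<open>n ^ 5\<close>, which gives the exponent 7 for
  \<open>B\<close>, and 64 into \<open>n ^ 6\<close>, which leads from 9 to 15.\<close>

lemma power_bounds:
  assumes "2 \<le> (n::nat)"
  shows "n * n + 2 * n + 100 < n ^ 7" "16 * (n ^ 7 * (n + 1) + n + n * n + 4) \<le> n ^ 15"
proof -
  have p: "2 ^ i \<le> n ^ i" for i using assms by (rule power_mono) simp
  have "n * n + 2 * n + 100 < 32 * (n * n)"
  proof -
    have "2 * n \<le> n * n" "4 \<le> n * n" using assms mult_le_mono[OF assms assms] by auto
    then show ?thesis by linarith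
  qed
  also have "\<dots> \<le> n ^ 5 * (n * n)" using p[of 5] by (intro mult_le_mono1) simp
  also have "\<dots> = n ^ 7" by (simp add: power_numeral_reduce)
  finally show "n * n + 2 * n + 100 < n ^ 7" .
  have a: "n + 1 \<le> n ^ 2"
  proof -
    have "2 * n \<le> n * n" using assms by simp
    then have "n + 1 \<le> n * n" using assms by linarith
    then show ?thesis by (simp add: power2_eq_square)
  qed
  have "n ^ 7 * (n + 1) \<le> n ^ 7 * n ^ 2" using a by (rule mult_le_mono2)
  then have b: "n ^ 7 * (n + 1) \<le> n ^ 9" by (simp add: power_add[symmetric])
  have c: "n + n * n + 4 \<le> 3 * n ^ 9"
  proof -
    have "n ^ 1 \<le> n ^ 9" "n ^ 2 \<le> n ^ 9" by (rule power_increasing; use assms in simp)+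
    moreover have "4 \<le> n ^ 9" using p[of 9] by simp
    ultimately show ?thesis unfolding power2_eq_square power_one_right by linarith
  qed
  have "n ^ 7 * (n + 1) + (n + n * n + 4) \<le> 4 * n ^ 9" using add_mono[OF b c] by simp
  then have "n ^ 7 * (n + 1) + n + n * n + 4 \<le> 4 * n ^ 9" by (simp only: add.assoc)
  then have "16 * (n ^ 7 * (n + 1) + n + n * n + 4) \<le> 16 * (4 * n ^ 9)" by (rule mult_le_mono2)
  also have "\<dots> = 2 ^ 6 * n ^ 9" by simp
  also have "\<dots> \<le> n ^ 6 * n ^ 9" by (intro mult_le_mono1 p)
  also have "\<dots> = n ^ 15" by (simp add: power_add[symmetric])
  finally show "16 * (n ^ 7 * (n + 1) + n + n * n + 4) \<le> n ^ 15" .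
qed

lemma kgraph_of_graph:
  assumes "simple_graph Gr" "fst Gr = {0..<n}" "2 \<le> k" "k \<le> n"
  shows "kgraph n k (\<lambda>u v. {u, v} \<in> snd Gr)"
proof
  have e: "u < n \<and> v < n \<and> u \<noteq> v" if uv: "{u, v} \<in> snd Gr" for u v
  proof -
    have "\<forall>e \<in> snd Gr. \<exists>u \<in> fst Gr. \<exists>v \<in> fst Gr. u \<noteq> v \<and> e = {u, v}"
      using assms(1) unfolding simple_graph_def by (rule conjunct2)
    from bspec[OF this uv] obtain a b where ab: "a \<in> fst Gr" "b \<in> fst Gr" "a \<noteq> b" "{u, v} = {a, b}"
      by (elim bexE conjE)
    then have "(u = a \<and> v = b) \<or> (u = b \<and> v = a)" by (simp only: doubleton_eq_iff)
    then show ?thesis using ab(1-3) unfolding assms(2) by auto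
  qed
  show "{v, u} \<in> snd Gr" if "{u, v} \<in> snd Gr" for u v using that by (simp only: insert_commute)
  show "{u, u} \<notin> snd Gr" for u using e[of u u] by auto
  show "u < n" if "{u, v} \<in> snd Gr" for u v using e[OF that] by simp
qed (rule assms)+

theorem theorem4p1:
  "\<exists>(P :: instr list) (c :: nat) (d :: nat).
     \<forall>(G :: nat ugraph) (n :: nat) (k :: nat) (adj :: nat list list).
       simple_graph G \<and> connected_graph G \<and> card (fst G) = n \<and> 2 \<le> k \<and> k \<le> n \<and>
       adjacency_lists G adj \<longrightarrow>
       (\<exists>t ys. ram_run (n ^ d) P (encode_input k adj) t ys \<and>
          lists_exactly_once ys (k_subgraphs k G) \<and>
          t \<le> c * (\<Sum>H \<in> k_subgraphs k G. card (snd H)))"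
\<comment> \<open>8 machine steps per unit of time, 1800 units per unit of degree sum and two
  degrees per edge make 28800; the remaining steps of the prologue fit into 40000. The exponent 15
  comes from \<open>power_bounds\<close>.\<close>
proof (rule exI[of _ "program main_code"], rule exI[of _ 40000], rule exI[of _ 15], intro allI impI)
  fix Gr :: "nat ugraph" and n k :: nat and al :: "nat list list"
  assume A: "simple_graph Gr \<and> connected_graph Gr \<and> card (fst Gr) = n \<and> 2 \<le> k \<and> k \<le> n \<and> adjacency_lists Gr al"
  let ?adj = "\<lambda>u v. {u, v} \<in> snd Gr" and ?inp = "encode_input k al"
  have sg: "simple_graph Gr" and cg: "connected_graph Gr" and cn: "card (fst Gr) = n" and k: "2 \<le> k" "k \<le> n"
    and al: "adjacency_lists Gr al" using A by blast+
  have al': "fst Gr = {0..<length al}"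
    "\<And>v. v < length al \<Longrightarrow> distinct (al ! v) \<and> set (al ! v) = {u. {u, v} \<in> snd Gr}"
    using al unfolding adjacency_lists_def by blast+
  have V: "fst Gr = {0..<length al}" "length al = n" using al'(1) cn by simp_all
  then have V': "fst Gr = {..<n}" by (simp add: lessThan_atLeast0)
  have n2: "2 \<le> n" using k by linarith
  have kg: "kgraph n k ?adj" using kgraph_of_graph[OF sg _ k] V by simp
  interpret alg n k ?adj "n ^ 7" ?inp
    by (rule alg.intro[OF kg], rule alg_axioms.intro, rule power_bounds(1)[OF n2])
  interpret input n k ?adj "n ^ 7" ?inp al
  proof
    show "length al = n" by (rule V(2))
    show "distinct (al ! v) \<and> set (al ! v) = {w. {v, w} \<in> snd Gr}" if "v < n" for v
      using al'(2)[of v] that V(2) by (simp add: insert_commute)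
  qed simp
  have whole: "induced_subgraph Gr {..<n} = Gr"
  proof -
    have "induced_edges Gr {..<n} = snd Gr"
    proof (intro equalityI subsetI)
      fix e assume e: "e \<in> snd Gr"
      then obtain u v where "u \<in> fst Gr" "v \<in> fst Gr" "e = {u, v}" using sg unfolding simple_graph_def by blast
      then show "e \<in> induced_edges Gr {..<n}" using e V' unfolding induced_edges_def by auto
    qed (auto simp: induced_edges_def)
    then show ?thesis using V' by (simp add: induced_subgraph_def prod_eq_iff)
  qed
  have ci: "connected_graph (induced_subgraph Gr T) \<longleftrightarrow> conn T" if "T \<subseteq> {..<n}" for T
    using connected_induced_iff[OF _ _ kg, of Gr T] sg that V' by simp
  have "conn {..<n}" using ci[of "{..<n}"] whole cg by simp
  from main_code_correct[OF this] obtain \<sigma> where \<sigma>: "big_step n (n ^ 7) ?inp main_code initial_hstate \<sigma>" "listing ?adj (ou \<sigma>) solutions"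
    "tm \<sigma> \<le> 1800 * (\<Sum>T \<in> solutions. degsum T)" by blast
  have ks: "k_subgraphs k Gr = induced_subgraph Gr ` solutions"
  proof (intro equalityI subsetI)
    fix H assume "H \<in> k_subgraphs k Gr"
    then obtain T where T: "H = induced_subgraph Gr T" "T \<subseteq> {..<n}" "card T = k" "connected_graph (induced_subgraph Gr T)"
      unfolding k_subgraphs_def V' by blast
    then have "T \<in> solutions" unfolding solutions_def using ci[OF T(2)] by simp
    then show "H \<in> induced_subgraph Gr ` solutions" unfolding T(1) by (rule imageI)
  next
    fix H assume "H \<in> induced_subgraph Gr ` solutions"
    then obtain T where T: "H = induced_subgraph Gr T" "T \<subseteq> {..<n}" "card T = k" "conn T"
      unfolding solutions_def by blast
    have "connected_graph (induced_subgraph Gr T)" using ci[OF T(2)] T(4) by simp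
    then show "H \<in> k_subgraphs k Gr" unfolding k_subgraphs_def V' using T(1-3) by blast
  qed
  have inj: "inj_on (induced_subgraph Gr) solutions" by (auto simp: inj_on_def induced_subgraph_def)
  have ie: "snd (induced_subgraph Gr T) = edges_within ?adj T" for T
    by (simp add: induced_subgraph_def induced_edges_def edges_within_def)
  have lay: "layout (n ^ 15) n (n ^ 7) ?inp"
  proof
    show "16 * (n ^ 7 * (n + 1) + n + n * n + 4) \<le> n ^ 15" by (rule power_bounds(2)[OF n2])
    show "length ?inp \<le> n * n + 3" using inp_length off_bd by simp
    have kB: "k < n ^ 7" "n < n ^ 7" using B_large k_le_n by linarith+
    show "\<forall>x \<in> set ?inp. x < n ^ 7"
    proof
      fix x assume x: "x \<in> set ?inp"
      have "x \<in> set [length al, k] \<or> x \<in> set (map (\<lambda>v. length al + 3 + length (concat (take v al))) [0..<length al + 1]) \<or>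
          x \<in> set (concat al)"
        using x unfolding encode_input_def by (simp only: set_append Un_iff)
      then show "x < n ^ 7"
      proof (elim disjE)
        assume "x \<in> set [length al, k]"
        then show ?thesis using kB V(2) by auto
      next
        assume "x \<in> set (map (\<lambda>v. length al + 3 + length (concat (take v al))) [0..<length al + 1])"
        then obtain v where "v < length al + 1" "x = length al + 3 + length (concat (take v al))"
          unfolding set_map set_upt by (elim imageE) simp
        then have "v \<le> n" "x = off v" unfolding off_def V(2) by simp_all
        then show ?thesis using off_n_bd by simp
      next
        assume "x \<in> set (concat al)"
        then obtain ys where "ys \<in> set al" "x \<in> set ys" by (simp only: set_concat UN_iff) (elim bexE)
        then obtain v where "v < n" "x \<in> set (al ! v)" using V(2) unfolding in_set_conv_nth[of ys] by (elim exE conjE) simp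
        then have "x < n" using al_bd by simp
        then show ?thesis using kB by linarith
      qed
    qed
  qed
  have "0 < n ^ 7" using n2 by simp
  moreover have "0 < length ?inp" using inp_length by (simp add: off_def)
  ultimately obtain t where t: "ram_run (n ^ 15) (program main_code) ?inp t (ou \<sigma>)" "t \<le> 8 * tm \<sigma> + 8"
    using program_correct[OF lay _ _ inp_header(1) \<sigma>(1)] by blast
  have once: "lists_exactly_once (ou \<sigma>) (k_subgraphs k Gr)"
  proof -
    obtain Ts ess where L: "distinct Ts" "set Ts = solutions" "list_all2 (\<lambda>T es. lists_edges es (edges_within ?adj T)) Ts ess"
      "ou \<sigma> = concat (map encode_edges ess)" using \<sigma>(2) by (auto simp: listing_def)
    have "distinct (map (induced_subgraph Gr) Ts)" using L(1,2) inj by (simp add: distinct_map)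
    moreover have "set (map (induced_subgraph Gr) Ts) = k_subgraphs k Gr" using L(2) ks by simp
    moreover have "list_all2 (\<lambda>H es. lists_edges es (snd H)) (map (induced_subgraph Gr) Ts) ess"
      using L(3) by (simp add: list_all2_map1 ie)
    ultimately show ?thesis unfolding lists_exactly_once_def using L(4) by blast
  qed
  have "t \<le> 40000 * (\<Sum>H \<in> k_subgraphs k Gr. card (snd H))"
  proof -
    have "(\<Sum>T \<in> solutions. degsum T) \<le> (\<Sum>T \<in> solutions. 2 * card (edges_within ?adj T))"
      using degsum_le_edges finite_subset[of _ "{..<n}"] by (intro sum_mono) (auto simp: solutions_def)
    also have "\<dots> = 2 * (\<Sum>H \<in> k_subgraphs k Gr. card (snd H))"
      unfolding ks by (simp add: sum.reindex[OF inj] ie sum_distrib_left)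
    finally have a: "(\<Sum>T \<in> solutions. degsum T) \<le> 2 * (\<Sum>H \<in> k_subgraphs k Gr. card (snd H))" .
    have "n \<le> (\<Sum>T \<in> solutions. degsum T)"
      using degsum_all_le[OF \<open>conn {..<n}\<close>] degsum_ge_card[OF \<open>conn {..<n}\<close>] n2 by simp
    then show ?thesis using a t(2) \<sigma>(3) n2 by linarith
  qed
  then show "\<exists>t ys. ram_run (n ^ 15) (program main_code) ?inp t ys \<and> lists_exactly_once ys (k_subgraphs k Gr) \<and>
      t \<le> 40000 * (\<Sum>H \<in> k_subgraphs k Gr. card (snd H))"
    using t(1) once by blast
qed

end
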